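(* Let $A\subset\mathbb R^q$ be Borel with $p_A:=\mathbb P(\mathbf Z\in A)>0$ and assume the conditional copula $C(\cdot|A)$ is continuously differentiable on $[0,1]^p$. Let $M\ge 2$. Then the process $$\mathcal C_{n,M,A}(\mathbf u_0,\dots,\mathbf u_M):=\big(\overline{\mathbb C}_n(\mathbf u_0|A),\overline{\mathbb C}^*_{n,1}(\mathbf u_1|A),\dots,\overline{\mathbb C}^*_{n,M}(\mathbf u_M|A)\big)$$ converges weakly in $\ell^\infty([0,1]^{p(M+1)},\mathbb R^{M+1})$ to a process concatenating $M+1$ independent copies of the centered Gaussian process $$\mathbb C_\infty(\mathbf u|A):=\frac{\mathbb B(\mathbf u,A)}{p_A}-\sum_{k=1}^p\frac{\partial_kD(\mathbf u,A)}{p_A^2}\Big(\mathbb B\big((u_k,\mathbf 1_{-k}),A\big)-u_k\mathbb B(\mathbf 1,A)\Big)-\frac{D(\mathbf u,A)}{p_A^2}\mathbb B(\mathbf 1,A),$$ where $\mathbb B(\cdot,A)$ is centered Gaussian with covariance $\mathbb E[\mathbb B(\mathbf u,A)\mathbb B(\mathbf u',A)]=p_AC(\mathbf u\wedge\mathbf u'|A)-p_A^2C(\mathbf u|A)C(\mathbf u'|A)$.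
   Context: Let $(\mathbf X,\mathbf Z)$ be a random vector in $\mathbb R^p\times\mathbb R^q$ with i.i.d. copies $(\mathbf X_i,\mathbf Z_i)_{i\le n}$. Vector inequalities and $\wedge$ are componentwise. Conditional margins $F_k(t|A):=\mathbb P(X_k\le t\mid\mathbf Z\in A)$ are continuous (standing assumption); $C(\cdot|A)$ is the conditional copula of $\mathbf X$ given $\mathbf Z\in A$; $\mathbf U^A:=(F_1(X_1|A),\dots,F_p(X_p|A))$; $D(\mathbf u,A):=\mathbb P(\mathbf U^A\le\mathbf u,\mathbf Z\in A)=p_AC(\mathbf u|A)$, and $\partial_kD$ is its partial derivative in $u_k$. $(u_k,\mathbf 1_{-k})$ has $k$-th coordinate $u_k$ and others $1$. Empirical: $\hat p_A:=n^{-1}\sum_i\mathbf 1(\mathbf Z_i\in A)$, $F_{n,k}(t|A):=\frac1{n\hat p_A}\sum_i\mathbf 1(X_{i,k}\le t,\mathbf Z_i\in A)$, $F^{-1}(u):=\inf\{t:F(t)\ge u\}$, $\overline C_n(\mathbf u|A):=\frac1{n\hat p_A}\sum_i\mathbf 1(X_{i,k}\le F^{-1}_{n,k}(u_k|A)\,\forall k,\mathbf Z_i\in A)$, $\overline{\mathbb C}_n(\mathbf u|A):=\sqrt n(\overline C_n-C)(\mathbf u|A)$. Nonparametric bootstrap: $(\mathbf X^*_i,\mathbf Z^*_i)_{i\le n}$ is drawn with replacement (uniformly, $n$ times) from the original sample; $\hat p^*_A$, $F^*_{n,k}(\cdot|A)$ and $\overline C^*_n(\mathbf u|A):=\frac1{n\hat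 p^*_A}\sum_i\mathbf 1(X^*_{i,k}\le (F^*_{n,k})^{-1}(u_k|A)\,\forall k,\mathbf Z^*_i\in A)$ are the same quantities computed on the bootstrap sample, and $\overline{\mathbb C}^*_n(\mathbf u|A):=\sqrt n(\overline C^*_n-\overline C_n)(\mathbf u|A)$. $\overline{\mathbb C}^*_{n,1},\dots,\overline{\mathbb C}^*_{n,M}$ come from $M$ independent bootstrap resamples. *)

theory Defs
  imports "HOL-Probability.Probability"
begin

definition unit_cube :: "(real^'p) set" where
  "unit_cube = {u. \<forall>k. 0 \<le> u $ k \<and> u $ k \<le> 1}"

definition pA :: "'a measure \<Rightarrow> ('a \<Rightarrow> real^'q) \<Rightarrow> (real^'q) set \<Rightarrow> real" where
  "pA P Z A = measure P {\<omega>\<in>space P. Z \<omega> \<in> A}"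

definition condF :: "'a measure \<Rightarrow> ('a \<Rightarrow> real^'p) \<Rightarrow> ('a \<Rightarrow> real^'q) \<Rightarrow> (real^'q) set
    \<Rightarrow> 'p \<Rightarrow> real \<Rightarrow> real" where
  "condF P X Z A k t = measure P {\<omega>\<in>space P. X \<omega> $ k \<le> t \<and> Z \<omega> \<in> A} / pA P Z A"

definition condD :: "'a measure \<Rightarrow> ('a \<Rightarrow> real^'p) \<Rightarrow> ('a \<Rightarrow> real^'q) \<Rightarrow> (real^'q) set
    \<Rightarrow> real^'p \<Rightarrow> real" where
  "condD P X Z A u =
     measure P {\<omega>\<in>space P. (\<forall>k. condF P X Z A k (X \<omega> $ k) \<le> u $ k) \<and> Z \<omega> \<in> A}"

text \<open>Conditional copula \<open>C(u|A) = D(u,A)/p_A\<close> (continuous conditional margins).\<close>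
definition condC :: "'a measure \<Rightarrow> ('a \<Rightarrow> real^'p) \<Rightarrow> ('a \<Rightarrow> real^'q) \<Rightarrow> (real^'q) set
    \<Rightarrow> real^'p \<Rightarrow> real" where
  "condC P X Z A u = condD P X Z A u / pA P Z A"

text \<open>A sample is a map \<open>s :: nat \<Rightarrow> (real^'p) \<times> (real^'q)\<close>; only \<open>s 0, \<dots>, s (n-1)\<close> are used.\<close>

definition emp_pA :: "nat \<Rightarrow> (nat \<Rightarrow> (real^'p) \<times> (real^'q)) \<Rightarrow> (real^'q) set \<Rightarrow> real" where
  "emp_pA n s A = (\<Sum>i<n. if snd (s i) \<in> A then 1 else 0) / real n"

definition emp_F :: "nat \<Rightarrow> (nat \<Rightarrow> (real^'p) \<times> (real^'q)) \<Rightarrow> (real^'q) set \<Rightarrow> 'p \<Rightarrow> real \<Rightarrow> real" where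
  "emp_F n s A k t =
     (\<Sum>i<n. if fst (s i) $ k \<le> t \<and> snd (s i) \<in> A then 1 else 0) / (real n * emp_pA n s A)"

text \<open>Generalized inverse \<open>F^{-1}(u) = inf {t. F t \<ge> u}\<close>, valued in the extended reals
  (so that it is \<open>-\<infinity>\<close> for \<open>u \<le> 0\<close>, and \<open>+\<infinity>\<close> for the empty set).\<close>
definition ginv :: "(real \<Rightarrow> real) \<Rightarrow> real \<Rightarrow> ereal" where
  "ginv F u = Inf {ereal t | t. F t \<ge> u}"

definition emp_copula :: "nat \<Rightarrow> (nat \<Rightarrow> (real^'p) \<times> (real^'q)) \<Rightarrow> (real^'q) set \<Rightarrow> real^'p \<Rightarrow> real" where
  "emp_copula n s A u =
     (\<Sum>i<n. if (\<forall>k. ereal (fst (s i) $ k) \<le> ginv (emp_F n s A k) (u $ k)) \<and> snd (s i) \<in> A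
             then 1 else 0) / (real n * emp_pA n s A)"

text \<open>Elements of \<open>\<ell>^\<infinity>(T)\<close> with \<open>T \<subseteq> nat \<times> real^'p\<close> are represented by functions
  \<open>nat \<Rightarrow> real^'p \<Rightarrow> real\<close>, bounded on T, with the sup (pseudo)distance over T.\<close>

definition linf :: "(nat \<times> (real^'p)) set \<Rightarrow> (nat \<Rightarrow> real^'p \<Rightarrow> real) set" where
  "linf T = {f. bdd_above ((\<lambda>(m,u). \<bar>f m u\<bar>) ` T)}"

definition sup_dist :: "(nat \<times> (real^'p)) set \<Rightarrow> (nat \<Rightarrow> real^'p \<Rightarrow> real) \<Rightarrow> (nat \<Rightarrow> real^'p \<Rightarrow> real) \<Rightarrow> real" where
  "sup_dist T f g = (SUP x\<in>T. \<bar>f (fst x) (snd x) - g (fst x) (snd x)\<bar>)"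

definition bcont_linf :: "(nat \<times> (real^'p)) set \<Rightarrow> ((nat \<Rightarrow> real^'p \<Rightarrow> real) \<Rightarrow> real) \<Rightarrow> bool" where
  "bcont_linf T h \<longleftrightarrow>
     (\<exists>B. \<forall>f\<in>linf T. \<bar>h f\<bar> \<le> B) \<and>
     (\<forall>f\<in>linf T. \<forall>e>0. \<exists>d>0. \<forall>g\<in>linf T. sup_dist T f g < d \<longrightarrow> \<bar>h f - h g\<bar> < e)"

definition outer_exp :: "'a measure \<Rightarrow> ('a \<Rightarrow> real) \<Rightarrow> real" where
  "outer_exp P f = Inf {integral\<^sup>L P U | U. integrable P U \<and> (\<forall>\<omega>\<in>space P. f \<omega> \<le> U \<omega>)}"

text \<open>\<open>X_n \<leadsto> G\<close> in \<open>\<ell>^\<infinity>(T)\<close>: G is a (Borel) random element on N and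
  \<open>E^* h(X_n) \<rightarrow> E h(G)\<close> for every bounded continuous h.\<close>
definition weak_conv_linf ::
  "(nat \<times> (real^'p)) set \<Rightarrow> 'a measure \<Rightarrow> (nat \<Rightarrow> 'a \<Rightarrow> (nat \<Rightarrow> real^'p \<Rightarrow> real))
     \<Rightarrow> 'b measure \<Rightarrow> ('b \<Rightarrow> (nat \<Rightarrow> real^'p \<Rightarrow> real)) \<Rightarrow> bool" where
  "weak_conv_linf T P Xn N G \<longleftrightarrow>
     (\<forall>h. bcont_linf T h \<longrightarrow>
        (\<lambda>\<omega>. h (G \<omega>)) \<in> borel_measurable N \<and>
        (\<lambda>n. outer_exp P (\<lambda>\<omega>. h (Xn n \<omega>))) \<longlonglongrightarrow> integral\<^sup>L N (\<lambda>\<omega>. h (G \<omega>)))"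

definition gaussian_rv :: "'b measure \<Rightarrow> ('b \<Rightarrow> real) \<Rightarrow> bool" where
  "gaussian_rv N Y \<longleftrightarrow> Y \<in> borel_measurable N \<and>
     ((\<exists>\<mu> \<sigma>. \<sigma> > 0 \<and> distributed N lborel Y (\<lambda>x. ennreal (normal_density \<mu> \<sigma> x)))
      \<or> (\<exists>c. AE \<omega> in N. Y \<omega> = c))"

definition centered_gaussian_process ::
  "'b measure \<Rightarrow> ('b \<Rightarrow> 'i \<Rightarrow> real) \<Rightarrow> 'i set \<Rightarrow> ('i \<Rightarrow> 'i \<Rightarrow> real) \<Rightarrow> bool" where
  "centered_gaussian_process N B S K \<longleftrightarrow>
     (\<forall>F c. finite F \<and> F \<subseteq> S \<longrightarrow> gaussian_rv N (\<lambda>\<omega>. \<Sum>u\<in>F. c u * B \<omega> u)) \<and>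
     (\<forall>u\<in>S. integrable N (\<lambda>\<omega>. B \<omega> u) \<and> integral\<^sup>L N (\<lambda>\<omega>. B \<omega> u) = 0) \<and>
     (\<forall>u\<in>S. \<forall>v\<in>S. integrable N (\<lambda>\<omega>. B \<omega> u * B \<omega> v) \<and>
                    integral\<^sup>L N (\<lambda>\<omega>. B \<omega> u * B \<omega> v) = K u v)"


text \<open>The joint process \<open>(\<overline>\<bbbC>_n(\<cdot>|A), \<overline>\<bbbC>^*_{n,1}(\<cdot>|A), \<dots>, \<overline>\<bbbC>^*_{n,M}(\<cdot>|A))\<close>
  at sample size n, component index m (0 = original sample, m \<ge> 1 = m-th bootstrap resample).
  \<open>J (n,m,i)\<close> is the index of the original observation drawn as i-th bootstrap observation
  in the m-th resample of size n.\<close>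
definition copula_proc ::
  "'a measure \<Rightarrow> (nat \<Rightarrow> 'a \<Rightarrow> real^'p) \<Rightarrow> (nat \<Rightarrow> 'a \<Rightarrow> real^'q) \<Rightarrow> (nat \<times> nat \<times> nat \<Rightarrow> 'a \<Rightarrow> nat)
     \<Rightarrow> (real^'q) set \<Rightarrow> nat \<Rightarrow> 'a \<Rightarrow> nat \<Rightarrow> real^'p \<Rightarrow> real" where
  "copula_proc P X Z J A n \<omega> m u =
     (let s = (\<lambda>i. (X i \<omega>, Z i \<omega>));
          sb = (\<lambda>i. s (J (n, m, i) \<omega>))
      in if m = 0 then sqrt (real n) * (emp_copula n s A u - condC P (X 0) (Z 0) A u)
         else sqrt (real n) * (emp_copula n sb A u - emp_copula n s A u))"

text \<open>\<open>\<bbbC>_\<infinity>(u|A)\<close> built from a path \<open>B = \<bbbB>(\<cdot>,A)\<close>, with \<open>p = p_A\<close>, \<open>D(u,A) = p C(u|A)\<close> and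
  \<open>\<partial>_k D(u,A) = p \<cdot> dC u k\<close>, where \<open>dC u k\<close> is the k-th partial derivative of \<open>C(\<cdot>|A)\<close> at u.\<close>
definition Cinf :: "real \<Rightarrow> (real^'p \<Rightarrow> real) \<Rightarrow> (real^'p \<Rightarrow> 'p \<Rightarrow> real) \<Rightarrow> (real^'p \<Rightarrow> real)
     \<Rightarrow> real^'p \<Rightarrow> real" where
  "Cinf p C dC B u =
     B u / p
     - (\<Sum>k\<in>UNIV. (p * dC u k) / p\<^sup>2 * (B (\<chi> j. if j = k then u $ k else 1) - u $ k * B 1))
     - (p * C u) / p\<^sup>2 * B 1"

end

theory Submission
  imports Defs
begin

text \<open>
  Put \<open>U\<^sub>k = F\<^sub>k(X\<^sub>k|A)\<close> and let \<open>D\<^sub>n\<close>, \<open>D\<^sub>n\<^sup>*\<close> be the empirical measures of the orthants \<open>{U \<le> u, Z \<in> A}\<close> under the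
  sample and a resample. With \<open>G = sqrt n (Q - D)\<close>, \<open>Q \<in> {D\<^sub>n, D\<^sub>n\<^sup>*}\<close>, the copula process \<open>sqrt n (C(Q) - C)\<close> differs from the
  linear functional \<open>Cinf\<close> of \<open>G\<close> by an explicit amount controlled by the supremum and the modulus of continuity of \<open>G\<close>;
  subtracting the two cases, the bootstrap copula process is \<open>Cinf\<close> of \<open>sqrt n (D\<^sub>n\<^sup>* - D\<^sub>n)\<close> up to a negligible error.

  The modulus is controlled by chaining along dyadic grids: the increments of \<open>sqrt n (D\<^sub>n - D)\<close> and, after averaging the
  conditional bound over the data, those of \<open>sqrt n (D\<^sub>n\<^sup>* - D\<^sub>n)\<close> have moment generating function at most
  \<open>exp (2 \<theta>\<^sup>2 v)\<close> for \<open>|\<theta>| \<le> sqrt n / 2\<close>, with \<open>v\<close> the \<open>D\<close>-mass of the increment; below the mesh \<open>1/n\<close> monotonicity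
  takes over. Conditionally on the data the characteristic functions of the resampled sums are \<open>n\<close>-th powers whose limits
  involve only the empirical variances, which gives the asymptotic independence of the components.

  The limit is built on the dyadic points from independent normal variables by a Cholesky factorisation of the covariance
  and is extended continuously by the same chaining bound.
\<close>

section \<open>Oscillation on the unit cube\<close>

lemma unit_cube_eq_cbox: "unit_cube = cbox 0 (1 :: real^'p)"
  by (auto simp: unit_cube_def mem_box_cart)

lemma compact_unit_cube: "compact (unit_cube :: (real^'p) set)"
  unfolding unit_cube_eq_cbox by (rule compact_cbox)

lemma convex_unit_cube: "convex (unit_cube :: (real^'p) set)"
  unfolding unit_cube_eq_cbox by (rule convex_box)

lemma one_in_unit_cube: "1 \<in> unit_cube"
  by (simp add: unit_cube_def)

lemma unit_cube_component: "u \<in> unit_cube \<Longrightarrow> 0 \<le> u $ k" "u \<in> unit_cube \<Longrightarrow> u $ k \<le> 1"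
  by (simp_all add: unit_cube_def)

lemma dist_le_card_mult:
  fixes u v :: "real^'p"
  assumes "\<And>k. \<bar>u $ k - v $ k\<bar> \<le> \<delta>"
  shows "dist u v \<le> real CARD('p) * \<delta>"
proof -
  have "dist u v \<le> (\<Sum>k\<in>UNIV. \<bar>u $ k - v $ k\<bar>)"
    using norm_le_l1_cart[of "u - v"] by (simp add: dist_norm)
  also have "\<dots> \<le> (\<Sum>k\<in>(UNIV::'p set). \<delta>)"
    by (intro sum_mono assms)
  finally show ?thesis by simp
qed

definition oscillation_le :: "real \<Rightarrow> real \<Rightarrow> (real^'p \<Rightarrow> 'b::metric_space) \<Rightarrow> bool" where
  "oscillation_le \<delta> \<eta> f \<longleftrightarrow>
     (\<forall>u\<in>unit_cube. \<forall>v\<in>unit_cube. (\<forall>k. \<bar>u $ k - v $ k\<bar> \<le> \<delta>) \<longrightarrow> dist (f u) (f v) \<le> \<eta>)"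

lemma oscillation_leD:
  assumes "oscillation_le \<delta> \<eta> f" "u \<in> unit_cube" "v \<in> unit_cube" "\<And>k. \<bar>u $ k - v $ k\<bar> \<le> \<delta>"
  shows "dist (f u) (f v) \<le> \<eta>"
  using assms unfolding oscillation_le_def by blast

lemma oscillation_le_mono: "oscillation_le \<delta> \<eta> f \<Longrightarrow> \<eta> \<le> \<eta>' \<Longrightarrow> oscillation_le \<delta> \<eta>' f"
  unfolding oscillation_le_def by (meson order_trans)

lemma continuous_on_imp_oscillation_le:
  fixes f :: "real^'p \<Rightarrow> 'b::metric_space"
  assumes "continuous_on unit_cube f" "0 < e"
  shows "eventually (\<lambda>l. oscillation_le (1 / 2 ^ l) e f) sequentially"
proof -
  have "uniformly_continuous_on unit_cube f"
    using assms(1) compact_unit_cube by (rule compact_uniformly_continuous)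
  then obtain d where d: "0 < d"
    "\<And>u v. u \<in> unit_cube \<Longrightarrow> v \<in> unit_cube \<Longrightarrow> dist u v < d \<Longrightarrow> dist (f u) (f v) < e"
    unfolding uniformly_continuous_on_def using assms(2) by metis
  have "(\<lambda>l. real CARD('p) * (1 / 2) ^ l) \<longlonglongrightarrow> real CARD('p) * 0"
    by (intro tendsto_intros LIMSEQ_power_zero) simp
  from order_tendstoD(2)[OF this, of d] d(1)
  have "eventually (\<lambda>l. real CARD('p) * (1 / 2) ^ l < d) sequentially" by simp
  then show ?thesis
  proof eventually_elim
    case (elim l)
    have "dist u v < d" if "\<And>k. \<bar>u $ k - v $ k\<bar> \<le> 1 / 2 ^ l" for u v :: "real^'p"
      using dist_le_card_mult[OF that] elim by (simp add: power_one_over)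
    then show ?case
      unfolding oscillation_le_def using d(2) less_imp_le by blast
  qed
qed

section \<open>Chaining along dyadic grids\<close>

definition dyadic_grid :: "nat \<Rightarrow> (real^'p) set" where
  "dyadic_grid j = {u \<in> unit_cube. \<forall>k. 2 ^ j * u $ k \<in> \<int>}"

definition dyadic_floor :: "nat \<Rightarrow> real^'p \<Rightarrow> real^'p" where
  "dyadic_floor j u = (\<chi> k. of_int \<lfloor>2 ^ j * u $ k\<rfloor> / 2 ^ j)"

definition dyadic_ceiling :: "nat \<Rightarrow> real^'p \<Rightarrow> real^'p" where
  "dyadic_ceiling j u = (\<chi> k. of_int \<lceil>2 ^ j * u $ k\<rceil> / 2 ^ j)"

definition grid_succ :: "nat \<Rightarrow> 'p \<Rightarrow> real^'p \<Rightarrow> real^'p" where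
  "grid_succ j k u = u + axis k (1 / 2 ^ j)"

lemma grid_succ_component: "grid_succ j k u $ i = (if i = k then u $ k + 1 / 2 ^ j else u $ i)"
  by (simp add: grid_succ_def axis_def)

lemma le_grid_succ: "u \<le> grid_succ j k u"
  by (simp add: less_eq_vec_def grid_succ_component)

lemma dyadic_grid_in_unit_cube: "u \<in> dyadic_grid j \<Longrightarrow> u \<in> unit_cube"
  by (simp add: dyadic_grid_def)

lemma dyadic_grid_subset_image:
  "(dyadic_grid j :: (real^'p) set) \<subseteq>
     (\<lambda>g. \<chi> k. real (g k) / 2 ^ j) ` (UNIV \<rightarrow>\<^sub>E {..2 ^ j})"
proof
  fix u :: "real^'p" assume u: "u \<in> dyadic_grid j"
  define g where "g k = nat \<lfloor>2 ^ j * u $ k\<rfloor>" for k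
  have g: "real (g k) = 2 ^ j * u $ k" for k
  proof -
    have "0 \<le> 2 ^ j * u $ k" "of_int \<lfloor>2 ^ j * u $ k\<rfloor> = 2 ^ j * u $ k"
      using u by (auto simp: dyadic_grid_def unit_cube_def)
    then show ?thesis by (simp add: g_def)
  qed
  have "g k \<le> 2 ^ j" for k
  proof -
    have "real (g k) \<le> real (2 ^ j)"
      unfolding g using u by (simp add: dyadic_grid_def unit_cube_def mult_left_le)
    then show ?thesis by (simp only: of_nat_le_iff)
  qed
  moreover have "u = (\<chi> k. real (g k) / 2 ^ j)"
    using g by (simp add: vec_eq_iff)
  ultimately show "u \<in> (\<lambda>g. \<chi> k. real (g k) / 2 ^ j) ` (UNIV \<rightarrow>\<^sub>E {..2 ^ j})"
    by (auto intro!: image_eqI[where x = g])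
qed

lemma finite_dyadic_grid: "finite (dyadic_grid j :: (real^'p) set)"
  by (rule finite_subset[OF dyadic_grid_subset_image]) (intro finite_imageI finite_PiE; simp)

lemma card_dyadic_grid_le: "card (dyadic_grid j :: (real^'p) set) \<le> (2 ^ j + 1) ^ CARD('p)"
proof -
  let ?G = "(UNIV :: 'p set) \<rightarrow>\<^sub>E {..(2::nat) ^ j}"
  have G: "finite ?G" by (intro finite_PiE) auto
  have "card (dyadic_grid j :: (real^'p) set)
      \<le> card ((\<lambda>g. (\<chi> k. real (g k) / 2 ^ j) :: real^'p) ` ?G)"
    by (intro card_mono dyadic_grid_subset_image finite_imageI G)
  also have "\<dots> \<le> card ?G"
    by (rule card_image_le[OF G])
  also have "\<dots> = (2 ^ j + 1) ^ CARD('p)"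
    by (subst card_PiE) auto
  finally show ?thesis .
qed

lemma dyadic_grid_mono:
  assumes "j \<le> l" shows "dyadic_grid j \<subseteq> dyadic_grid l"
proof
  fix u :: "real^'p" assume u: "u \<in> dyadic_grid j"
  have "2 ^ l * u $ k = 2 ^ (l - j) * (2 ^ j * u $ k)" for k
    using assms by (metis le_add_diff_inverse2 mult.assoc power_add)
  moreover have "2 ^ (l - j) * (2 ^ j * u $ k) \<in> \<int>" for k
    by (rule Ints_mult[OF _ spec[of _ k]]) (use u in \<open>auto simp: dyadic_grid_def\<close>)
  ultimately have "2 ^ l * u $ k \<in> \<int>" for k by metis
  with u show "u \<in> dyadic_grid l" by (simp add: dyadic_grid_def)
qed

lemma dyadic_floor_le: "dyadic_floor j u $ k \<le> u $ k"
  by (simp add: dyadic_floor_def divide_le_eq mult.commute)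

lemma dyadic_floor_ge: "u $ k - 1 / 2 ^ j \<le> dyadic_floor j u $ k"
proof -
  have "(2 ^ j * u $ k - 1) / 2 ^ j \<le> of_int \<lfloor>2 ^ j * u $ k\<rfloor> / 2 ^ j"
    by (intro divide_right_mono) (linarith, simp)
  then show ?thesis by (simp add: dyadic_floor_def diff_divide_distrib)
qed

lemma abs_diff_dyadic_floor_le: "\<bar>u $ k - dyadic_floor j u $ k\<bar> \<le> 1 / 2 ^ j"
  using dyadic_floor_le[of j u k] dyadic_floor_ge[of u k j] by linarith

lemma dyadic_ceiling_ge: "u $ k \<le> dyadic_ceiling j u $ k"
  by (simp add: dyadic_ceiling_def le_divide_eq mult.commute)

lemma dyadic_ceiling_le: "dyadic_ceiling j u $ k \<le> u $ k + 1 / 2 ^ j"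
proof -
  have "of_int \<lceil>2 ^ j * u $ k\<rceil> / 2 ^ j \<le> (2 ^ j * u $ k + 1) / 2 ^ j"
    by (intro divide_right_mono) (linarith, simp)
  then show ?thesis by (simp add: dyadic_ceiling_def add_divide_distrib)
qed

lemma dyadic_floor_in_grid:
  assumes "u \<in> unit_cube" shows "dyadic_floor j u \<in> dyadic_grid j"
proof -
  have "0 \<le> dyadic_floor j u $ k" for k
    using unit_cube_component(1)[OF assms, of k] by (simp add: dyadic_floor_def)
  moreover have "dyadic_floor j u $ k \<le> 1" for k
    using dyadic_floor_le unit_cube_component(2)[OF assms] by (rule order_trans)
  ultimately show ?thesis
    by (auto simp: dyadic_grid_def unit_cube_def) (simp add: dyadic_floor_def)
qed

lemma dyadic_floor_in_unit_cube: "u \<in> unit_cube \<Longrightarrow> dyadic_floor j u \<in> unit_cube"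
  by (rule dyadic_grid_in_unit_cube[OF dyadic_floor_in_grid])

lemma dyadic_ceiling_in_grid:
  assumes "u \<in> unit_cube" shows "dyadic_ceiling j u \<in> dyadic_grid j"
proof -
  have "0 \<le> dyadic_ceiling j u $ k" for k
    using unit_cube_component(1)[OF assms] dyadic_ceiling_ge by (rule order_trans)
  moreover have "dyadic_ceiling j u $ k \<le> 1" for k
  proof -
    have "\<lceil>2 ^ j * u $ k\<rceil> \<le> 2 ^ j"
      using unit_cube_component(2)[OF assms, of k] by (simp add: ceiling_le_iff mult_left_le)
    then have "of_int \<lceil>2 ^ j * u $ k\<rceil> \<le> (2 ^ j :: real)"
      by (metis of_int_le_iff of_int_numeral of_int_power)
    then show ?thesis by (simp add: dyadic_ceiling_def)
  qed
  ultimately show ?thesis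
    by (auto simp: dyadic_grid_def unit_cube_def) (simp add: dyadic_ceiling_def)
qed

lemma dyadic_ceiling_floor_diff: "\<bar>dyadic_ceiling j u $ k - dyadic_floor j u $ k\<bar> \<le> 1 / 2 ^ j"
proof -
  have "\<bar>\<lceil>2 ^ j * u $ k\<rceil> - \<lfloor>2 ^ j * u $ k\<rfloor>\<bar> \<le> 1" by linarith
  then have "\<bar>of_int \<lceil>2 ^ j * u $ k\<rceil> - of_int \<lfloor>2 ^ j * u $ k\<rfloor>\<bar> \<le> (1::real)" by linarith
  then show ?thesis
    by (simp add: dyadic_ceiling_def dyadic_floor_def diff_divide_distrib[symmetric] divide_le_eq)
qed

lemma dyadic_floor_diff:
  assumes "\<bar>u $ k - v $ k\<bar> \<le> 1 / 2 ^ j"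
  shows "\<bar>dyadic_floor j u $ k - dyadic_floor j v $ k\<bar> \<le> 1 / 2 ^ j"
proof -
  have "\<bar>2 ^ j * u $ k - 2 ^ j * v $ k\<bar> \<le> 1"
    using assms unfolding right_diff_distrib[symmetric] abs_mult
    by (simp add: le_divide_eq mult.commute)
  then have "\<bar>\<lfloor>2 ^ j * u $ k\<rfloor> - \<lfloor>2 ^ j * v $ k\<rfloor>\<bar> \<le> 1" by linarith
  then have "\<bar>of_int \<lfloor>2 ^ j * u $ k\<rfloor> - of_int \<lfloor>2 ^ j * v $ k\<rfloor>\<bar> \<le> (1::real)" by linarith
  then show ?thesis
    by (simp add: dyadic_floor_def diff_divide_distrib[symmetric] divide_le_eq)
qed

lemma dyadic_floor_Suc_diff:
  "\<bar>dyadic_floor (Suc j) u $ k - dyadic_floor j u $ k\<bar> \<le> 1 / 2 ^ Suc j"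
proof -
  define y where "y = 2 ^ j * u $ k"
  have "\<bar>\<lfloor>2 * y\<rfloor> - 2 * \<lfloor>y\<rfloor>\<bar> \<le> 1" by linarith
  then have "\<bar>of_int \<lfloor>2 * y\<rfloor> - 2 * of_int \<lfloor>y\<rfloor>\<bar> \<le> (1::real)" by linarith
  then have "\<bar>(of_int \<lfloor>2 * y\<rfloor> - 2 * of_int \<lfloor>y\<rfloor>) / 2 ^ Suc j\<bar> \<le> (1 / 2 ^ Suc j :: real)"
    by (simp add: divide_le_eq)
  moreover have "dyadic_floor (Suc j) u $ k - dyadic_floor j u $ k
      = (of_int \<lfloor>2 * y\<rfloor> - 2 * of_int \<lfloor>y\<rfloor>) / 2 ^ Suc j"
    by (simp add: dyadic_floor_def y_def mult.assoc diff_divide_distrib)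
  ultimately show ?thesis by simp
qed

lemma dyadic_floor_tendsto: "(\<lambda>l. dyadic_floor l u) \<longlonglongrightarrow> u"
proof (rule vec_tendstoI)
  fix k
  have "(\<lambda>l. u $ k - (1 / 2) ^ l) \<longlonglongrightarrow> u $ k - 0"
    by (intro tendsto_intros LIMSEQ_power_zero) simp
  then have "(\<lambda>l. u $ k - 1 / 2 ^ l) \<longlonglongrightarrow> u $ k"
    by (simp add: power_one_over)
  then show "(\<lambda>l. dyadic_floor l u $ k) \<longlonglongrightarrow> u $ k"
    by (rule tendsto_sandwich[OF always_eventually always_eventually _ tendsto_const, rotated 2])
      (auto intro: dyadic_floor_ge dyadic_floor_le)
qed

definition grid_increments_le :: "nat \<Rightarrow> real \<Rightarrow> (real^'p \<Rightarrow> real) \<Rightarrow> bool" where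
  "grid_increments_le j x f \<longleftrightarrow>
     (\<forall>u\<in>dyadic_grid j. \<forall>k. grid_succ j k u \<in> dyadic_grid j \<longrightarrow> \<bar>f (grid_succ j k u) - f u\<bar> \<le> x)"

lemma grid_increments_le_nonneg:
  fixes f :: "real^'p \<Rightarrow> real"
  assumes "grid_increments_le j x f" shows "0 \<le> x"
proof -
  fix k :: 'p
  have "(0 :: real^'p) \<in> dyadic_grid j" "grid_succ j k 0 \<in> dyadic_grid j"
    by (auto simp: dyadic_grid_def unit_cube_def grid_succ_component)
  then have "\<bar>f (grid_succ j k 0) - f 0\<bar> \<le> x"
    using assms unfolding grid_increments_le_def by blast
  then show ?thesis by linarith
qed

lemma grid_increments_le_coordinate:
  fixes f :: "real^'p \<Rightarrow> real"
  assumes f: "grid_increments_le j x f"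
    and a: "a \<in> dyadic_grid j" and b: "b \<in> dyadic_grid j"
    and eq: "\<And>i. i \<noteq> k \<Longrightarrow> a $ i = b $ i" and ab: "\<bar>a $ k - b $ k\<bar> \<le> 1 / 2 ^ j"
  shows "\<bar>f a - f b\<bar> \<le> x"
proof -
  obtain r s where rs: "2 ^ j * a $ k = of_int r" "2 ^ j * b $ k = of_int s"
    using a b unfolding dyadic_grid_def by (metis (mono_tags, lifting) Ints_cases mem_Collect_eq)
  have "\<bar>of_int r - of_int s\<bar> \<le> (1::real)"
    using ab unfolding rs[symmetric] right_diff_distrib[symmetric] abs_mult
    by (simp add: le_divide_eq mult.commute)
  then consider "r = s" | "s = r + 1" | "r = s + 1" by linarith
  then show ?thesis
  proof cases
    case 1
    then have "a = b" using rs eq by (metis mult_left_cancel power_not_zero vec_eq_iff zero_neq_numeral)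
    then show ?thesis using grid_increments_le_nonneg[OF f] by simp
  next
    case 2
    then have "b $ k = a $ k + 1 / 2 ^ j" using rs by (simp add: field_simps)
    then have "b = grid_succ j k a" using eq by (simp add: vec_eq_iff grid_succ_component)
    then show ?thesis using f a b by (auto simp: grid_increments_le_def abs_minus_commute)
  next
    case 3
    then have "a $ k = b $ k + 1 / 2 ^ j" using rs by (simp add: field_simps)
    then have "a = grid_succ j k b" using eq by (simp add: vec_eq_iff grid_succ_component)
    then show ?thesis using f a b by (auto simp: grid_increments_le_def)
  qed
qed

lemma grid_increments_le_adjacent:
  fixes f :: "real^'p \<Rightarrow> real"
  assumes f: "grid_increments_le j x f"
    and a: "a \<in> dyadic_grid j" and b: "b \<in> dyadic_grid j"
    and ab: "\<And>k. \<bar>a $ k - b $ k\<bar> \<le> 1 / 2 ^ j"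
  shows "\<bar>f a - f b\<bar> \<le> real CARD('p) * x"
proof -
  define c where "c F = (\<chi> k. if k \<in> F then b $ k else a $ k)" for F
  have c: "c F \<in> dyadic_grid j" for F
    using a b by (auto simp: c_def dyadic_grid_def unit_cube_def)
  have "\<bar>f a - f (c F)\<bar> \<le> real (card F) * x" for F
  proof (induction F rule: finite_induct[OF finite])
    case 1
    then show ?case by (simp add: c_def)
  next
    case (2 k F)
    have "\<bar>f (c F) - f (c (insert k F))\<bar> \<le> x"
      by (rule grid_increments_le_coordinate[OF f c c, of k])
        (use 2 ab[of k] in \<open>auto simp: c_def\<close>)
    then show ?case using 2 by (simp add: algebra_simps)
  qed
  from this[of UNIV] show ?thesis by (simp add: c_def)
qed

lemma abs_diff_dyadic_floor_levels_le:
  fixes f :: "real^'p \<Rightarrow> real"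
  assumes "\<And>j. l \<le> j \<Longrightarrow> j \<le> L \<Longrightarrow> grid_increments_le j (x j) f"
    and "l \<le> L" and u: "u \<in> unit_cube"
  shows "\<bar>f (dyadic_floor L u) - f (dyadic_floor l u)\<bar> \<le> real CARD('p) * (\<Sum>j=l..L. x j)"
  using \<open>l \<le> L\<close> assms(1)
proof (induction L rule: dec_induct)
  case base
  then show ?case using grid_increments_le_nonneg by force
next
  case (step L)
  have "dyadic_floor L u \<in> dyadic_grid (Suc L)"
    using dyadic_floor_in_grid[OF u] dyadic_grid_mono[of L "Suc L"] by auto
  then have "\<bar>f (dyadic_floor (Suc L) u) - f (dyadic_floor L u)\<bar> \<le> real CARD('p) * x (Suc L)"
    using step by (intro grid_increments_le_adjacent[of "Suc L"] dyadic_floor_in_grid[OF u]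
        dyadic_floor_Suc_diff) auto
  moreover have "\<bar>f (dyadic_floor L u) - f (dyadic_floor l u)\<bar> \<le> real CARD('p) * (\<Sum>j=l..L. x j)"
    using step by auto
  ultimately show ?case using step by (simp add: algebra_simps)
qed

lemma abs_diff_le_of_dyadic_floor:
  fixes f :: "real^'p \<Rightarrow> real"
  assumes f: "grid_increments_le l x f"
    and floor: "\<And>w. w \<in> {u, v} \<Longrightarrow> \<bar>f w - f (dyadic_floor l w)\<bar> \<le> \<tau>"
    and uv: "u \<in> unit_cube" "v \<in> unit_cube" "\<And>k. \<bar>u $ k - v $ k\<bar> \<le> 1 / 2 ^ l"
  shows "\<bar>f u - f v\<bar> \<le> 2 * \<tau> + real CARD('p) * x"
proof -
  have "\<bar>f (dyadic_floor l u) - f (dyadic_floor l v)\<bar> \<le> real CARD('p) * x"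
    by (intro grid_increments_le_adjacent[OF f] dyadic_floor_in_grid dyadic_floor_diff uv)
  then show ?thesis using floor[of u] floor[of v] by simp
qed

definition l1_growth :: "(real^'p \<Rightarrow> real) \<Rightarrow> bool" where
  "l1_growth D \<longleftrightarrow> (\<forall>u\<in>unit_cube. \<forall>v\<in>unit_cube. u \<le> v \<longrightarrow> D v - D u \<le> (\<Sum>k\<in>UNIV. v $ k - u $ k))"

lemma l1_growth_le:
  fixes D :: "real^'p \<Rightarrow> real"
  assumes "l1_growth D" "u \<in> unit_cube" "v \<in> unit_cube" "u \<le> v" "\<And>k. v $ k - u $ k \<le> \<delta>"
  shows "D v - D u \<le> real CARD('p) * \<delta>"
proof -
  have "D v - D u \<le> (\<Sum>k\<in>UNIV. v $ k - u $ k)" using assms by (simp add: l1_growth_def)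
  also have "\<dots> \<le> (\<Sum>k\<in>(UNIV::'p set). \<delta>)" by (intro sum_mono assms)
  finally show ?thesis by simp
qed

lemma l1_growth_grid_succ:
  fixes D :: "real^'p \<Rightarrow> real"
  assumes "l1_growth D" "u \<in> unit_cube" "grid_succ j k u \<in> unit_cube"
  shows "D (grid_succ j k u) - D u \<le> 1 / 2 ^ j"
proof -
  have "D (grid_succ j k u) - D u \<le> (\<Sum>i\<in>UNIV. grid_succ j k u $ i - u $ i)"
    using assms le_grid_succ[of u j k] by (simp add: l1_growth_def)
  also have "\<dots> = (\<Sum>i\<in>UNIV. if i = k then 1 / 2 ^ j else 0)"
    by (intro sum.cong) (auto simp: grid_succ_component)
  finally show ?thesis by simp
qed

text \<open>Below the mesh, monotonicity of \<open>Q\<close> replaces chaining.\<close>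
lemma abs_diff_dyadic_floor_le_of_mono:
  fixes Q D :: "real^'p \<Rightarrow> real"
  assumes Q: "mono Q" and D: "l1_growth D" and r: "0 \<le> r"
    and f_eq: "f = (\<lambda>u. r * (Q u - D u))" and f: "grid_increments_le L x f"
    and u: "u \<in> unit_cube"
  shows "\<bar>f u - f (dyadic_floor L u)\<bar> \<le> real CARD('p) * x + r * (real CARD('p) / 2 ^ L)"
proof -
  let ?lo = "dyadic_floor L u" and ?hi = "dyadic_ceiling L u" and ?e = "real CARD('p) / 2 ^ L"
  note lo = dyadic_floor_in_grid[OF u, of L] and hi = dyadic_ceiling_in_grid[OF u, of L]
  note cube = lo[THEN dyadic_grid_in_unit_cube] hi[THEN dyadic_grid_in_unit_cube] u
  have corners: "?lo \<le> u" "u \<le> ?hi"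
    by (simp_all add: less_eq_vec_def dyadic_floor_le dyadic_ceiling_ge)
  have "D u - D ?lo \<le> real CARD('p) * (1 / 2 ^ L)"
    using abs_diff_dyadic_floor_le[of u _ L] cube corners
    by (intro l1_growth_le[OF D]) (auto simp: abs_le_iff)
  moreover have "D ?hi - D u \<le> real CARD('p) * (1 / 2 ^ L)"
    using dyadic_ceiling_le[of L u] cube corners
    by (intro l1_growth_le[OF D]) (auto simp: algebra_simps)
  ultimately have "r * (Q ?lo - D ?lo) \<le> r * (Q u - D u + ?e)" "r * (Q u - D u) \<le> r * (Q ?hi - D ?hi + ?e)"
    using monoD[OF Q corners(1)] monoD[OF Q corners(2)] r by (auto intro!: mult_left_mono)
  then have "f ?lo \<le> f u + r * ?e" "f u \<le> f ?hi + r * ?e"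
    by (simp_all add: f_eq algebra_simps)
  moreover have "\<bar>f ?hi - f ?lo\<bar> \<le> real CARD('p) * x"
    by (intro grid_increments_le_adjacent[OF f hi lo] dyadic_ceiling_floor_diff)
  ultimately show ?thesis
    using grid_increments_le_nonneg[OF f] by (auto simp: abs_le_iff)
qed

definition chain_step :: "nat \<Rightarrow> nat \<Rightarrow> real" where
  "chain_step d j = (real d + 1) * (real (Suc j) * sqrt (1/2) ^ j)"

definition chain_tail :: "nat \<Rightarrow> nat \<Rightarrow> real" where
  "chain_tail d l = (\<Sum>j. chain_step d (j + l))"

lemma chain_step_nonneg: "0 \<le> chain_step d j"
  by (simp add: chain_step_def)

lemma summable_chain_step: "summable (chain_step d)"
proof -
  have "norm (sqrt (1/2)) < 1" by (simp add: real_sqrt_divide)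
  from geometric_deriv_sums[OF this] show ?thesis
    unfolding chain_step_def by (intro summable_mult) (auto simp: sums_iff)
qed

lemma chain_tail_tendsto_0: "chain_tail d \<longlonglongrightarrow> 0"
  unfolding chain_tail_def using suminf_exist_split2[OF summable_chain_step] .

lemma sum_chain_step_le_tail:
  assumes "l \<le> L" shows "(\<Sum>j=l..L. chain_step d j) \<le> chain_tail d l"
proof -
  have "(\<Sum>j=l..L. chain_step d j) = (\<Sum>j<Suc (L - l). chain_step d (j + l))"
    using assms by (intro sum.reindex_bij_witness[of _ "\<lambda>j. j + l" "\<lambda>j. j - l"]) auto
  also have "\<dots> \<le> chain_tail d l"
    unfolding chain_tail_def
    by (intro sum_le_suminf) (auto simp: summable_iff_shift summable_chain_step chain_step_nonneg)
  finally show ?thesis .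
qed

lemma chain_step_le_tail:
  assumes "l \<le> j" shows "chain_step d j \<le> chain_tail d l"
proof -
  have "chain_step d j \<le> (\<Sum>i=l..j. chain_step d i)"
    using assms chain_step_nonneg by (intro member_le_sum) auto
  also have "\<dots> \<le> chain_tail d l" using assms by (rule sum_chain_step_le_tail)
  finally show ?thesis .
qed

lemma abs_diff_dyadic_floor_le_chain_tail:
  fixes f :: "real^'p \<Rightarrow> real"
  assumes f: "\<And>j. l \<le> j \<Longrightarrow> j \<le> L \<Longrightarrow> grid_increments_le j (c * chain_step CARD('p) j) f"
    and "0 \<le> c" "l \<le> L" "u \<in> unit_cube"
  shows "\<bar>f (dyadic_floor L u) - f (dyadic_floor l u)\<bar> \<le> real CARD('p) * (c * chain_tail CARD('p) l)"
proof -
  let ?d = "CARD('p)"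
  have "\<bar>f (dyadic_floor L u) - f (dyadic_floor l u)\<bar> \<le> real ?d * (\<Sum>j=l..L. c * chain_step ?d j)"
    using assms by (intro abs_diff_dyadic_floor_levels_le) auto
  also have "\<dots> \<le> real ?d * (c * chain_tail ?d l)"
    using assms sum_chain_step_le_tail[of l L ?d]
    by (intro mult_left_mono) (auto simp: sum_distrib_left[symmetric] intro: mult_left_mono)
  finally show ?thesis .
qed

lemma oscillation_le_chaining:
  fixes Q D :: "real^'p \<Rightarrow> real"
  assumes Q: "mono Q" and D: "l1_growth D" and r: "0 \<le> r" and l: "l \<le> L"
    and f_eq: "f = (\<lambda>u. r * (Q u - D u))"
    and f: "\<And>j. l \<le> j \<Longrightarrow> j \<le> L \<Longrightarrow> grid_increments_le j (2 * chain_step CARD('p) j) f"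
  shows "oscillation_le (1 / 2 ^ l)
    (real CARD('p) * (10 * chain_tail CARD('p) l + 2 * r / 2 ^ L)) f"
proof -
  let ?d = "CARD('p)"
  have step: "real ?d * (2 * chain_step ?d j) \<le> real ?d * (2 * chain_tail ?d l)" if "l \<le> j" for j
    using chain_step_le_tail[OF that] by simp
  have floor: "\<bar>f w - f (dyadic_floor l w)\<bar> \<le> real ?d * (4 * chain_tail ?d l + r / 2 ^ L)"
    if w: "w \<in> unit_cube" for w
  proof -
    have "\<bar>f w - f (dyadic_floor L w)\<bar> \<le> real ?d * (2 * chain_step ?d L) + r * (real ?d / 2 ^ L)"
      using l w by (intro abs_diff_dyadic_floor_le_of_mono[OF Q D r f_eq] f) auto
    moreover have "\<bar>f (dyadic_floor L w) - f (dyadic_floor l w)\<bar> \<le> real ?d * (2 * chain_tail ?d l)"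
      by (rule abs_diff_dyadic_floor_le_chain_tail[OF f]) (use l w in auto)
    ultimately have "\<bar>f w - f (dyadic_floor l w)\<bar>
        \<le> real ?d * (2 * chain_tail ?d l) + r * (real ?d / 2 ^ L) + real ?d * (2 * chain_tail ?d l)"
      using step[OF l] by linarith
    then show ?thesis by (simp add: algebra_simps)
  qed
  have "\<bar>f u - f v\<bar> \<le> real ?d * (10 * chain_tail ?d l + 2 * r / 2 ^ L)"
    if uv: "u \<in> unit_cube" "v \<in> unit_cube" "\<And>k. \<bar>u $ k - v $ k\<bar> \<le> 1 / 2 ^ l" for u v
  proof -
    have "\<bar>f u - f v\<bar> \<le> 2 * (real ?d * (4 * chain_tail ?d l + r / 2 ^ L)) + real ?d * (2 * chain_step ?d l)"
      by (rule abs_diff_le_of_dyadic_floor[OF f floor uv]) (use l uv in auto)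
    also have "\<dots> \<le> 2 * (real ?d * (4 * chain_tail ?d l + r / 2 ^ L)) + real ?d * (2 * chain_tail ?d l)"
      using step by simp
    finally show ?thesis by (simp add: algebra_simps)
  qed
  then show ?thesis by (auto simp: oscillation_le_def dist_real_def)
qed

section \<open>Convergence of finite-dimensional distributions\<close>

definition lipschitz_coords :: "'i set \<Rightarrow> real \<Rightarrow> (('i \<Rightarrow> real) \<Rightarrow> real) \<Rightarrow> bool" where
  "lipschitz_coords I L f \<longleftrightarrow> 0 \<le> L \<and> (\<forall>x y. \<bar>f x - f y\<bar> \<le> L * (\<Sum>i\<in>I. \<bar>x i - y i\<bar>))"

lemma lipschitz_coordsD:
  assumes "lipschitz_coords I L f"
  shows "0 \<le> L" "\<bar>f x - f y\<bar> \<le> L * (\<Sum>i\<in>I. \<bar>x i - y i\<bar>)"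
  using assms by (auto simp: lipschitz_coords_def)

lemma lipschitz_coords_imp_continuous:
  assumes f: "lipschitz_coords I L f"
  shows "continuous_on UNIV f"
proof -
  have "(f \<longlongrightarrow> f x) (at x)" for x
  proof -
    have "((\<lambda>y. y i) \<longlongrightarrow> x i) (at x)" for i
      using continuous_on_product_coordinates[of i] by (auto simp: continuous_on_def)
    then have "((\<lambda>y. L * (\<Sum>i\<in>I. \<bar>y i - x i\<bar>)) \<longlongrightarrow> L * (\<Sum>i\<in>I. \<bar>x i - x i\<bar>)) (at x)"
      by (intro tendsto_intros)
    then have "((\<lambda>y. L * (\<Sum>i\<in>I. \<bar>y i - x i\<bar>)) \<longlongrightarrow> 0) (at x)" by simp
    then have "((\<lambda>y. f y - f x) \<longlongrightarrow> 0) (at x)"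
      by (rule Lim_null_comparison[rotated]) (simp add: lipschitz_coordsD[OF f])
    then show ?thesis by (simp add: LIM_zero_iff)
  qed
  then show ?thesis by (simp add: continuous_on_def)
qed

lemma lipschitz_coords_reindex:
  assumes e: "bij_betw e J I" and f: "lipschitz_coords I L f"
  obtains g where "lipschitz_coords J L g" "\<And>x. f x = g (\<lambda>j. x (e j))"
proof -
  define e' where "e' = the_inv_into J e"
  have e': "e' (e j) = j" if "j \<in> J" for j
    using the_inv_into_f_f[OF bij_betw_imp_inj_on[OF e] that] by (simp add: e'_def)
  have "\<bar>f (\<lambda>i. x (e' i)) - f (\<lambda>i. y (e' i))\<bar> \<le> L * (\<Sum>j\<in>J. \<bar>x j - y j\<bar>)" for x y
    using lipschitz_coordsD(2)[OF f, of "\<lambda>i. x (e' i)" "\<lambda>i. y (e' i)"]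
    by (simp add: sum.reindex_bij_betw[OF e, symmetric] e')
  then have "lipschitz_coords J L (\<lambda>y. f (\<lambda>i. y (e' i)))"
    using lipschitz_coordsD(1)[OF f] by (simp add: lipschitz_coords_def)
  moreover have "f x = f (\<lambda>i. x (e (e' i)))" for x
    using lipschitz_coordsD(2)[OF f, of x "\<lambda>i. x (e (e' i))"]
    by (simp add: sum.reindex_bij_betw[OF e, symmetric] e')
  ultimately show thesis by (rule that)
qed

lemma borel_measurable_lipschitz_coords:
  assumes I: "finite I" and f: "lipschitz_coords I L f"
    and Y: "\<And>i. i \<in> I \<Longrightarrow> (\<lambda>\<omega>. Y \<omega> i) \<in> borel_measurable M"
  shows "(\<lambda>\<omega>. f (Y \<omega>)) \<in> borel_measurable M"
proof -
  obtain e where e: "bij_betw e {..<card I} I"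
    using bij_betw_from_nat_into_finite[OF I] by blast
  obtain g where g: "lipschitz_coords {..<card I} L g" and fg: "\<And>x. f x = g (\<lambda>j. x (e j))"
    using lipschitz_coords_reindex[OF e f] by blast
  define Z where "Z \<omega> j = (if j < card I then Y \<omega> (e j) else 0)" for \<omega> j
  have "(\<lambda>\<omega>. Z \<omega> j) \<in> borel_measurable M" for j
    using Y e by (cases "j < card I") (auto simp: Z_def bij_betw_def)
  then have "Z \<in> borel_measurable M" by (rule measurable_coordinatewise_then_product)
  then have "(\<lambda>\<omega>. g (Z \<omega>)) \<in> borel_measurable M"
    using borel_measurable_continuous_onI[OF lipschitz_coords_imp_continuous[OF g]]
    by (rule measurable_compose)
  moreover have "g (Z \<omega>) = f (Y \<omega>)" for \<omega>
    using lipschitz_coordsD(2)[OF g, of "Z \<omega>" "\<lambda>j. Y \<omega> (e j)"] by (simp add: Z_def fg)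
  ultimately show ?thesis by simp
qed

lemma (in prob_space) integrable_lipschitz_coords:
  assumes "finite I" "lipschitz_coords I L f" "\<And>i. i \<in> I \<Longrightarrow> (\<lambda>\<omega>. Y \<omega> i) \<in> borel_measurable M"
    and "\<And>x. \<bar>f x\<bar> \<le> b"
  shows "integrable M (\<lambda>\<omega>. f (Y \<omega>))"
  by (rule integrable_const_bound[of _ b])
    (use assms borel_measurable_lipschitz_coords[where Y = Y and f = f and M = M] in auto)

lemma cis_sum: "cis (\<Sum>i\<in>I. f i) = (\<Prod>i\<in>I. cis (f i))"
  by (induction I rule: infinite_finite_induct) (auto simp: cis_mult[symmetric])

lemma borel_measurable_cis [measurable (raw)]:
  "f \<in> borel_measurable N \<Longrightarrow> (\<lambda>x. cis (f x)) \<in> borel_measurable N"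
  unfolding cis_conv_exp by measurable

inductive trig_poly :: "'i set \<Rightarrow> (('i \<Rightarrow> real) \<Rightarrow> complex) \<Rightarrow> bool" for I where
  monomial: "trig_poly I (\<lambda>x. c * cis (\<Sum>i\<in>I. t i * x i))"
| add: "trig_poly I f \<Longrightarrow> trig_poly I g \<Longrightarrow> trig_poly I (\<lambda>x. f x + g x)"

lemma trig_poly_mult:
  assumes "trig_poly I f" "trig_poly I g"
  shows "trig_poly I (\<lambda>x. f x * g x)"
  using assms(1)
proof induction
  case (monomial c t)
  show ?case using assms(2)
  proof induction
    case (monomial c' t')
    have "(\<lambda>x. c * cis (\<Sum>i\<in>I. t i * x i) * (c' * cis (\<Sum>i\<in>I. t' i * x i)))
        = (\<lambda>x. (c * c') * cis (\<Sum>i\<in>I. (t i + t' i) * x i))"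
      by (auto simp: fun_eq_iff cis_mult[symmetric] sum.distrib distrib_right)
    then show ?case using trig_poly.monomial[of I "c * c'" "\<lambda>i. t i + t' i"] by simp
  next
    case (add f g)
    then show ?case by (simp add: distrib_left trig_poly.add)
  qed
next
  case (add f g)
  then show ?case by (simp add: distrib_right trig_poly.add)
qed

lemma trig_poly_const: "trig_poly I (\<lambda>x. c)"
  using trig_poly.monomial[of I c "\<lambda>_. 0"] by simp

lemma trig_poly_sin:
  assumes "finite I" "i \<in> I"
  shows "trig_poly I (\<lambda>x. complex_of_real (R * sin (x i / R)))"
proof -
  define t where "t s = (\<lambda>j. if j = i then s / R else (0::real))" for s
  have t: "(\<Sum>j\<in>I. t s j * x j) = s * x i / R" for s x
    using assms by (simp add: t_def if_distrib[of "\<lambda>a. a * _"] cong: if_cong)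
  have eq: "(\<lambda>x. complex_of_real (R * sin (x i / R)))
     = (\<lambda>x. (of_real R / (2 * \<i>)) * cis (\<Sum>j\<in>I. t 1 j * x j)
         + (- of_real R / (2 * \<i>)) * cis (\<Sum>j\<in>I. t (-1) j * x j))"
    unfolding t by (auto simp: fun_eq_iff complex_eq_iff)
  show ?thesis unfolding eq by (intro trig_poly.add trig_poly.monomial)
qed

lemma trig_poly_reindex:
  assumes "trig_poly J g" and e: "bij_betw e J I"
  shows "trig_poly I (\<lambda>x. g (\<lambda>j. x (e j)))"
  using assms(1)
proof induction
  case (monomial c t)
  have "(\<Sum>j\<in>J. t j * x (e j)) = (\<Sum>i\<in>I. t (the_inv_into J e i) * x i)" for x
    unfolding sum.reindex_bij_betw[OF e, symmetric]
    using the_inv_into_f_f[OF bij_betw_imp_inj_on[OF e]] by (intro sum.cong) auto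
  then show ?case by (simp only: trig_poly.monomial)
qed (rule trig_poly.add)

lemma (in prob_space) trig_poly_integrable:
  assumes "trig_poly I g" and Y: "\<And>i. i \<in> I \<Longrightarrow> (\<lambda>\<omega>. Y \<omega> i) \<in> borel_measurable M"
  shows "integrable M (\<lambda>\<omega>. g (Y \<omega>))"
  using assms(1)
proof induction
  case (monomial c t)
  have "(\<lambda>\<omega>. cis (\<Sum>i\<in>I. t i * Y \<omega> i)) \<in> borel_measurable M"
    using Y by (intro borel_measurable_cis borel_measurable_sum borel_measurable_times) auto
  then show ?case
    by (intro integrable_mult_right integrable_const_bound[of _ 1]) auto
qed auto

lemma trig_poly_tendsto:
  fixes Y :: "nat \<Rightarrow> 'a \<Rightarrow> 'i \<Rightarrow> real"
  assumes "trig_poly I g" and P: "prob_space P" and N: "prob_space N"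
    and Y: "\<And>n i. i \<in> I \<Longrightarrow> (\<lambda>\<omega>. Y n \<omega> i) \<in> borel_measurable P"
    and V: "\<And>i. i \<in> I \<Longrightarrow> (\<lambda>\<omega>. V \<omega> i) \<in> borel_measurable N"
    and cf: "\<And>t. (\<lambda>n. \<integral>\<omega>. cis (\<Sum>i\<in>I. t i * Y n \<omega> i) \<partial>P) \<longlonglongrightarrow> (\<integral>\<omega>. cis (\<Sum>i\<in>I. t i * V \<omega> i) \<partial>N)"
  shows "(\<lambda>n. \<integral>\<omega>. g (Y n \<omega>) \<partial>P) \<longlonglongrightarrow> (\<integral>\<omega>. g (V \<omega>) \<partial>N)"
  using assms(1)
proof induction
  case (monomial c t)
  then show ?case using tendsto_mult[OF tendsto_const cf] by simp
next
  case (add f g)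
  have "integrable P (\<lambda>\<omega>. h (Y n \<omega>))" "integrable N (\<lambda>\<omega>. h (V \<omega>))" if "h \<in> {f, g}" for h n
    using that add.hyps prob_space.trig_poly_integrable[OF P, where Y = "Y n", OF _ Y]
      prob_space.trig_poly_integrable[OF N, where Y = V, OF _ V] by auto
  then show ?case using tendsto_add[OF add.IH] by simp
qed

definition sin_coords :: "'i set \<Rightarrow> real \<Rightarrow> ('i \<Rightarrow> real) \<Rightarrow> 'i \<Rightarrow> real" where
  "sin_coords I R x = (\<lambda>i. if i \<in> I then R * sin (x i / R) else 0)"

lemma measurable_sin_coords:
  assumes "i \<in> I \<Longrightarrow> (\<lambda>\<omega>. U \<omega> i) \<in> borel_measurable M"
  shows "(\<lambda>\<omega>. sin_coords I R (U \<omega>) i) \<in> borel_measurable M"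
  unfolding sin_coords_def using assms by (cases "i \<in> I") auto

lemma compact_supported_box:
  "compact {x :: 'i \<Rightarrow> real. \<forall>i. x i \<in> (if i \<in> I then {-R..R} else {0})}" (is "compact ?S")
proof -
  have "?S = PiE UNIV (\<lambda>i. if i \<in> I then {-R..R} else {0})" by (auto simp: PiE_def Pi_def)
  moreover have "compactin (product_topology (\<lambda>_. euclidean) UNIV)
     (PiE UNIV (\<lambda>i. if i \<in> I then {-R..R} else {0::real}))"
    unfolding compactin_PiE by auto
  ultimately show ?thesis by (simp add: euclidean_product_topology)
qed

lemma sin_coords_in_box:
  assumes "0 < R"
  shows "sin_coords I R x i \<in> (if i \<in> I then {-R..R} else {0})"
proof -
  have "\<bar>R * sin (x i / R)\<bar> \<le> R" using assms by (simp add: abs_mult mult_left_le)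
  then show ?thesis by (auto simp: sin_coords_def abs_le_iff)
qed

lemma lipschitz_coords_trig_poly_approx_countable:
  fixes f :: "('i::countable \<Rightarrow> real) \<Rightarrow> real"
  assumes I: "finite I" and f: "lipschitz_coords I L f" and R: "0 < R" and e: "0 < e"
  obtains g where "trig_poly I (\<lambda>x. complex_of_real (g x))" "\<And>x. \<bar>f (sin_coords I R x) - g x\<bar> < e"
proof -
  define S where "S = {x :: 'i \<Rightarrow> real. \<forall>i. x i \<in> (if i \<in> I then {-R..R} else {0})}"
  let ?A = "\<lambda>g :: ('i \<Rightarrow> real) \<Rightarrow> real. continuous_on S g \<and> trig_poly I (\<lambda>x. complex_of_real (g (sin_coords I R x)))"
  have "\<exists>g. ?A g \<and> (\<forall>x\<in>S. \<bar>f x - g x\<bar> < e)"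
  proof (rule Stone_Weierstrass_HOL[of S ?A f])
    show "compact S" unfolding S_def by (rule compact_supported_box)
    show "continuous_on S f"
      using lipschitz_coords_imp_continuous[OF f] continuous_on_subset by blast
    show "?A (\<lambda>x. c)" for c by (simp add: trig_poly_const)
    show "?A (\<lambda>x. f x + g x)" if "?A f \<and> ?A g" for f g
      using that by (simp add: continuous_on_add trig_poly.add)
    show "?A (\<lambda>x. f x * g x)" if "?A f \<and> ?A g" for f g
      using that by (simp add: continuous_on_mult trig_poly_mult)
    show "\<exists>g. ?A g \<and> g x \<noteq> g y" if xy: "x \<in> S \<and> y \<in> S \<and> x \<noteq> y" for x y
    proof -
      obtain i where i: "x i \<noteq> y i" using xy by auto
      then have "i \<in> I" using xy unfolding S_def by (smt (verit) mem_Collect_eq singletonD)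
      then have "?A (\<lambda>x. x i)"
        using trig_poly_sin[OF I, of i R] continuous_on_subset[OF continuous_on_product_coordinates[of i], of S]
        by (simp add: sin_coords_def)
      then show ?thesis using i by blast
    qed
  qed (use e in auto)
  then obtain g where "?A g" "\<And>x. x \<in> S \<Longrightarrow> \<bar>f x - g x\<bar> < e" by blast
  moreover have "sin_coords I R x \<in> S" for x
    unfolding S_def by (intro CollectI allI sin_coords_in_box[OF R])
  ultimately show thesis using that[of "\<lambda>x. g (sin_coords I R x)"] by blast
qed

lemma lipschitz_coords_trig_poly_approx:
  assumes I: "finite I" and f: "lipschitz_coords I L f" and R: "0 < R" and e: "0 < e"
  obtains g where "trig_poly I (\<lambda>x. complex_of_real (g x))" "\<And>x. \<bar>f (sin_coords I R x) - g x\<bar> < e"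
proof -
  obtain b where b: "bij_betw b {..<card I} I"
    using bij_betw_from_nat_into_finite[OF I] by blast
  obtain f' where f': "lipschitz_coords {..<card I} L f'" and ff': "\<And>x. f x = f' (\<lambda>j. x (b j))"
    using lipschitz_coords_reindex[OF b f] by blast
  obtain g where g: "trig_poly {..<card I} (\<lambda>x. complex_of_real (g x))"
    and f'g: "\<And>x. \<bar>f' (sin_coords {..<card I} R x) - g x\<bar> < e"
    using lipschitz_coords_trig_poly_approx_countable[OF finite_lessThan f' R e] by blast
  have "b j \<in> I" if "j < card I" for j using b that by (auto simp: bij_betw_def)
  then have "f (sin_coords I R x) = f' (sin_coords {..<card I} R (\<lambda>j. x (b j)))" for x
    unfolding ff'
    using lipschitz_coordsD(2)[OF f', of "\<lambda>j. sin_coords I R x (b j)" "sin_coords {..<card I} R (\<lambda>j. x (b j))"]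
    by (simp add: sin_coords_def)
  then show thesis
    using that[of "\<lambda>x. g (\<lambda>j. x (b j))"] trig_poly_reindex[OF g b] f'g by simp
qed

lemma abs_scaled_sin_diff_le:
  fixes x R :: real
  assumes "0 < R" shows "\<bar>R * sin (x / R) - x\<bar> \<le> x\<^sup>2 / R"
proof -
  have "\<bar>sin (x / R) - x / R\<bar> \<le> (x / R)\<^sup>2 / 2"
    using Maclaurin_sin_bound[of "x / R" 2]
    by (simp add: numeral_2_eq_2 sin_coeff_def power2_eq_square)
  then have "R * \<bar>sin (x / R) - x / R\<bar> \<le> R * ((x / R)\<^sup>2 / 2)"
    using assms by (intro mult_left_mono) auto
  also have "\<dots> \<le> x\<^sup>2 / R" using assms by (simp add: power2_eq_square field_simps)
  also have "R * \<bar>sin (x / R) - x / R\<bar> = \<bar>R * (sin (x / R) - x / R)\<bar>"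
    using assms by (simp add: abs_mult)
  finally show ?thesis using assms by (simp add: right_diff_distrib)
qed

lemma abs_integral_diff_le:
  fixes f g h :: "'a \<Rightarrow> real"
  assumes "integrable M f" "integrable M g" "integrable M h"
    and "\<And>x. x \<in> space M \<Longrightarrow> \<bar>f x - g x\<bar> \<le> h x"
  shows "\<bar>(\<integral>x. f x \<partial>M) - (\<integral>x. g x \<partial>M)\<bar> \<le> (\<integral>x. h x \<partial>M)"
proof -
  have "\<bar>(\<integral>x. f x \<partial>M) - (\<integral>x. g x \<partial>M)\<bar> = \<bar>\<integral>x. f x - g x \<partial>M\<bar>"
    using assms by simp
  also have "\<dots> \<le> (\<integral>x. \<bar>f x - g x\<bar> \<partial>M)" by (rule integral_abs_bound)
  also have "\<dots> \<le> (\<integral>x. h x \<partial>M)" using assms by (intro integral_mono) auto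
  finally show ?thesis .
qed

lemma (in prob_space) abs_expectation_sin_coords_diff_le:
  assumes I: "finite I" and f: "lipschitz_coords I L f" and bnd: "\<And>x. \<bar>f x\<bar> \<le> b"
    and U: "\<And>i. i \<in> I \<Longrightarrow> (\<lambda>\<omega>. U \<omega> i) \<in> borel_measurable M" and R: "0 < R"
    and U2: "\<And>i. i \<in> I \<Longrightarrow> integrable M (\<lambda>\<omega>. (U \<omega> i)\<^sup>2) \<and> (\<integral>\<omega>. (U \<omega> i)\<^sup>2 \<partial>M) \<le> c"
  shows "\<bar>(\<integral>\<omega>. f (sin_coords I R (U \<omega>)) \<partial>M) - (\<integral>\<omega>. f (U \<omega>) \<partial>M)\<bar> \<le> L * (real (card I) * c) / R"
proof -
  note L = lipschitz_coordsD[OF f]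
  have "\<bar>(\<integral>\<omega>. f (sin_coords I R (U \<omega>)) \<partial>M) - (\<integral>\<omega>. f (U \<omega>) \<partial>M)\<bar> \<le> (\<integral>\<omega>. L * (\<Sum>i\<in>I. (U \<omega> i)\<^sup>2 / R) \<partial>M)"
  proof (rule abs_integral_diff_le)
    show "integrable M (\<lambda>\<omega>. f (sin_coords I R (U \<omega>)))" "integrable M (\<lambda>\<omega>. f (U \<omega>))"
      using integrable_lipschitz_coords[where Y = U, OF I f U bnd]
        integrable_lipschitz_coords[where Y = "\<lambda>\<omega>. sin_coords I R (U \<omega>)", OF I f measurable_sin_coords[OF U] bnd]
      by auto
    show "integrable M (\<lambda>\<omega>. L * (\<Sum>i\<in>I. (U \<omega> i)\<^sup>2 / R))"
      using U2 by (intro integrable_mult_right Bochner_Integration.integrable_sum integrable_divide) auto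
    show "\<bar>f (sin_coords I R (U \<omega>)) - f (U \<omega>)\<bar> \<le> L * (\<Sum>i\<in>I. (U \<omega> i)\<^sup>2 / R)" for \<omega>
    proof -
      have "\<bar>f (sin_coords I R (U \<omega>)) - f (U \<omega>)\<bar> \<le> L * (\<Sum>i\<in>I. \<bar>sin_coords I R (U \<omega>) i - U \<omega> i\<bar>)"
        by (rule L)
      also have "\<dots> \<le> L * (\<Sum>i\<in>I. (U \<omega> i)\<^sup>2 / R)"
        using abs_scaled_sin_diff_le[OF R] L(1) by (intro mult_left_mono sum_mono) (auto simp: sin_coords_def)
      finally show ?thesis .
    qed
  qed
  also have "\<dots> = L * (\<Sum>i\<in>I. (\<integral>\<omega>. (U \<omega> i)\<^sup>2 \<partial>M) / R)"
    using U2 by (subst integral_mult_right_zero, subst Bochner_Integration.integral_sum) auto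
  also have "\<dots> \<le> L * (\<Sum>i\<in>I. c / R)"
    using L(1) R U2 by (intro mult_left_mono sum_mono divide_right_mono) auto
  finally show ?thesis by simp
qed

lemma (in prob_space) abs_expectation_trig_approx_le:
  assumes I: "finite I" and f: "lipschitz_coords I L f" and bnd: "\<And>x. \<bar>f x\<bar> \<le> b" and R: "0 < R"
    and g: "trig_poly I (\<lambda>x. complex_of_real (g x))" and fg: "\<And>x. \<bar>f (sin_coords I R x) - g x\<bar> \<le> e"
    and U: "\<And>i. i \<in> I \<Longrightarrow> (\<lambda>\<omega>. U \<omega> i) \<in> borel_measurable M"
    and U2: "\<And>i. i \<in> I \<Longrightarrow> integrable M (\<lambda>\<omega>. (U \<omega> i)\<^sup>2) \<and> (\<integral>\<omega>. (U \<omega> i)\<^sup>2 \<partial>M) \<le> c"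
  shows "\<bar>(\<integral>\<omega>. f (U \<omega>) \<partial>M) - (\<integral>\<omega>. g (U \<omega>) \<partial>M)\<bar> \<le> e + L * (real (card I) * c) / R"
proof -
  have "integrable M (\<lambda>\<omega>. g (U \<omega>))"
    using trig_poly_integrable[where Y = U, OF g U] by (simp add: complex_of_real_integrable_eq)
  then have "\<bar>(\<integral>\<omega>. f (sin_coords I R (U \<omega>)) \<partial>M) - (\<integral>\<omega>. g (U \<omega>) \<partial>M)\<bar> \<le> (\<integral>\<omega>. e \<partial>M)"
    by (intro abs_integral_diff_le integrable_lipschitz_coords[OF I f _ bnd] measurable_sin_coords U fg) auto
  also have "\<dots> = e" by (simp add: prob_space)
  finally show ?thesis
    using abs_expectation_sin_coords_diff_le[where U = U, OF I f bnd U R U2] by linarith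
qed

text \<open>Composing \<open>f\<close> with \<open>x \<mapsto> R sin (x / R)\<close> costs only \<open>O(1/R)\<close> in mean and confines the argument to a
  compact box, where Stone--Weierstrass turns \<open>f\<close> into a trigonometric polynomial.\<close>
lemma expectation_lipschitz_coords_tendsto:
  fixes Y :: "nat \<Rightarrow> 'a \<Rightarrow> 'i \<Rightarrow> real" and V :: "'b \<Rightarrow> 'i \<Rightarrow> real"
  assumes P: "prob_space P" and N: "prob_space N" and I: "finite I"
    and f: "lipschitz_coords I L f" and bnd: "\<And>x. \<bar>f x\<bar> \<le> b"
    and Y: "\<And>n i. i \<in> I \<Longrightarrow> (\<lambda>\<omega>. Y n \<omega> i) \<in> borel_measurable P"
    and V: "\<And>i. i \<in> I \<Longrightarrow> (\<lambda>\<omega>. V \<omega> i) \<in> borel_measurable N"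
    and cf: "\<And>t. (\<lambda>n. \<integral>\<omega>. cis (\<Sum>i\<in>I. t i * Y n \<omega> i) \<partial>P) \<longlonglongrightarrow> (\<integral>\<omega>. cis (\<Sum>i\<in>I. t i * V \<omega> i) \<partial>N)"
    and Y2: "\<And>n i. i \<in> I \<Longrightarrow> integrable P (\<lambda>\<omega>. (Y n \<omega> i)\<^sup>2) \<and> (\<integral>\<omega>. (Y n \<omega> i)\<^sup>2 \<partial>P) \<le> c"
    and V2: "\<And>i. i \<in> I \<Longrightarrow> integrable N (\<lambda>\<omega>. (V \<omega> i)\<^sup>2) \<and> (\<integral>\<omega>. (V \<omega> i)\<^sup>2 \<partial>N) \<le> c"
  shows "(\<lambda>n. \<integral>\<omega>. f (Y n \<omega>) \<partial>P) \<longlonglongrightarrow> (\<integral>\<omega>. f (V \<omega>) \<partial>N)"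
proof (rule LIMSEQ_I)
  fix e :: real assume e: "0 < e"
  define R where "R = max 1 (L * (real (card I) * c) * 5 / e)"
  have R: "0 < R" by (simp add: R_def)
  have "L * (real (card I) * c) * 5 / e \<le> R" by (simp add: R_def)
  then have Re: "L * (real (card I) * c) / R \<le> e / 5"
    using R e by (simp add: field_simps)
  obtain g where g: "trig_poly I (\<lambda>x. complex_of_real (g x))"
    and fg: "\<And>x. \<bar>f (sin_coords I R x) - g x\<bar> < e / 5"
    using lipschitz_coords_trig_poly_approx[OF I f R, of "e / 5"] e by auto
  have "(\<lambda>n. \<integral>\<omega>. complex_of_real (g (Y n \<omega>)) \<partial>P) \<longlonglongrightarrow> (\<integral>\<omega>. complex_of_real (g (V \<omega>)) \<partial>N)"
    by (rule trig_poly_tendsto[OF g P N Y V cf])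
  then have "(\<lambda>n. \<integral>\<omega>. g (Y n \<omega>) \<partial>P) \<longlonglongrightarrow> (\<integral>\<omega>. g (V \<omega>) \<partial>N)"
    unfolding integral_complex_of_real by (rule tendsto_of_real_iff[THEN iffD1])
  from LIMSEQ_D[OF this, of "e / 5"] e obtain n0 where
    n0: "\<And>n. n \<ge> n0 \<Longrightarrow> \<bar>(\<integral>\<omega>. g (Y n \<omega>) \<partial>P) - (\<integral>\<omega>. g (V \<omega>) \<partial>N)\<bar> < e / 5" by auto
  have fg_P: "\<bar>(\<integral>\<omega>. f (Y n \<omega>) \<partial>P) - (\<integral>\<omega>. g (Y n \<omega>) \<partial>P)\<bar> \<le> e / 5 + L * (real (card I) * c) / R" for n
    by (rule prob_space.abs_expectation_trig_approx_le[OF P I f bnd R g less_imp_le[OF fg] Y Y2])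
  have fg_N: "\<bar>(\<integral>\<omega>. f (V \<omega>) \<partial>N) - (\<integral>\<omega>. g (V \<omega>) \<partial>N)\<bar> \<le> e / 5 + L * (real (card I) * c) / R"
    by (rule prob_space.abs_expectation_trig_approx_le[OF N I f bnd R g less_imp_le[OF fg] V V2])
  have "\<bar>(\<integral>\<omega>. f (Y n \<omega>) \<partial>P) - (\<integral>\<omega>. f (V \<omega>) \<partial>N)\<bar> < e" if "n \<ge> n0" for n
    using n0[OF that] fg_P[of n] fg_N Re by linarith
  then show "\<exists>no. \<forall>n\<ge>no. norm ((\<integral>\<omega>. f (Y n \<omega>) \<partial>P) - (\<integral>\<omega>. f (V \<omega>) \<partial>N)) < e" by auto
qed

section \<open>Exponential moments and characteristic functions of bounded variables\<close>

lemma tendsto_const_over_sqrt: "(\<lambda>n. c / sqrt (real n)) \<longlonglongrightarrow> 0"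
  by (intro tendsto_divide_0[OF tendsto_const] filterlim_at_top_imp_at_infinity
      filterlim_compose[OF sqrt_at_top filterlim_real_sequentially])

lemma exp_minus_le_quadratic:
  fixes y :: real
  assumes "0 \<le> y" shows "exp (- y) \<le> 1 - y + y\<^sup>2"
proof -
  have "exp (- y) \<le> 1 / (1 + y)"
    using exp_ge_add_one_self[of y] assms by (simp add: exp_minus field_simps)
  also have "\<dots> \<le> 1 - y + y\<^sup>2"
  proof -
    have "(1 - y + y\<^sup>2) * (1 + y) = 1 + y ^ 3"
      by (simp add: algebra_simps power2_eq_square power3_eq_cube)
    then have "1 \<le> (1 - y + y\<^sup>2) * (1 + y)" using assms by simp
    then show ?thesis using assms by (simp add: divide_le_eq)
  qed
  finally show ?thesis .
qed

lemma exp_le_quadratic: "\<bar>x\<bar> \<le> 1 \<Longrightarrow> exp x \<le> 1 + x + x\<^sup>2" for x :: real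
  using exp_bound[of x] exp_minus_le_quadratic[of "- x"] by (cases "0 \<le> x") auto

lemma abs_exp_minus_diff_le:
  fixes a b :: real
  assumes "0 \<le> a" "0 \<le> b" shows "\<bar>exp (- a) - exp (- b)\<bar> \<le> \<bar>a - b\<bar>"
  using assms
proof (induction a b rule: linorder_wlog)
  case (le a b)
  have "exp (- a) * (1 - exp (- (b - a))) \<le> 1 * (b - a)"
    using le exp_ge_add_one_self[of "- (b - a)"] by (intro mult_mono) (linarith | simp)+
  then show ?case using le by (simp add: right_diff_distrib exp_add[symmetric])
qed (simp add: abs_minus_commute)

lemma square_le_exp_sum: "x\<^sup>2 \<le> 2 * (exp x + exp (- x))" for x :: real
proof -
  have "1 + \<bar>x\<bar> + \<bar>x\<bar>\<^sup>2 / 2 \<le> exp \<bar>x\<bar>" by (rule exp_lower_Taylor_quadratic) simp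
  also have "\<dots> \<le> exp x + exp (- x)" by (cases "0 \<le> x") auto
  finally show ?thesis by simp
qed

lemma abs_mult_diff_le_1:
  fixes a b t :: real
  assumes "\<bar>t\<bar> \<le> 1 / 2" "\<bar>a\<bar> \<le> 1" "\<bar>b\<bar> \<le> 1" shows "\<bar>t * (a - b)\<bar> \<le> 1"
proof -
  have "\<bar>a - b\<bar> \<le> 2" using assms by linarith
  then have "\<bar>t\<bar> * \<bar>a - b\<bar> \<le> 1 / 2 * 2" using assms(1) by (intro mult_mono) auto
  then show ?thesis by (simp add: abs_mult)
qed

context prob_space
begin

lemma abs_expectation_le:
  assumes "Y \<in> borel_measurable M" "\<And>x. x \<in> space M \<Longrightarrow> \<bar>Y x\<bar> \<le> (c::real)"
  shows "\<bar>expectation Y\<bar> \<le> c"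
proof -
  have "integrable M Y" by (rule integrable_const_bound[of _ c]) (use assms in auto)
  then have "\<bar>expectation Y - expectation (\<lambda>_. 0)\<bar> \<le> expectation (\<lambda>_. c)"
    using assms(2) by (intro abs_integral_diff_le) auto
  then show ?thesis by (simp add: prob_space)
qed

definition mgf_le :: "real \<Rightarrow> real \<Rightarrow> ('a \<Rightarrow> real) \<Rightarrow> bool" where
  "mgf_le \<theta> b Y \<longleftrightarrow> integrable M (\<lambda>\<omega>. exp (\<theta> * Y \<omega>)) \<and> expectation (\<lambda>\<omega>. exp (\<theta> * Y \<omega>)) \<le> b"

lemma mgf_le_mono: "mgf_le \<theta> b Y \<Longrightarrow> b \<le> b' \<Longrightarrow> mgf_le \<theta> b' Y"
  by (auto simp: mgf_le_def)

lemma chernoff_two_sided: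
  assumes [measurable]: "Y \<in> borel_measurable M" and \<theta>: "0 \<le> \<theta>"
    and mgf: "mgf_le \<theta> c Y" "mgf_le (- \<theta>) c Y"
  shows "prob {\<omega>\<in>space M. x < \<bar>Y \<omega>\<bar>} \<le> 2 * c * exp (- (\<theta> * x))"
proof -
  let ?f = "\<lambda>\<omega>. exp (\<theta> * Y \<omega>) + exp (- \<theta> * Y \<omega>)"
  have "exp (\<theta> * x) \<le> ?f \<omega>" if "x < \<bar>Y \<omega>\<bar>" for \<omega>
  proof -
    have "\<theta> * x \<le> \<theta> * \<bar>Y \<omega>\<bar>" using that \<theta> by (intro mult_left_mono) auto
    then have "exp (\<theta> * x) \<le> exp (\<theta> * \<bar>Y \<omega>\<bar>)" by simp
    also have "\<dots> \<le> ?f \<omega>" by (cases "0 \<le> Y \<omega>") auto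
    finally show ?thesis .
  qed
  then have "prob {\<omega>\<in>space M. x < \<bar>Y \<omega>\<bar>} \<le> prob {\<omega>\<in>space M. exp (\<theta> * x) \<le> ?f \<omega>}"
    by (intro finite_measure_mono) auto
  also have "\<dots> \<le> expectation ?f / exp (\<theta> * x)"
    by (rule integral_Markov_inequality_measure[of _ _ "{}"]) (use mgf in \<open>auto simp: mgf_le_def\<close>)
  also have "expectation ?f \<le> 2 * c" using mgf by (simp add: mgf_le_def)
  finally show ?thesis by (simp add: exp_minus field_simps divide_right_mono)
qed

lemma mgf_centered_le:
  assumes [measurable]: "Y \<in> borel_measurable M" and Y1: "\<And>x. \<bar>Y x\<bar> \<le> (1::real)" and t: "\<bar>t\<bar> \<le> 1 / 2"
  shows "expectation (\<lambda>x. exp (t * (Y x - expectation Y))) \<le> exp (t\<^sup>2 * expectation (\<lambda>x. (Y x)\<^sup>2))"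
proof -
  let ?\<mu> = "expectation Y"
  have iY: "integrable M Y" by (rule integrable_const_bound[of _ 1]) (use Y1 in auto)
  have iY2: "integrable M (\<lambda>x. (Y x)\<^sup>2)"
    by (rule integrable_const_bound[of _ 1]) (use Y1 in \<open>auto simp: abs_square_le_1\<close>)
  have small: "\<bar>t * (Y x - ?\<mu>)\<bar> \<le> 1" for x
    using Y1 by (intro abs_mult_diff_le_1 t abs_expectation_le) auto
  have "expectation (\<lambda>x. exp (t * (Y x - ?\<mu>))) \<le> expectation (\<lambda>x. 1 + t * (Y x - ?\<mu>) + (t * (Y x - ?\<mu>))\<^sup>2)"
  proof (rule integral_mono)
    show "integrable M (\<lambda>x. exp (t * (Y x - ?\<mu>)))"
      by (rule integrable_const_bound[of _ "exp 1"]) (use small in \<open>auto simp: abs_le_iff\<close>)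
    show "integrable M (\<lambda>x. 1 + t * (Y x - ?\<mu>) + (t * (Y x - ?\<mu>))\<^sup>2)"
      using iY iY2 by (simp add: power_mult_distrib power2_diff)
  qed (rule exp_le_quadratic[OF small])
  also have "\<dots> = 1 + t\<^sup>2 * (expectation (\<lambda>x. (Y x)\<^sup>2) - ?\<mu>\<^sup>2)"
    using iY iY2 by (simp add: power_mult_distrib power2_diff prob_space) (simp add: power2_eq_square algebra_simps)
  also have "\<dots> \<le> 1 + t\<^sup>2 * expectation (\<lambda>x. (Y x)\<^sup>2)" by (simp add: mult_left_mono)
  also have "\<dots> \<le> exp (t\<^sup>2 * expectation (\<lambda>x. (Y x)\<^sup>2))" by (rule exp_ge_add_one_self)
  finally show ?thesis .
qed

lemma cmod_cf_minus_quadratic_le: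
  assumes [measurable]: "Y \<in> borel_measurable M" and Y: "\<And>x. \<bar>Y x\<bar> \<le> (c::real)" and mean: "expectation Y = 0"
  shows "cmod (expectation (\<lambda>x. cis (t * Y x)) - (1 - t\<^sup>2 * expectation (\<lambda>x. (Y x)\<^sup>2) / 2)) \<le> \<bar>t\<bar> ^ 3 * c ^ 3"
proof -
  have c: "0 \<le> c" using order_trans[OF abs_ge_zero Y] .
  have "expectation (\<lambda>x. cis (t * Y x)) = char (distr M borel Y) t"
    by (simp add: char_def integral_distr cis_conv_exp)
  moreover have "cmod (char (distr M borel Y) t - (1 - t\<^sup>2 * expectation (\<lambda>x. (Y x)\<^sup>2) / 2))
      \<le> (t\<^sup>2 / 6) * expectation (\<lambda>x. min (6 * (Y x)\<^sup>2) (\<bar>t\<bar> * \<bar>Y x\<bar> ^ 3))"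
  proof (rule char_approx3')
    show "integrable M Y" by (rule integrable_const_bound[of _ c]) (use Y in auto)
    show "integrable M (\<lambda>x. (Y x)\<^sup>2)"
      by (rule integrable_const_bound[of _ "c\<^sup>2"]) (use Y c in \<open>auto simp: abs_le_square_iff[symmetric]\<close>)
  qed (use mean in auto)
  also have "(t\<^sup>2 / 6) * expectation (\<lambda>x. min (6 * (Y x)\<^sup>2) (\<bar>t\<bar> * \<bar>Y x\<bar> ^ 3)) \<le> t\<^sup>2 * (\<bar>t\<bar> * c ^ 3)"
  proof (rule mult_mono)
    have "min (6 * (Y x)\<^sup>2) (\<bar>t\<bar> * \<bar>Y x\<bar> ^ 3) \<le> \<bar>t\<bar> * c ^ 3" for x
      using Y[of x] by (intro min.coboundedI2 mult_left_mono power_mono) auto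
    then have "\<bar>min (6 * (Y x)\<^sup>2) (\<bar>t\<bar> * \<bar>Y x\<bar> ^ 3)\<bar> \<le> \<bar>t\<bar> * c ^ 3" for x
      by (simp add: min_def split: if_splits)
    then show "expectation (\<lambda>x. min (6 * (Y x)\<^sup>2) (\<bar>t\<bar> * \<bar>Y x\<bar> ^ 3)) \<le> \<bar>t\<bar> * c ^ 3"
      by (intro order_trans[OF abs_ge_self abs_expectation_le]) auto
  qed (auto intro!: integral_nonneg_AE)
  finally show ?thesis by (simp add: power3_eq_cube power2_eq_square abs_mult_self_eq mult.assoc)
qed

lemma cf_power_approx:
  assumes Ym [measurable]: "Y \<in> borel_measurable M" and Y: "\<And>x. \<bar>Y x\<bar> \<le> (c::real)"
    and mean: "expectation Y = 0" and n: "0 < n"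
  shows "cmod (expectation (\<lambda>x. cis (Y x / sqrt (real n))) ^ n - exp (- expectation (\<lambda>x. (Y x)\<^sup>2) / 2))
    \<le> (c ^ 3 + c ^ 4) / sqrt (real n)"
proof -
  define t where "t = 1 / sqrt (real n)"
  have t: "0 < t" "t \<le> 1" "real n * t\<^sup>2 = 1" using n by (auto simp: t_def power_divide)
  define \<sigma> where "\<sigma> = expectation (\<lambda>x. (Y x)\<^sup>2)"
  define \<phi> where "\<phi> = expectation (\<lambda>x. cis (t * Y x))"
  define y where "y = t\<^sup>2 * \<sigma> / 2"
  have c: "0 \<le> c" using order_trans[OF abs_ge_zero Y] .
  have \<sigma>: "0 \<le> \<sigma>" "\<sigma> \<le> c\<^sup>2"
    using abs_expectation_le[of "\<lambda>x. (Y x)\<^sup>2" "c\<^sup>2"] Y c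
    by (auto simp: \<sigma>_def abs_le_square_iff[symmetric] intro!: integral_nonneg_AE)
  have y: "0 \<le> y" "y \<le> t\<^sup>2 * c\<^sup>2"
    using \<sigma> t(1) mult_left_mono[OF \<sigma>(2), of "t\<^sup>2"] by (auto simp: y_def)
  have "cmod (\<phi> - of_real (1 - y)) \<le> t ^ 3 * c ^ 3"
    using cmod_cf_minus_quadratic_le[OF Ym Y mean, of t] t(1) by (simp add: \<phi>_def y_def \<sigma>_def)
  moreover have "cmod (of_real (exp (- y) - (1 - y))) \<le> t ^ 3 * c ^ 4"
  proof -
    have "cmod (of_real (exp (- y) - (1 - y))) \<le> y\<^sup>2"
      using exp_minus_le_quadratic[OF y(1)] exp_ge_add_one_self[of "- y"] unfolding norm_of_real by simp
    also have "\<dots> \<le> (t\<^sup>2 * c\<^sup>2)\<^sup>2" using y by (intro power_mono)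
    also have "\<dots> = t * (t ^ 3 * c ^ 4)" by (simp add: eval_nat_numeral algebra_simps)
    also have "\<dots> \<le> 1 * (t ^ 3 * c ^ 4)" using t c by (intro mult_right_mono) auto
    finally show ?thesis by simp
  qed
  ultimately have "cmod (\<phi> - of_real (exp (- y))) \<le> t ^ 3 * (c ^ 3 + c ^ 4)"
    using norm_triangle_ineq4[of "\<phi> - of_real (1 - y)" "of_real (exp (- y) - (1 - y))"]
    by (simp add: algebra_simps)
  moreover have "cmod \<phi> \<le> 1"
    unfolding \<phi>_def using integral_norm_bound[of M "\<lambda>x. cis (t * Y x)"] by (simp add: prob_space)
  ultimately have "cmod (\<phi> ^ n - of_real (exp (- y)) ^ n) \<le> real n * (t ^ 3 * (c ^ 3 + c ^ 4))"
    using norm_power_diff[of \<phi> "of_real (exp (- y))" n] y(1)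
    by (intro order_trans[OF norm_power_diff] mult_left_mono) auto
  also have "\<dots> = (real n * t\<^sup>2) * t * (c ^ 3 + c ^ 4)" by (simp add: eval_nat_numeral)
  also have "\<dots> = (c ^ 3 + c ^ 4) / sqrt (real n)" unfolding t(3) by (simp add: t_def)
  also have "of_real (exp (- y)) ^ n = of_real (exp (- \<sigma> / 2))"
  proof -
    have "real n * (- y) = - \<sigma> / 2" using t(3) by (simp add: y_def mult.assoc[symmetric])
    then have "exp (- y) ^ n = exp (- \<sigma> / 2)" by (simp only: exp_of_nat_mult[symmetric])
    then show ?thesis by (metis of_real_power)
  qed
  finally show ?thesis by (simp add: \<phi>_def \<sigma>_def t_def)
qed

lemma cmod_expectation_mult_prod_diff_le:
  fixes b :: "'a \<Rightarrow> complex" and \<phi> :: "'i \<Rightarrow> 'a \<Rightarrow> complex" and e :: "'i \<Rightarrow> complex"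
  assumes [measurable]: "b \<in> borel_measurable M" "\<And>i. \<phi> i \<in> borel_measurable M"
    and b: "\<And>\<omega>. cmod (b \<omega>) \<le> 1" and \<phi>: "\<And>i \<omega>. cmod (\<phi> i \<omega>) \<le> 1" and e: "\<And>i. cmod (e i) \<le> 1"
  shows "cmod (expectation (\<lambda>\<omega>. b \<omega> * (\<Prod>i\<in>I. \<phi> i \<omega>)) - z * (\<Prod>i\<in>I. e i))
    \<le> cmod (expectation b - z) + (\<Sum>i\<in>I. expectation (\<lambda>\<omega>. cmod (\<phi> i \<omega> - e i)))"
proof -
  let ?P = "\<lambda>\<omega>. \<Prod>i\<in>I. \<phi> i \<omega>" and ?E = "\<Prod>i\<in>I. e i"
  have cmod_le_one: "cmod ?E \<le> 1" "cmod (?P \<omega>) \<le> 1" for \<omega>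
    unfolding prod_norm[symmetric] by (intro prod_le_1; simp add: e \<phi>)+
  have integrable_b: "integrable M b" by (rule integrable_const_bound[of _ 1]) (auto simp: b)
  have integrable_b_mult: "integrable M (\<lambda>\<omega>. b \<omega> * ?P \<omega>)"
    by (rule integrable_const_bound[of _ 1]) (auto simp: norm_mult intro!: mult_le_one b cmod_le_one)
  have "cmod (\<phi> i \<omega> - e i) \<le> 2" for i \<omega>
    using norm_triangle_ineq4[of "\<phi> i \<omega>" "e i"] \<phi>[of i \<omega>] e[of i] by linarith
  then have i\<phi>: "integrable M (\<lambda>\<omega>. cmod (\<phi> i \<omega> - e i))" for i
    by (intro integrable_const_bound[of _ 2]) auto
  have "cmod (expectation (\<lambda>\<omega>. b \<omega> * ?P \<omega>) - expectation b * ?E) \<le> expectation (\<lambda>\<omega>. \<Sum>i\<in>I. cmod (\<phi> i \<omega> - e i))"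
  proof -
    have "expectation (\<lambda>\<omega>. b \<omega> * ?P \<omega>) - expectation b * ?E = expectation (\<lambda>\<omega>. b \<omega> * (?P \<omega> - ?E))"
      using integrable_b integrable_b_mult by (simp add: right_diff_distrib)
    also have "cmod \<dots> \<le> expectation (\<lambda>\<omega>. cmod (b \<omega> * (?P \<omega> - ?E)))" by (rule integral_norm_bound)
    also have "\<dots> \<le> expectation (\<lambda>\<omega>. \<Sum>i\<in>I. cmod (\<phi> i \<omega> - e i))"
    proof (rule integral_mono)
      show "integrable M (\<lambda>\<omega>. cmod (b \<omega> * (?P \<omega> - ?E)))"
        using integrable_b integrable_b_mult by (simp add: right_diff_distrib)
      show "cmod (b \<omega> * (?P \<omega> - ?E)) \<le> (\<Sum>i\<in>I. cmod (\<phi> i \<omega> - e i))" for \<omega>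
        using mult_mono[OF b[of \<omega>] norm_prod_diff[of I "\<lambda>i. \<phi> i \<omega>" e, OF \<phi> e]] by (simp add: norm_mult)
    qed (intro Bochner_Integration.integrable_sum i\<phi>)
    finally show ?thesis .
  qed
  moreover have "cmod (expectation b * ?E - z * ?E) \<le> cmod (expectation b - z)"
    unfolding left_diff_distrib[symmetric] norm_mult using cmod_le_one(1) by (rule mult_left_le) simp
  ultimately show ?thesis
    using norm_triangle_ineq[of "expectation (\<lambda>\<omega>. b \<omega> * ?P \<omega>) - expectation b * ?E" "expectation b * ?E - z * ?E"] i\<phi>
    by (simp add: Bochner_Integration.integral_sum)
qed

end

section \<open>Events of almost full probability\<close>

context prob_space
begin

definition nearly_surely :: "real \<Rightarrow> ('a \<Rightarrow> bool) \<Rightarrow> bool" where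
  "nearly_surely \<epsilon> Q \<longleftrightarrow> (\<exists>E\<in>events. prob E \<le> \<epsilon> \<and> (\<forall>\<omega>\<in>space M - E. Q \<omega>))"

lemma nearly_surelyE:
  assumes "nearly_surely \<epsilon> Q"
  obtains E where "E \<in> events" "prob E \<le> \<epsilon>" "\<And>\<omega>. \<omega> \<in> space M - E \<Longrightarrow> Q \<omega>"
  using assms unfolding nearly_surely_def by blast

lemma nearly_surelyI:
  assumes "{\<omega>\<in>space M. \<not> Q \<omega>} \<in> events" "prob {\<omega>\<in>space M. \<not> Q \<omega>} \<le> \<epsilon>"
  shows "nearly_surely \<epsilon> Q"
  using assms unfolding nearly_surely_def by blast

lemma nearly_surely_mono:
  assumes "nearly_surely \<epsilon> Q" "\<epsilon> \<le> \<epsilon>'" "\<And>\<omega>. \<omega> \<in> space M \<Longrightarrow> Q \<omega> \<Longrightarrow> Q' \<omega>"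
  shows "nearly_surely \<epsilon>' Q'"
  using assms unfolding nearly_surely_def by (meson DiffD1 order_trans)

lemma nearly_surely_conj:
  assumes "nearly_surely \<epsilon> Q" "nearly_surely \<epsilon>' Q'"
  shows "nearly_surely (\<epsilon> + \<epsilon>') (\<lambda>\<omega>. Q \<omega> \<and> Q' \<omega>)"
proof -
  obtain E E' where E: "E \<in> events" "prob E \<le> \<epsilon>" "\<And>\<omega>. \<omega> \<in> space M - E \<Longrightarrow> Q \<omega>"
    and E': "E' \<in> events" "prob E' \<le> \<epsilon>'" "\<And>\<omega>. \<omega> \<in> space M - E' \<Longrightarrow> Q' \<omega>"
    using assms by (auto elim!: nearly_surelyE)
  show ?thesis
    unfolding nearly_surely_def
    by (rule bexI[of _ "E \<union> E'"])
      (use E E' measure_Un_le[OF E(1) E'(1)] in auto)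
qed

lemma nearly_surely_ball_finite:
  assumes "finite I" "\<And>i. i \<in> I \<Longrightarrow> nearly_surely (p i) (Q i)"
  shows "nearly_surely (\<Sum>i\<in>I. p i) (\<lambda>\<omega>. \<forall>i\<in>I. Q i \<omega>)"
  using assms
proof (induction I rule: finite_induct)
  case empty
  then show ?case by (intro nearly_surelyI) auto
next
  case (insert i I)
  then show ?case using nearly_surely_conj[of "p i" "Q i"] by simp
qed

lemma nearly_surely_of_AE:
  assumes "AE \<omega> in M. Q \<omega>" shows "nearly_surely 0 Q"
proof -
  obtain E where "{\<omega>\<in>space M. \<not> Q \<omega>} \<subseteq> E" "emeasure M E = 0" "E \<in> events"
    using assms by (rule AE_E)
  then show ?thesis
    unfolding nearly_surely_def by (intro bexI[of _ E]) (auto simp: emeasure_eq_measure)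
qed

lemma AE_eventually_of_nearly_surely:
  assumes "\<And>j. nearly_surely (p j) (Q j)" "summable p"
  shows "AE \<omega> in M. eventually (\<lambda>j. Q j \<omega>) sequentially"
proof -
  obtain E where E: "\<And>j. E j \<in> events" "\<And>j. prob (E j) \<le> p j" "\<And>j \<omega>. \<omega> \<in> space M - E j \<Longrightarrow> Q j \<omega>"
    using assms(1) unfolding nearly_surely_def by metis
  have "AE \<omega> in M. eventually (\<lambda>j. \<omega> \<in> space M - E j) sequentially"
  proof (rule borel_cantelli_AE1)
    show "summable (\<lambda>j. prob (E j))"
      by (rule summable_comparison_test'[OF assms(2)]) (simp add: E)
  qed (use E in \<open>auto simp: emeasure_eq_measure\<close>)
  then show ?thesis
    by eventually_elim (rule eventually_mono, assumption, rule E(3))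
qed

end

definition chain_prob :: "nat \<Rightarrow> nat \<Rightarrow> real" where
  "chain_prob d j = real d * exp 2 * (1/2) ^ j"

lemma chain_prob_nonneg: "0 \<le> chain_prob d j"
  by (simp add: chain_prob_def)

lemma summable_chain_prob: "summable (chain_prob d)"
  unfolding chain_prob_def by (intro summable_mult summable_geometric) simp

lemma sum_chain_prob_le: "(\<Sum>j=l..L. chain_prob d j) \<le> 2 * chain_prob d l"
proof (cases "l \<le> L")
  case True
  have "(\<Sum>j=l..L. chain_prob d j) = chain_prob d l * (\<Sum>j=0..L-l. (1/2) ^ j)"
    using True by (subst sum.atLeastAtMost_shift_0) (auto simp: chain_prob_def sum_distrib_left power_add mult_ac)
  also have "\<dots> \<le> chain_prob d l * 2"
    by (intro mult_left_mono chain_prob_nonneg) (simp add: sum_gp0 atLeast0AtMost)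
  finally show ?thesis by simp
qed (simp add: chain_prob_nonneg)

lemma exp_minus_chain_step_le:
  "exp (- (sqrt 2 ^ j * chain_step d j)) \<le> (1 / 2) ^ ((d + 1) * Suc j)"
proof -
  have "sqrt 2 ^ j * sqrt (1/2) ^ j = 1"
    unfolding power_mult_distrib[symmetric] real_sqrt_mult[symmetric] by simp
  then have "sqrt 2 ^ j * chain_step d j = (real d + 1) * real (Suc j)"
    by (simp add: chain_step_def mult.left_commute)
  then have "exp (- (sqrt 2 ^ j * chain_step d j)) = exp (- 1) ^ ((d + 1) * Suc j)"
    by (simp only: exp_of_nat_mult[symmetric]) (simp add: algebra_simps)
  also have "\<dots> \<le> (1 / 2) ^ ((d + 1) * Suc j)"
  proof (rule power_mono)
    have "2 \<le> exp (1::real)" using exp_ge_add_one_self[of 1] by simp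
    then show "exp (- 1) \<le> (1 / 2 :: real)" by (simp add: exp_minus field_simps)
  qed simp
  finally show ?thesis .
qed

text \<open>The logarithmic factor in \<open>chain_step\<close> is what pays for the number of grid edges at level \<open>j\<close>.\<close>
lemma grid_edges_mult_tail_le:
  "real ((2 ^ j + 1) ^ d * d) * (2 * exp 2 * exp (- (sqrt 2 ^ j * chain_step d j))) \<le> chain_prob d j"
proof -
  have "(2 ^ j + 1 :: real) \<le> 2 ^ Suc j" by simp
  then have "(2 ^ j + 1 :: real) ^ d \<le> (2 ^ Suc j) ^ d" by (rule power_mono) simp
  also have "\<dots> = 2 ^ (Suc j * d)" by (rule power_mult[symmetric])
  finally have "real ((2 ^ j + 1) ^ d) \<le> 2 ^ (Suc j * d)" by (simp add: add.commute)
  then have "real ((2 ^ j + 1) ^ d * d) * (2 * exp 2 * exp (- (sqrt 2 ^ j * chain_step d j)))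
      \<le> (2 ^ (Suc j * d) * real d) * (2 * exp 2 * (1 / 2) ^ ((d + 1) * Suc j))"
    unfolding of_nat_mult using exp_minus_chain_step_le by (intro mult_mono) auto
  also have "\<dots> = real d * exp 2 * (2 * (2 ^ (Suc j * d) * (1 / 2) ^ (Suc j * d) * (1 / 2) ^ Suc j))"
    by (simp add: power_add[symmetric] algebra_simps)
  also have "(2::real) ^ (Suc j * d) * (1 / 2) ^ (Suc j * d) = 1"
    unfolding power_mult_distrib[symmetric] by simp
  finally show ?thesis by (simp add: chain_prob_def)
qed

lemma (in prob_space) nearly_surely_grid_increments_le:
  fixes f :: "'a \<Rightarrow> real^'p \<Rightarrow> real"
  assumes f: "\<And>u. u \<in> dyadic_grid j \<Longrightarrow> (\<lambda>\<omega>. f \<omega> u) \<in> borel_measurable M"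
    and mgf: "\<And>u k \<theta>. u \<in> dyadic_grid j \<Longrightarrow> grid_succ j k u \<in> dyadic_grid j \<Longrightarrow> \<theta>\<^sup>2 = 2 ^ j \<Longrightarrow>
        mgf_le \<theta> (exp 2) (\<lambda>\<omega>. f \<omega> (grid_succ j k u) - f \<omega> u)"
  shows "nearly_surely (chain_prob CARD('p) j) (\<lambda>\<omega>. grid_increments_le j (chain_step CARD('p) j) (f \<omega>))"
proof -
  let ?d = "CARD('p)" and ?G = "dyadic_grid j :: (real^'p) set"
  let ?I = "{(u, k). u \<in> ?G \<and> grid_succ j k u \<in> ?G}" and ?t = "2 * exp 2 * exp (- (sqrt 2 ^ j * chain_step ?d j))"
  have sub: "?I \<subseteq> ?G \<times> UNIV" and fin: "finite (?G \<times> (UNIV :: 'p set))"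
    by (auto simp: finite_dyadic_grid)
  have "nearly_surely ?t (\<lambda>\<omega>. case e of (u, k) \<Rightarrow> \<bar>f \<omega> (grid_succ j k u) - f \<omega> u\<bar> \<le> chain_step ?d j)"
    if edge: "e \<in> ?I" for e
  proof -
    obtain u k where e: "e = (u, k)" "u \<in> ?G" "grid_succ j k u \<in> ?G"
      using edge by (cases e) auto
    have sq: "(sqrt 2 ^ j)\<^sup>2 = (2::real) ^ j" by (simp add: power_mult[symmetric] mult.commute[of j] power_mult)
    have [measurable]: "(\<lambda>\<omega>. f \<omega> (grid_succ j k u) - f \<omega> u) \<in> borel_measurable M"
      using e by (intro borel_measurable_diff f)
    have "prob {\<omega>\<in>space M. chain_step ?d j < \<bar>f \<omega> (grid_succ j k u) - f \<omega> u\<bar>} \<le> ?t"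
      using e by (intro chernoff_two_sided mgf) (auto simp: sq)
    then show ?thesis unfolding e(1) by (intro nearly_surelyI) (simp_all add: not_le)
  qed
  then have "nearly_surely (\<Sum>e\<in>?I. ?t)
      (\<lambda>\<omega>. \<forall>e\<in>?I. case e of (u, k) \<Rightarrow> \<bar>f \<omega> (grid_succ j k u) - f \<omega> u\<bar> \<le> chain_step ?d j)"
    by (intro nearly_surely_ball_finite finite_subset[OF sub fin])
  then show ?thesis
  proof (rule nearly_surely_mono)
    have "card ?I \<le> card (?G \<times> (UNIV :: 'p set))" by (rule card_mono[OF fin sub])
    also have "\<dots> \<le> (2 ^ j + 1) ^ ?d * ?d"
      unfolding card_cartesian_product by (intro mult_right_mono card_dyadic_grid_le) simp
    finally have "(\<Sum>e\<in>?I. ?t) \<le> real ((2 ^ j + 1) ^ ?d * ?d) * ?t"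
      unfolding sum_constant by (intro mult_right_mono of_nat_mono) auto
    also have "\<dots> \<le> chain_prob ?d j" by (rule grid_edges_mult_tail_le)
    finally show "(\<Sum>e\<in>?I. ?t) \<le> chain_prob ?d j" .
  qed (auto simp: grid_increments_le_def)
qed

section \<open>Averages\<close>

definition avg :: "nat \<Rightarrow> (nat \<Rightarrow> 'c) \<Rightarrow> 'c::real_normed_field" where
  "avg n f = (\<Sum>l<n. f l) / of_nat n"

lemma avg_diff: "avg n (\<lambda>l. f l - g l) = avg n f - avg n g"
  by (simp add: avg_def sum_subtractf diff_divide_distrib)

lemma avg_const: "0 < n \<Longrightarrow> avg n (\<lambda>l. c) = c"
  by (simp add: avg_def)

lemma avg_cmult: "avg n (\<lambda>l. c * f l) = c * avg n f"
  by (simp add: avg_def sum_distrib_left)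

lemma avg_sum: "avg n (\<lambda>l. \<Sum>i\<in>K. f i l) = (\<Sum>i\<in>K. avg n (f i))"
  unfolding avg_def by (subst sum.swap) (simp add: sum_divide_distrib)

lemma avg_mono: "(\<And>l. l < n \<Longrightarrow> f l \<le> g l) \<Longrightarrow> avg n f \<le> avg n (g :: nat \<Rightarrow> real)"
  unfolding avg_def by (intro divide_right_mono sum_mono) auto

lemma avg_nonneg: "(\<And>l. l < n \<Longrightarrow> 0 \<le> f l) \<Longrightarrow> 0 \<le> avg n (f :: nat \<Rightarrow> real)"
  using avg_mono[of n "\<lambda>_. 0" f] by (simp add: avg_def)

lemma norm_avg_le:
  assumes "\<And>l. norm (f l) \<le> c" "0 < n" shows "norm (avg n f) \<le> c"
proof -
  have "norm (\<Sum>l<n. f l) \<le> (\<Sum>l<n. c)" by (intro sum_norm_le assms)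
  then show ?thesis using assms(2) by (simp add: avg_def norm_divide divide_le_eq mult.commute)
qed

lemma sqrt_mult_avg_diff:
  assumes "0 < n"
  shows "sqrt (real n) * (avg n f - c) = (\<Sum>i<n. (f i - c) / sqrt (real n))"
proof -
  have "sqrt (real n) * (avg n f - c) = (sqrt (real n) / real n) * (\<Sum>i<n. f i - c)"
    using assms by (simp add: avg_def sum_subtractf field_simps)
  also have "sqrt (real n) / real n = inverse (sqrt (real n))"
    by (rule sqrt_divide_self_eq) simp
  finally show ?thesis by (simp add: sum_distrib_left divide_inverse mult.commute)
qed

lemma borel_measurable_avg [measurable (raw)]:
  fixes f :: "nat \<Rightarrow> 'a \<Rightarrow> 'c::{real_normed_field, second_countable_topology}"
  assumes "\<And>l. f l \<in> borel_measurable M"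
  shows "(\<lambda>x. avg n (\<lambda>l. f l x)) \<in> borel_measurable M"
  unfolding avg_def using assms by measurable

lemma expectation_uniform_lessThan:
  fixes f :: "nat \<Rightarrow> 'b::{banach, second_countable_topology, real_normed_field}"
  assumes "0 < n"
  shows "measure_pmf.expectation (pmf_of_set {..<n}) f = avg n f"
proof -
  have "measure_pmf.expectation (pmf_of_set {..<n}) f = (\<Sum>l<n. pmf (pmf_of_set {..<n}) l *\<^sub>R f l)"
    by (rule integral_measure_pmf) (use assms in \<open>auto simp: lessThan_empty_iff\<close>)
  also have "\<dots> = (\<Sum>l<n. f l / of_nat n)"
    using assms by (intro sum.cong refl) (auto simp: pmf_of_set lessThan_empty_iff scaleR_conv_of_real)
  finally show ?thesis by (simp add: avg_def sum_divide_distrib)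
qed

definition sample_var :: "nat \<Rightarrow> (nat \<Rightarrow> real) \<Rightarrow> real" where
  "sample_var n f = avg n (\<lambda>l. (f l)\<^sup>2) - (avg n f)\<^sup>2"

lemma sample_var_eq_avg:
  assumes "0 < n" shows "sample_var n f = avg n (\<lambda>l. (f l - avg n f)\<^sup>2)"
proof -
  have "(\<lambda>l. (f l - avg n f)\<^sup>2) = (\<lambda>l. (f l)\<^sup>2 - (2 * avg n f * f l - (avg n f)\<^sup>2))"
    by (simp add: fun_eq_iff power2_diff)
  then show ?thesis
    using assms by (simp only: avg_diff avg_cmult avg_const sample_var_def) (simp add: power2_eq_square)
qed

lemma sample_var_nonneg: "0 < n \<Longrightarrow> 0 \<le> sample_var n f"
  by (simp add: sample_var_eq_avg avg_nonneg)

definition cf_rate :: "real \<Rightarrow> real" where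
  "cf_rate c = (2 * c) ^ 3 + (2 * c) ^ 4"

lemma avg_cis_power_approx:
  assumes f: "\<And>l. \<bar>f l\<bar> \<le> c" and n: "0 < n"
  shows "cmod (avg n (\<lambda>l. cis ((f l - avg n f) / sqrt (real n))) ^ n - exp (- sample_var n f / 2))
      \<le> cf_rate c / sqrt (real n)"
proof -
  have "\<bar>f l - avg n f\<bar> \<le> 2 * c" for l
    using f[of l] norm_avg_le[of f c n] f n by fastforce
  moreover have "avg n (\<lambda>l. f l - avg n f) = 0"
    using n by (simp add: avg_diff avg_const)
  ultimately show ?thesis
    using measure_pmf.cf_power_approx[of "\<lambda>l. f l - avg n f" "pmf_of_set {..<n}" "2 * c" n] n
    by (simp add: expectation_uniform_lessThan sample_var_eq_avg cf_rate_def)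
qed

section \<open>The bootstrap of an i.i.d. sample\<close>

text \<open>\<open>indep_var\<close> only relates random variables with values in the same type, hence the explicit rectangles.\<close>
lemma (in prob_space) distr_Pair_eq_pair_measure:
  assumes X: "X \<in> measurable M S" and Y: "Y \<in> measurable M T"
    and rect: "\<And>A B. A \<in> sets S \<Longrightarrow> B \<in> sets T \<Longrightarrow> prob {\<omega>\<in>space M. X \<omega> \<in> A \<and> Y \<omega> \<in> B}
      = prob {\<omega>\<in>space M. X \<omega> \<in> A} * prob {\<omega>\<in>space M. Y \<omega> \<in> B}"
  shows "distr M (S \<Otimes>\<^sub>M T) (\<lambda>\<omega>. (X \<omega>, Y \<omega>)) = distr M S X \<Otimes>\<^sub>M distr M T Y"
proof (rule pair_measure_eqI[symmetric])
  show "sigma_finite_measure (distr M S X)" "sigma_finite_measure (distr M T Y)"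
    by (intro prob_space_imp_sigma_finite prob_space_distr X Y)+
  fix A B assume "A \<in> sets (distr M S X)" "B \<in> sets (distr M T Y)"
  then have AB: "A \<in> sets S" "B \<in> sets T" by simp_all
  have "emeasure (distr M (S \<Otimes>\<^sub>M T) (\<lambda>\<omega>. (X \<omega>, Y \<omega>))) (A \<times> B) = prob {\<omega>\<in>space M. X \<omega> \<in> A \<and> Y \<omega> \<in> B}"
    using AB X Y by (subst emeasure_distr) (auto simp: emeasure_eq_measure intro!: arg_cong[where f = prob])
  also have "\<dots> = emeasure (distr M S X) A * emeasure (distr M T Y) B"
    unfolding rect[OF AB] using AB X Y
    by (auto simp: emeasure_distr emeasure_eq_measure ennreal_mult intro!: arg_cong2[where f = "(*)"] arg_cong[where f = prob])
  finally show "emeasure (distr M S X) A * emeasure (distr M T Y) B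
      = emeasure (distr M (S \<Otimes>\<^sub>M T) (\<lambda>\<omega>. (X \<omega>, Y \<omega>))) (A \<times> B)" by simp
qed (simp cong: sets_pair_measure_cong)

lemma (in prob_space) expectation_independent_iterated:
  fixes f :: "'b \<times> 'c \<Rightarrow> 'd::{banach, second_countable_topology}"
  assumes X: "X \<in> measurable M S" and Y: "Y \<in> measurable M T"
    and ind: "distr M (S \<Otimes>\<^sub>M T) (\<lambda>\<omega>. (X \<omega>, Y \<omega>)) = distr M S X \<Otimes>\<^sub>M distr M T Y"
    and f: "f \<in> borel_measurable (S \<Otimes>\<^sub>M T)" and bnd: "\<And>z. norm (f z) \<le> c"
  shows "expectation (\<lambda>\<omega>. f (X \<omega>, Y \<omega>)) = expectation (\<lambda>\<omega>. expectation (\<lambda>\<omega>'. f (X \<omega>, Y \<omega>')))"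
proof -
  interpret X: prob_space "distr M S X" by (rule prob_space_distr[OF X])
  interpret Y: prob_space "distr M T Y" by (rule prob_space_distr[OF Y])
  interpret XY: pair_prob_space "distr M S X" "distr M T Y" ..
  have f': "f \<in> borel_measurable (distr M S X \<Otimes>\<^sub>M distr M T Y)"
    using f by (simp cong: measurable_cong_sets sets_pair_measure_cong)
  then have int: "integrable (distr M S X \<Otimes>\<^sub>M distr M T Y) f"
    by (intro XY.integrable_const_bound[of _ c]) (auto simp: bnd)
  have inner: "(\<lambda>x. \<integral>y. f (x, y) \<partial>distr M T Y) \<in> borel_measurable S"
    using Y.borel_measurable_lebesgue_integral[of "\<lambda>x y. f (x, y)" S] f
    by (simp add: split_beta' cong: measurable_cong_sets sets_pair_measure_cong)
  have "expectation (\<lambda>\<omega>. f (X \<omega>, Y \<omega>)) = (\<integral>z. f z \<partial>distr M (S \<Otimes>\<^sub>M T) (\<lambda>\<omega>. (X \<omega>, Y \<omega>)))"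
    using f X Y by (subst integral_distr) auto
  also have "\<dots> = (\<integral>z. f z \<partial>(distr M S X \<Otimes>\<^sub>M distr M T Y))"
    by (simp only: ind)
  also have "\<dots> = (\<integral>x. \<integral>y. f (x, y) \<partial>distr M T Y \<partial>distr M S X)"
    by (rule XY.integral_fst'[OF int, symmetric])
  also have "\<dots> = expectation (\<lambda>\<omega>. \<integral>y. f (X \<omega>, y) \<partial>distr M T Y)"
    by (rule integral_distr[OF X inner])
  also have "\<dots> = expectation (\<lambda>\<omega>. expectation (\<lambda>\<omega>'. f (X \<omega>, Y \<omega>')))"
  proof (intro Bochner_Integration.integral_cong refl)
    fix \<omega> assume "\<omega> \<in> space M"
    then have "(\<lambda>y. f (X \<omega>, y)) \<in> borel_measurable T"
      using measurable_space[OF X] f by (intro measurable_compose[OF measurable_Pair1' f])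
    then show "(\<integral>y. f (X \<omega>, y) \<partial>distr M T Y) = expectation (\<lambda>\<omega>'. f (X \<omega>, Y \<omega>'))"
      by (rule integral_distr[OF Y])
  qed
  finally show ?thesis .
qed

locale iid_bootstrap = prob_space P for P :: "'a measure" +
  fixes S :: "'s measure" and obs :: "nat \<Rightarrow> 'a \<Rightarrow> 's" and J :: "nat \<times> nat \<times> nat \<Rightarrow> 'a \<Rightarrow> nat"
  assumes obs_indep: "indep_vars (\<lambda>_. S) obs UNIV"
    and obs_distr: "\<And>i. distr P S (obs i) = distr P S (obs 0)"
    and J_indep: "indep_vars (\<lambda>_. count_space UNIV) J UNIV"
    and J_unif: "\<And>n m i. i < n \<Longrightarrow>
          distr P (count_space UNIV) (J (n, m, i)) = measure_pmf (pmf_of_set {..<n})"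
    and obs_J_indep: "\<And>B E. B \<in> sets (Pi\<^sub>M UNIV (\<lambda>_. S)) \<Longrightarrow> E \<in> sets (Pi\<^sub>M UNIV (\<lambda>_. count_space UNIV)) \<Longrightarrow>
          prob {\<omega>\<in>space P. (\<lambda>i. obs i \<omega>) \<in> B \<and> (\<lambda>x. J x \<omega>) \<in> E}
          = prob {\<omega>\<in>space P. (\<lambda>i. obs i \<omega>) \<in> B} * prob {\<omega>\<in>space P. (\<lambda>x. J x \<omega>) \<in> E}"
begin

definition data :: "'a \<Rightarrow> nat \<Rightarrow> 's" where
  "data \<omega> i = obs i \<omega>"

definition resample :: "nat \<Rightarrow> nat \<Rightarrow> 'a \<Rightarrow> nat \<Rightarrow> 's" where
  "resample n m \<omega> i = (if m = 0 then data \<omega> i else data \<omega> (J (n, m, i) \<omega>))"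

lemma measurable_obs [measurable]: "obs i \<in> measurable P S"
  using obs_indep unfolding indep_vars_def by blast

lemma measurable_data_component [measurable]: "(\<lambda>\<omega>. data \<omega> i) \<in> measurable P S"
  unfolding data_def by measurable

lemma measurable_data [measurable]: "data \<in> measurable P (Pi\<^sub>M UNIV (\<lambda>_. S))"
proof (rule measurable_PiM_single')
  show "data \<in> space P \<rightarrow> UNIV \<rightarrow>\<^sub>E space S"
    using measurable_space[OF measurable_obs] by (auto simp: data_def)
qed measurable

lemma measurable_J [measurable]: "J x \<in> measurable P (count_space UNIV)"
  using J_indep unfolding indep_vars_def by blast

lemma measurable_J_path [measurable]: "(\<lambda>\<omega> x. J x \<omega>) \<in> measurable P (Pi\<^sub>M UNIV (\<lambda>_. count_space UNIV))"
  by (rule measurable_PiM_single') auto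

lemma distr_data_J:
  "distr P (Pi\<^sub>M UNIV (\<lambda>_. S) \<Otimes>\<^sub>M Pi\<^sub>M UNIV (\<lambda>_. count_space UNIV)) (\<lambda>\<omega>. (data \<omega>, \<lambda>x. J x \<omega>))
   = distr P (Pi\<^sub>M UNIV (\<lambda>_. S)) data \<Otimes>\<^sub>M distr P (Pi\<^sub>M UNIV (\<lambda>_. count_space UNIV)) (\<lambda>\<omega> x. J x \<omega>)"
  by (rule distr_Pair_eq_pair_measure[OF measurable_data measurable_J_path])
    (simp add: obs_J_indep data_def[abs_def])

lemma measurable_resample [measurable]: "(\<lambda>\<omega>. resample n m \<omega> i) \<in> measurable P S"
  unfolding resample_def
  by (cases "m = 0") (auto intro!: measurable_compose_countable[where g = "J (n, m, i)"])

lemma expectation_J: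
  fixes f :: "nat \<Rightarrow> 'c::{real_normed_field, banach, second_countable_topology}"
  assumes "i < n"
  shows "expectation (\<lambda>\<omega>. f (J (n, m, i) \<omega>)) = avg n f"
proof -
  have "expectation (\<lambda>\<omega>. f (J (n, m, i) \<omega>)) = (\<integral>x. f x \<partial>distr P (count_space UNIV) (J (n, m, i)))"
    by (rule integral_distr[symmetric]) auto
  then show ?thesis using J_unif[OF assms] expectation_uniform_lessThan[of n f] assms by simp
qed

lemma expectation_prod_J:
  fixes a :: "nat \<Rightarrow> nat \<Rightarrow> 'c::{real_normed_field, banach, second_countable_topology}"
  assumes I: "finite I" and a: "\<And>m l. norm (a m l) \<le> c"
  shows "expectation (\<lambda>\<omega>. \<Prod>m\<in>I. \<Prod>i<n. a m (J (n, m, i) \<omega>)) = (\<Prod>m\<in>I. avg n (a m) ^ n)"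
proof -
  let ?K = "I \<times> {..<n}"
  have "indep_vars (\<lambda>_. borel) (\<lambda>x \<omega>. a (fst (snd x)) (J x \<omega>)) ({n} \<times> ?K)"
    using indep_vars_compose2[OF indep_vars_subset[OF J_indep], of "{n} \<times> ?K" "\<lambda>x. a (fst (snd x))" "\<lambda>_. borel"]
    by simp
  then have "expectation (\<lambda>\<omega>. \<Prod>x\<in>{n} \<times> ?K. a (fst (snd x)) (J x \<omega>))
      = (\<Prod>x\<in>{n} \<times> ?K. expectation (\<lambda>\<omega>. a (fst (snd x)) (J x \<omega>)))"
    using I a by (intro indep_vars_lebesgue_integral integrable_const_bound[of _ c]) auto
  also have "\<dots> = (\<Prod>x\<in>{n} \<times> ?K. avg n (a (fst (snd x))))"
    by (intro prod.cong refl) (auto intro!: expectation_J)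
  finally show ?thesis
    by (simp add: prod.cartesian_product' split_beta)
qed

lemma expectation_resample_prod:
  fixes b :: "(nat \<Rightarrow> 's) \<Rightarrow> 'c::{real_normed_field, banach, second_countable_topology}"
    and a :: "nat \<Rightarrow> nat \<Rightarrow> (nat \<Rightarrow> 's) \<Rightarrow> 'c"
  assumes I: "finite I"
    and [measurable]: "b \<in> borel_measurable (Pi\<^sub>M UNIV (\<lambda>_. S))"
      "\<And>m l. a m l \<in> borel_measurable (Pi\<^sub>M UNIV (\<lambda>_. S))"
    and b: "\<And>x. norm (b x) \<le> cb" and a: "\<And>m l x. norm (a m l x) \<le> ca"
  shows "expectation (\<lambda>\<omega>. b (data \<omega>) * (\<Prod>m\<in>I. \<Prod>i<n. a m (J (n, m, i) \<omega>) (data \<omega>)))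
       = expectation (\<lambda>\<omega>. b (data \<omega>) * (\<Prod>m\<in>I. avg n (\<lambda>l. a m l (data \<omega>)) ^ n))"
proof -
  define f where "f z = b (fst z) * (\<Prod>m\<in>I. \<Prod>i<n. a m (snd z (n, m, i)) (fst z))"
    for z :: "(nat \<Rightarrow> 's) \<times> (nat \<times> nat \<times> nat \<Rightarrow> nat)"
  have [measurable]: "(\<lambda>z. a m (snd z (n, m, i)) (fst z))
      \<in> borel_measurable (Pi\<^sub>M UNIV (\<lambda>_. S) \<Otimes>\<^sub>M Pi\<^sub>M UNIV (\<lambda>_. count_space UNIV))" for m i
    by (rule measurable_compose_countable) measurable
  have "f \<in> borel_measurable (Pi\<^sub>M UNIV (\<lambda>_. S) \<Otimes>\<^sub>M Pi\<^sub>M UNIV (\<lambda>_. count_space UNIV))"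
    unfolding f_def by measurable
  moreover have "norm (f z) \<le> cb * (\<Prod>m\<in>I. \<Prod>i<n. ca)" for z
    unfolding f_def norm_mult prod_norm[symmetric]
    by (intro mult_mono b prod_mono conjI a norm_ge_zero order_trans[OF norm_ge_zero b] prod_nonneg)
  ultimately have iterated: "expectation (\<lambda>\<omega>. f (data \<omega>, \<lambda>x. J x \<omega>)) = expectation (\<lambda>\<omega>. expectation (\<lambda>\<omega>'. f (data \<omega>, \<lambda>x. J x \<omega>')))"
    by (intro expectation_independent_iterated[OF measurable_data measurable_J_path distr_data_J])
  have inner: "expectation (\<lambda>\<omega>'. f (x, \<lambda>k. J k \<omega>')) = b x * (\<Prod>m\<in>I. avg n (\<lambda>l. a m l x) ^ n)" for x
    unfolding f_def using expectation_prod_J[OF I, of "\<lambda>m l. a m l x" ca n] a by simp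
  show ?thesis using iterated unfolding inner by (simp add: f_def)
qed

lemma expectation_obs_eq:
  fixes f :: "'s \<Rightarrow> 'c::{banach, second_countable_topology}"
  assumes [measurable]: "f \<in> borel_measurable S"
  shows "expectation (\<lambda>\<omega>. f (obs i \<omega>)) = expectation (\<lambda>\<omega>. f (obs 0 \<omega>))"
proof -
  have "expectation (\<lambda>\<omega>. f (obs i \<omega>)) = (\<integral>x. f x \<partial>distr P S (obs i))" for i
    by (simp add: integral_distr)
  then show ?thesis using obs_distr[of i] by simp
qed

lemma expectation_prod_obs:
  fixes f :: "'s \<Rightarrow> 'c::{real_normed_field, banach, second_countable_topology}"
  assumes [measurable]: "f \<in> borel_measurable S" and f: "\<And>x. norm (f x) \<le> c"
  shows "expectation (\<lambda>\<omega>. \<Prod>i<n. f (obs i \<omega>)) = expectation (\<lambda>\<omega>. f (obs 0 \<omega>)) ^ n"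
proof -
  have "indep_vars (\<lambda>_. borel) (\<lambda>i \<omega>. f (obs i \<omega>)) {..<n}"
    using indep_vars_compose2[OF indep_vars_subset[OF obs_indep], of "{..<n}" "\<lambda>_. f" "\<lambda>_. borel"] by simp
  then have "expectation (\<lambda>\<omega>. \<Prod>i<n. f (obs i \<omega>)) = (\<Prod>i<n. expectation (\<lambda>\<omega>. f (obs i \<omega>)))"
    using f by (intro indep_vars_lebesgue_integral integrable_const_bound[of _ c]) auto
  also have "\<dots> = (\<Prod>i<n. expectation (\<lambda>\<omega>. f (obs 0 \<omega>)))"
    by (intro prod.cong refl expectation_obs_eq) measurable
  finally show ?thesis by simp
qed

definition emean :: "('s \<Rightarrow> real) \<Rightarrow> real" where
  "emean y = expectation (\<lambda>\<omega>. y (obs 0 \<omega>))"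

definition proc :: "nat \<Rightarrow> nat \<Rightarrow> ('s \<Rightarrow> real) \<Rightarrow> 'a \<Rightarrow> real" where
  "proc n m y \<omega> = sqrt (real n) * (avg n (\<lambda>i. y (resample n m \<omega> i))
     - (if m = 0 then emean y else avg n (\<lambda>l. y (data \<omega> l))))"

lemma integrable_obs:
  assumes [measurable]: "y \<in> borel_measurable S" and "\<And>s. \<bar>y s\<bar> \<le> (c::real)"
  shows "integrable P (\<lambda>\<omega>. y (obs i \<omega>))"
  by (rule integrable_const_bound[of _ c]) (use assms in auto)

lemma abs_emean_le:
  assumes [measurable]: "y \<in> borel_measurable S" and "\<And>s. \<bar>y s\<bar> \<le> c"
  shows "\<bar>emean y\<bar> \<le> c"
  unfolding emean_def by (rule abs_expectation_le) (use assms in auto)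

lemma emean_sum:
  assumes "\<And>i. i \<in> K \<Longrightarrow> y i \<in> borel_measurable S" "\<And>i s. \<bar>y i s\<bar> \<le> b"
  shows "emean (\<lambda>s. \<Sum>i\<in>K. c i * y i s) = (\<Sum>i\<in>K. c i * emean (y i))"
  unfolding emean_def using integrable_obs[OF assms]
  by (simp add: Bochner_Integration.integral_sum)

lemma measurable_proc [measurable]:
  assumes [measurable]: "y \<in> borel_measurable S"
  shows "proc n m y \<in> borel_measurable P"
  unfolding proc_def by (cases "m = 0") auto

lemma proc_diff:
  assumes "y \<in> borel_measurable S" "z \<in> borel_measurable S" "\<And>s. \<bar>y s\<bar> \<le> c" "\<And>s. \<bar>z s\<bar> \<le> c"
  shows "proc n m (\<lambda>s. y s - z s) \<omega> = proc n m y \<omega> - proc n m z \<omega>"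
proof -
  have "emean (\<lambda>s. y s - z s) = emean y - emean z"
    using integrable_obs[OF assms(1,3), of 0] integrable_obs[OF assms(2,4), of 0] by (simp add: emean_def)
  then show ?thesis by (simp add: proc_def avg_diff right_diff_distrib)
qed

lemma proc_sum:
  assumes "\<And>i. i \<in> K \<Longrightarrow> y i \<in> borel_measurable S" "\<And>i s. \<bar>y i s\<bar> \<le> b"
  shows "proc n m (\<lambda>s. \<Sum>i\<in>K. c i * y i s) \<omega> = (\<Sum>i\<in>K. c i * proc n m (y i) \<omega>)"
proof -
  have "emean (\<lambda>s. \<Sum>i\<in>K. c i * y i s) = (\<Sum>i\<in>K. c i * emean (y i))"
    by (rule emean_sum[OF assms])
  then show ?thesis
    by (simp add: proc_def avg_sum avg_cmult sum_subtractf right_diff_distrib sum_distrib_left mult.left_commute)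
qed

lemma proc_cmult: "proc n m (\<lambda>s. c * y s) \<omega> = c * proc n m y \<omega>"
  by (simp add: proc_def emean_def avg_cmult algebra_simps)

lemma abs_proc_le:
  assumes [measurable]: "y \<in> borel_measurable S" and y: "\<And>s. \<bar>y s\<bar> \<le> 1"
  shows "\<bar>proc n m y \<omega>\<bar> \<le> 2 * sqrt (real n)"
proof (cases "n = 0")
  case False
  have "\<bar>avg n (\<lambda>i. y (resample n m \<omega> i))\<bar> \<le> 1" "\<bar>avg n (\<lambda>l. y (data \<omega> l))\<bar> \<le> 1" "\<bar>emean y\<bar> \<le> 1"
    using norm_avg_le[of "\<lambda>i. y (resample n m \<omega> i)" 1 n] norm_avg_le[of "\<lambda>l. y (data \<omega> l)" 1 n]
      abs_emean_le[of y 1] y False by simp_all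
  then have "\<bar>avg n (\<lambda>i. y (resample n m \<omega> i)) - (if m = 0 then emean y else avg n (\<lambda>l. y (data \<omega> l)))\<bar> \<le> 2"
    by (auto simp: abs_le_iff)
  then show ?thesis by (simp add: proc_def abs_mult mult.commute[of "sqrt _"] mult_right_mono)
qed (simp add: proc_def)

lemma integrable_exp_proc:
  assumes [measurable]: "y \<in> borel_measurable S" and y: "\<And>s. \<bar>y s\<bar> \<le> 1"
  shows "integrable P (\<lambda>\<omega>. exp (\<theta> * proc n m y \<omega>))"
proof (rule integrable_const_bound[of _ "exp (\<bar>\<theta>\<bar> * (2 * sqrt (real n)))"])
  have "\<theta> * proc n m y \<omega> \<le> \<bar>\<theta>\<bar> * (2 * sqrt (real n))" for \<omega>
    using mult_left_mono[OF abs_proc_le[of y n m \<omega>], of "\<bar>\<theta>\<bar>"] y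
    by (simp add: abs_mult[symmetric] abs_le_iff)
  then show "AE \<omega> in P. norm (exp (\<theta> * proc n m y \<omega>)) \<le> exp (\<bar>\<theta>\<bar> * (2 * sqrt (real n)))" by simp
qed measurable

lemma proc_eq_sum:
  assumes "0 < n"
  shows "proc n m y \<omega> = (\<Sum>i<n. (y (resample n m \<omega> i)
    - (if m = 0 then emean y else avg n (\<lambda>l. y (data \<omega> l)))) / sqrt (real n))"
  unfolding proc_def using assms by (rule sqrt_mult_avg_diff)

end

context iid_bootstrap
begin

lemma emean_square_bounds:
  assumes "y \<in> borel_measurable S" "\<And>s. \<bar>y s\<bar> \<le> 1"
  shows "0 \<le> emean (\<lambda>s. (y s)\<^sup>2)" "emean (\<lambda>s. (y s)\<^sup>2) \<le> 1"
proof -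
  have "\<bar>emean (\<lambda>s. (y s)\<^sup>2)\<bar> \<le> 1"
    using assms by (intro abs_emean_le) (auto simp: abs_square_le_1)
  then show "emean (\<lambda>s. (y s)\<^sup>2) \<le> 1" by simp
qed (simp add: emean_def)

lemma expectation_exp_proc_0_le:
  assumes [measurable]: "y \<in> borel_measurable S" and y: "\<And>s. \<bar>y s\<bar> \<le> 1"
    and n: "0 < n" and t: "\<bar>t\<bar> \<le> 1 / 2"
  shows "expectation (\<lambda>\<omega>. exp (t * sqrt (real n) * proc n 0 y \<omega>)) \<le> exp (real n * t\<^sup>2 * emean (\<lambda>s. (y s)\<^sup>2))"
proof -
  have "exp (t * sqrt (real n) * proc n 0 y \<omega>) = (\<Prod>i<n. exp (t * (y (obs i \<omega>) - emean y)))" for \<omega>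
    using n by (simp add: proc_eq_sum resample_def data_def exp_sum[symmetric] sum_distrib_left)
  moreover have "norm (exp (t * (y s - emean y))) \<le> exp 1" for s
    using abs_mult_diff_le_1[OF t y[of s] abs_emean_le[of y 1]] y by simp
  ultimately have "expectation (\<lambda>\<omega>. exp (t * sqrt (real n) * proc n 0 y \<omega>))
      = expectation (\<lambda>\<omega>. exp (t * (y (obs 0 \<omega>) - emean y))) ^ n"
    using expectation_prod_obs[of "\<lambda>s. exp (t * (y s - emean y))" "exp 1" n] by simp
  also have "\<dots> \<le> exp (t\<^sup>2 * emean (\<lambda>s. (y s)\<^sup>2)) ^ n"
    using mgf_centered_le[of "\<lambda>\<omega>. y (obs 0 \<omega>)" t] y t
    by (intro power_mono) (auto simp: emean_def intro!: integral_nonneg_AE)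
  finally show ?thesis by (simp add: exp_of_nat_mult[symmetric] mult.assoc)
qed

lemma expectation_exp_square_le:
  assumes [measurable]: "y \<in> borel_measurable S" and y: "\<And>s. \<bar>y s\<bar> \<le> 1" and a: "0 \<le> a" "a \<le> 1"
  shows "expectation (\<lambda>\<omega>. exp (a * (y (obs 0 \<omega>))\<^sup>2)) \<le> exp (2 * a * emean (\<lambda>s. (y s)\<^sup>2))"
proof -
  have i: "integrable P (\<lambda>\<omega>. (y (obs 0 \<omega>))\<^sup>2)"
    by (rule integrable_const_bound[of _ 1]) (use y in \<open>auto simp: abs_square_le_1\<close>)
  have bounds: "0 \<le> a * (y s)\<^sup>2" "a * (y s)\<^sup>2 \<le> 1" for s
    using a y[of s] by (auto intro: mult_le_one simp: abs_square_le_1)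
  have "expectation (\<lambda>\<omega>. exp (a * (y (obs 0 \<omega>))\<^sup>2)) \<le> expectation (\<lambda>\<omega>. 1 + 2 * (a * (y (obs 0 \<omega>))\<^sup>2))"
  proof (rule integral_mono)
    show "integrable P (\<lambda>\<omega>. exp (a * (y (obs 0 \<omega>))\<^sup>2))"
      by (rule integrable_const_bound[of _ "exp 1"]) (use bounds in auto)
    show "integrable P (\<lambda>\<omega>. 1 + 2 * (a * (y (obs 0 \<omega>))\<^sup>2))" using i by simp
    fix \<omega>
    let ?z = "a * (y (obs 0 \<omega>))\<^sup>2"
    have "?z\<^sup>2 \<le> ?z" using bounds[of "obs 0 \<omega>"] by (simp only: power2_eq_square[of ?z] mult_left_le)
    then show "exp ?z \<le> 1 + 2 * ?z" using exp_bound[of ?z] bounds[of "obs 0 \<omega>"] by linarith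
  qed
  also have "\<dots> = 1 + 2 * a * emean (\<lambda>s. (y s)\<^sup>2)" using i by (simp add: emean_def prob_space)
  also have "\<dots> \<le> exp (2 * a * emean (\<lambda>s. (y s)\<^sup>2))" by (rule exp_ge_add_one_self)
  finally show ?thesis .
qed

lemma avg_exp_centered_bounds:
  fixes x :: "nat \<Rightarrow> 's" and t :: real
  assumes y: "\<And>s. \<bar>y s\<bar> \<le> 1" and n: "0 < n" and t: "\<bar>t\<bar> \<le> 1 / 2"
  defines "c \<equiv> \<lambda>l. y (x l) - avg n (\<lambda>l. y (x l))"
  shows "exp (t * c l) \<le> exp 1" "0 \<le> avg n (\<lambda>l. exp (t * c l))"
    "avg n (\<lambda>l. exp (t * c l)) \<le> exp (t\<^sup>2 * avg n (\<lambda>l. (y (x l))\<^sup>2))"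
proof -
  have "\<bar>avg n (\<lambda>l. y (x l))\<bar> \<le> 1" using norm_avg_le[of "\<lambda>l. y (x l)" 1 n] y n by simp
  then have "\<bar>t * c l\<bar> \<le> 1" unfolding c_def by (rule abs_mult_diff_le_1[OF t y])
  then show "exp (t * c l) \<le> exp 1" by simp
  show "0 \<le> avg n (\<lambda>l. exp (t * c l))" by (simp add: avg_nonneg)
  show "avg n (\<lambda>l. exp (t * c l)) \<le> exp (t\<^sup>2 * avg n (\<lambda>l. (y (x l))\<^sup>2))"
    using measure_pmf.mgf_centered_le[of "\<lambda>l. y (x l)" "pmf_of_set {..<n}" t] y t n
    by (simp add: expectation_uniform_lessThan c_def)
qed

lemma expectation_exp_proc_resample_le:
  assumes [measurable]: "y \<in> borel_measurable S" and y: "\<And>s. \<bar>y s\<bar> \<le> 1"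
    and n: "0 < n" and m: "0 < m" and t: "\<bar>t\<bar> \<le> 1 / 2"
  shows "expectation (\<lambda>\<omega>. exp (t * sqrt (real n) * proc n m y \<omega>))
    \<le> exp (2 * (real n * t\<^sup>2 * emean (\<lambda>s. (y s)\<^sup>2)))"
proof -
  define a where "a l x = exp (t * (y (x l) - avg n (\<lambda>l. y (x l))))" for l and x :: "nat \<Rightarrow> 's"
  have [measurable]: "a l \<in> borel_measurable (Pi\<^sub>M UNIV (\<lambda>_. S))" for l
    unfolding a_def by measurable
  note a_bounds = avg_exp_centered_bounds[where y = y, OF y n t, folded a_def]
  have a_norm: "norm (a l x) \<le> exp 1" for l x using a_bounds(1) by (simp add: a_def)
  have t_square: "0 \<le> t\<^sup>2" "t\<^sup>2 \<le> 1" using t by (auto simp: abs_square_le_1)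
  have exp_y: "norm (exp (t\<^sup>2 * (y s)\<^sup>2)) \<le> exp 1" for s
    using t_square y[of s] by (auto intro!: mult_le_one simp: abs_square_le_1)
  have "exp (t * sqrt (real n) * proc n m y \<omega>) = 1 * (\<Prod>m'\<in>{m}. \<Prod>i<n. a (J (n, m', i) \<omega>) (data \<omega>))" for \<omega>
    using n m by (simp add: proc_eq_sum resample_def a_def exp_sum[symmetric] sum_distrib_left)
  then have "expectation (\<lambda>\<omega>. exp (t * sqrt (real n) * proc n m y \<omega>))
      = expectation (\<lambda>\<omega>. avg n (\<lambda>l. a l (data \<omega>)) ^ n)"
    using expectation_resample_prod[of "{m}" "\<lambda>_. 1" "\<lambda>_. a" 1 "exp 1" n] a_norm by simp
  also have "\<dots> \<le> expectation (\<lambda>\<omega>. \<Prod>l<n. exp (t\<^sup>2 * (y (obs l \<omega>))\<^sup>2))"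
  proof (rule integral_mono)
    have "avg n (\<lambda>l. a l x) \<le> exp 1" for x
      using norm_avg_le[of "\<lambda>l. a l x" "exp 1" n, OF a_norm n] by simp
    then show "integrable P (\<lambda>\<omega>. avg n (\<lambda>l. a l (data \<omega>)) ^ n)"
      using a_bounds(2) by (intro integrable_const_bound[of _ "exp 1 ^ n"]) (auto simp: power_abs intro!: power_mono)
    show "integrable P (\<lambda>\<omega>. \<Prod>l<n. exp (t\<^sup>2 * (y (obs l \<omega>))\<^sup>2))"
    proof (rule integrable_const_bound[of _ "\<Prod>l<n. exp 1"])
      show "AE \<omega> in P. norm (\<Prod>l<n. exp (t\<^sup>2 * (y (obs l \<omega>))\<^sup>2)) \<le> (\<Prod>l<n. exp 1)"
        unfolding prod_norm[symmetric] by (intro AE_I2 prod_mono conjI norm_ge_zero exp_y)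
    qed measurable
    fix \<omega>
    have "avg n (\<lambda>l. a l (data \<omega>)) ^ n \<le> exp (t\<^sup>2 * avg n (\<lambda>l. (y (data \<omega> l))\<^sup>2)) ^ n"
      using a_bounds by (intro power_mono)
    also have "\<dots> = (\<Prod>l<n. exp (t\<^sup>2 * (y (obs l \<omega>))\<^sup>2))"
      using n by (simp add: exp_of_nat_mult[symmetric] exp_sum[symmetric] avg_def data_def sum_distrib_left[symmetric])
    finally show "avg n (\<lambda>l. a l (data \<omega>)) ^ n \<le> (\<Prod>l<n. exp (t\<^sup>2 * (y (obs l \<omega>))\<^sup>2))" .
  qed
  also have "\<dots> = expectation (\<lambda>\<omega>. exp (t\<^sup>2 * (y (obs 0 \<omega>))\<^sup>2)) ^ n"
    by (rule expectation_prod_obs[of "\<lambda>s. exp (t\<^sup>2 * (y s)\<^sup>2)", OF _ exp_y]) measurable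
  also have "\<dots> \<le> exp (2 * t\<^sup>2 * emean (\<lambda>s. (y s)\<^sup>2)) ^ n"
    using expectation_exp_square_le[of y "t\<^sup>2"] y t_square by (intro power_mono) (auto intro!: integral_nonneg_AE)
  finally show ?thesis by (simp add: exp_of_nat_mult[symmetric] mult_ac)
qed

lemma mgf_le_proc:
  assumes y: "y \<in> borel_measurable S" "\<And>s. \<bar>y s\<bar> \<le> 1" and \<theta>: "\<bar>\<theta>\<bar> \<le> sqrt (real n) / 2"
  shows "mgf_le \<theta> (exp (2 * \<theta>\<^sup>2 * emean (\<lambda>s. (y s)\<^sup>2))) (proc n m y)"
proof (cases "n = 0")
  case True
  then show ?thesis using emean_square_bounds(1)[OF y] by (simp add: mgf_le_def proc_def prob_space)
next
  case False
  define t where "t = \<theta> / sqrt (real n)"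
  have t: "\<bar>t\<bar> \<le> 1 / 2" "t * sqrt (real n) = \<theta>" "real n * t\<^sup>2 = \<theta>\<^sup>2"
    using \<theta> False by (auto simp: t_def abs_divide divide_le_eq power_divide)
  have "exp (\<theta>\<^sup>2 * emean (\<lambda>s. (y s)\<^sup>2)) \<le> exp (2 * (\<theta>\<^sup>2 * emean (\<lambda>s. (y s)\<^sup>2)))"
    using emean_square_bounds(1)[OF y] by simp
  then have "expectation (\<lambda>\<omega>. exp (\<theta> * proc n m y \<omega>)) \<le> exp (2 * (\<theta>\<^sup>2 * emean (\<lambda>s. (y s)\<^sup>2)))"
    using expectation_exp_proc_0_le[OF y _ t(1), of n] expectation_exp_proc_resample_le[OF y _ _ t(1), of n m] False
    unfolding t(2,3) by (cases "m = 0") (auto intro: order_trans)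
  then show ?thesis using integrable_exp_proc[OF y] by (simp add: mgf_le_def mult.assoc)
qed

definition moment_bound :: real where
  "moment_bound = 16 * exp (1 / 2)"

lemma proc_second_moment:
  assumes y: "y \<in> borel_measurable S" "\<And>s. \<bar>y s\<bar> \<le> 1"
  shows "integrable P (\<lambda>\<omega>. (proc n m y \<omega>)\<^sup>2)" "expectation (\<lambda>\<omega>. (proc n m y \<omega>)\<^sup>2) \<le> moment_bound"
proof -
  have "(proc n m y \<omega>)\<^sup>2 \<le> (2 * sqrt (real n))\<^sup>2" for \<omega>
    using power_mono[OF abs_proc_le[OF y] abs_ge_zero, of n m \<omega> 2] by simp
  then show i: "integrable P (\<lambda>\<omega>. (proc n m y \<omega>)\<^sup>2)"
    using y by (intro integrable_const_bound[of _ "(2 * sqrt (real n))\<^sup>2"]) auto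
  show "expectation (\<lambda>\<omega>. (proc n m y \<omega>)\<^sup>2) \<le> moment_bound"
  proof (cases "n = 0")
    case False
    have mgf: "mgf_le \<theta> (exp (1 / 2)) (proc n m y)" if "\<bar>\<theta>\<bar> = 1 / 2" for \<theta>
    proof (rule mgf_le_mono[OF mgf_le_proc[OF y]])
      have "\<bar>\<theta>\<bar>\<^sup>2 = (1 / 2)\<^sup>2" using that by (rule arg_cong)
      then have \<theta>2: "\<theta>\<^sup>2 = 1 / 4" by (simp add: power_divide)
      show "exp (2 * \<theta>\<^sup>2 * emean (\<lambda>s. (y s)\<^sup>2)) \<le> exp (1 / 2)"
        unfolding \<theta>2 using emean_square_bounds(2)[OF y] by simp
    qed (use that False in simp)
    have "(proc n m y \<omega>)\<^sup>2 \<le> 8 * (exp (1 / 2 * proc n m y \<omega>) + exp (- (1 / 2) * proc n m y \<omega>))" for \<omega>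
      using square_le_exp_sum[of "proc n m y \<omega> / 2"] by (simp add: power_divide)
    then have "expectation (\<lambda>\<omega>. (proc n m y \<omega>)\<^sup>2)
        \<le> expectation (\<lambda>\<omega>. 8 * (exp (1 / 2 * proc n m y \<omega>) + exp (- (1 / 2) * proc n m y \<omega>)))"
      using mgf[of "1 / 2"] mgf[of "- (1 / 2)"] by (intro integral_mono i) (auto simp: mgf_le_def)
    also have "\<dots> \<le> 8 * (exp (1 / 2) + exp (1 / 2))"
      using mgf[of "1 / 2"] mgf[of "- (1 / 2)"] by (simp add: mgf_le_def)
    finally show ?thesis by (simp add: moment_bound_def)
  qed (simp add: proc_def moment_bound_def)
qed

lemma expectation_abs_avg_error_le:
  assumes [measurable]: "y \<in> borel_measurable S" and y: "\<And>s. \<bar>y s\<bar> \<le> c" and c: "0 < c" and n: "0 < n"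
  shows "expectation (\<lambda>\<omega>. \<bar>avg n (\<lambda>l. y (data \<omega> l)) - emean y\<bar>) \<le> c * (1 + moment_bound) / sqrt (real n)"
proof -
  define z where "z s = 1 / c * y s" for s
  have z: "z \<in> borel_measurable S" "\<And>s. \<bar>z s\<bar> \<le> 1"
    unfolding z_def using y c by (auto simp: divide_le_eq)
  have eq: "\<bar>avg n (\<lambda>l. y (data \<omega> l)) - emean y\<bar> = c * \<bar>proc n 0 z \<omega>\<bar> / sqrt (real n)" for \<omega>
    unfolding z_def proc_cmult using n c
    by (simp add: proc_def resample_def abs_mult)
  have "\<bar>proc n 0 z \<omega>\<bar> \<le> 1 + (proc n 0 z \<omega>)\<^sup>2" for \<omega>
    using zero_le_power2[of "\<bar>proc n 0 z \<omega>\<bar> - 1 / 2"] by (simp add: power2_diff power_divide)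
  then have "expectation (\<lambda>\<omega>. \<bar>proc n 0 z \<omega>\<bar>) \<le> expectation (\<lambda>\<omega>. 1 + (proc n 0 z \<omega>)\<^sup>2)"
    using proc_second_moment[OF z] abs_proc_le[OF z] z(1)
    by (intro integral_mono integrable_const_bound[of "\<lambda>\<omega>. \<bar>proc n 0 z \<omega>\<bar>" "2 * sqrt (real n)"]) auto
  also have "\<dots> \<le> 1 + moment_bound"
    using proc_second_moment[OF z, of n 0] by (simp add: prob_space)
  finally show ?thesis
    unfolding eq using n c by (simp add: divide_right_mono mult_left_mono)
qed

definition evar :: "('s \<Rightarrow> real) \<Rightarrow> real" where
  "evar y = emean (\<lambda>s. (y s)\<^sup>2) - (emean y)\<^sup>2"

lemma evar_eq_expectation:
  assumes [measurable]: "y \<in> borel_measurable S" and y: "\<And>s. \<bar>y s\<bar> \<le> c"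
  shows "evar y = expectation (\<lambda>\<omega>. (y (obs 0 \<omega>) - emean y)\<^sup>2)"
proof -
  have "(y s)\<^sup>2 \<le> c\<^sup>2" for s using y[of s] by (simp add: abs_le_square_iff[symmetric])
  then have "integrable P (\<lambda>\<omega>. (y (obs 0 \<omega>))\<^sup>2)"
    by (intro integrable_const_bound[of _ "c\<^sup>2"]) auto
  moreover have "integrable P (\<lambda>\<omega>. y (obs 0 \<omega>))" by (rule integrable_obs[OF assms])
  ultimately show ?thesis
    by (simp add: evar_def power2_diff prob_space emean_def[symmetric]) (simp add: emean_def power2_eq_square)
qed

lemma evar_nonneg:
  assumes "y \<in> borel_measurable S" "\<And>s. \<bar>y s\<bar> \<le> c"
  shows "0 \<le> evar y"
  unfolding evar_eq_expectation[OF assms] by simp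

lemma abs_sample_var_error_le:
  assumes ym: "y \<in> borel_measurable S" and y: "\<And>s. \<bar>y s\<bar> \<le> c" and n: "0 < n"
  shows "\<bar>sample_var n (\<lambda>l. y (x l)) - evar y\<bar>
    \<le> \<bar>avg n (\<lambda>l. (y (x l))\<^sup>2) - emean (\<lambda>s. (y s)\<^sup>2)\<bar> + 2 * c * \<bar>avg n (\<lambda>l. y (x l)) - emean y\<bar>"
proof -
  let ?a = "avg n (\<lambda>l. y (x l))" and ?b = "avg n (\<lambda>l. (y (x l))\<^sup>2)" and ?m2 = "emean (\<lambda>s. (y s)\<^sup>2)"
  have "\<bar>?a\<bar> \<le> c" "\<bar>emean y\<bar> \<le> c"
    using norm_avg_le[of "\<lambda>l. y (x l)", OF _ n] abs_emean_le[OF ym y] y by simp_all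
  then have "\<bar>?a + emean y\<bar> \<le> 2 * c" by linarith
  then have "\<bar>?a + emean y\<bar> * \<bar>?a - emean y\<bar> \<le> 2 * c * \<bar>?a - emean y\<bar>"
    by (rule mult_right_mono) simp
  moreover have "sample_var n (\<lambda>l. y (x l)) - evar y = (?b - ?m2) - (?a + emean y) * (?a - emean y)"
    unfolding sample_var_def evar_def by (simp add: power2_eq_square algebra_simps)
  ultimately show ?thesis
    using abs_triangle_ineq4[of "?b - ?m2" "(?a + emean y) * (?a - emean y)"] by (simp add: abs_mult)
qed

lemma integrable_abs_avg_error:
  assumes y: "y \<in> borel_measurable S" "\<And>s. \<bar>y s\<bar> \<le> c" and n: "0 < n"
  shows "integrable P (\<lambda>\<omega>. \<bar>avg n (\<lambda>l. y (data \<omega> l)) - emean y\<bar>)"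
proof (rule integrable_const_bound[of _ "2 * c"])
  have avg: "\<bar>avg n (\<lambda>l. y (data \<omega> l))\<bar> \<le> c" for \<omega>
    using norm_avg_le[of "\<lambda>l. y (data \<omega> l)", OF _ n] y(2) by simp
  have "\<bar>avg n (\<lambda>l. y (data \<omega> l)) - emean y\<bar> \<le> 2 * c" for \<omega>
    using avg[of \<omega>] abs_emean_le[OF y] by linarith
  then show "AE \<omega> in P. norm \<bar>avg n (\<lambda>l. y (data \<omega> l)) - emean y\<bar> \<le> 2 * c" by simp
qed (use y in measurable)

lemma expectation_abs_sample_var_error_le:
  assumes ym [measurable]: "y \<in> borel_measurable S" and y: "\<And>s. \<bar>y s\<bar> \<le> c" and c: "0 < c" and n: "0 < n"
  shows "integrable P (\<lambda>\<omega>. \<bar>sample_var n (\<lambda>l. y (data \<omega> l)) - evar y\<bar>)"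
    "expectation (\<lambda>\<omega>. \<bar>sample_var n (\<lambda>l. y (data \<omega> l)) - evar y\<bar>) \<le> 3 * c\<^sup>2 * (1 + moment_bound) / sqrt (real n)"
proof -
  let ?e = "\<lambda>z \<omega>. \<bar>avg n (\<lambda>l. z (data \<omega> l)) - emean z\<bar>" and ?y2 = "\<lambda>s. (y s)\<^sup>2"
  have y2: "?y2 \<in> borel_measurable S" "\<And>s. \<bar>?y2 s\<bar> \<le> c\<^sup>2"
    using y c by (auto simp: abs_le_square_iff[symmetric])
  note pointwise = abs_sample_var_error_le[OF ym y n]
  note ie = integrable_abs_avg_error[OF y2 n] integrable_abs_avg_error[OF ym y n]
  then have i: "integrable P (\<lambda>\<omega>. ?e ?y2 \<omega> + 2 * c * ?e y \<omega>)"
    by (intro Bochner_Integration.integrable_add integrable_mult_right)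
  show i': "integrable P (\<lambda>\<omega>. \<bar>sample_var n (\<lambda>l. y (data \<omega> l)) - evar y\<bar>)"
  proof (rule Bochner_Integration.integrable_bound[OF i])
    show "(\<lambda>\<omega>. \<bar>sample_var n (\<lambda>l. y (data \<omega> l)) - evar y\<bar>) \<in> borel_measurable P"
      unfolding sample_var_def by measurable
    show "AE \<omega> in P. norm \<bar>sample_var n (\<lambda>l. y (data \<omega> l)) - evar y\<bar> \<le> norm (?e ?y2 \<omega> + 2 * c * ?e y \<omega>)"
      unfolding real_norm_def abs_abs by (intro AE_I2 order_trans[OF pointwise abs_ge_self])
  qed
  have "expectation (\<lambda>\<omega>. \<bar>sample_var n (\<lambda>l. y (data \<omega> l)) - evar y\<bar>) \<le> expectation (\<lambda>\<omega>. ?e ?y2 \<omega> + 2 * c * ?e y \<omega>)"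
    by (intro integral_mono i i' pointwise)
  also have "\<dots> = expectation (?e ?y2) + 2 * c * expectation (?e y)"
    using ie by simp
  also have "\<dots> \<le> c\<^sup>2 * (1 + moment_bound) / sqrt (real n) + 2 * c * (c * (1 + moment_bound) / sqrt (real n))"
    using c by (intro add_mono mult_left_mono expectation_abs_avg_error_le y2 ym y n) auto
  also have "\<dots> = 3 * c\<^sup>2 * (1 + moment_bound) / sqrt (real n)"
    by (simp add: power2_eq_square add_divide_distrib[symmetric] algebra_simps)
  finally show "expectation (\<lambda>\<omega>. \<bar>sample_var n (\<lambda>l. y (data \<omega> l)) - evar y\<bar>)
      \<le> 3 * c\<^sup>2 * (1 + moment_bound) / sqrt (real n)" .
qed

end

context iid_bootstrap
begin

definition data_cf :: "nat \<Rightarrow> ('s \<Rightarrow> real) \<Rightarrow> (nat \<Rightarrow> 's) \<Rightarrow> complex" where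
  "data_cf n y x = (\<Prod>i<n. cis ((y (x i) - emean y) / sqrt (real n)))"

definition resample_cf :: "nat \<Rightarrow> ('s \<Rightarrow> real) \<Rightarrow> (nat \<Rightarrow> 's) \<Rightarrow> complex" where
  "resample_cf n y x = avg n (\<lambda>l. cis ((y (x l) - avg n (\<lambda>l. y (x l))) / sqrt (real n))) ^ n"

lemma measurable_data_cf:
  assumes [measurable]: "y \<in> borel_measurable S"
  shows "data_cf n y \<in> borel_measurable (Pi\<^sub>M UNIV (\<lambda>_. S))"
  unfolding data_cf_def by measurable

lemma measurable_resample_cf:
  assumes [measurable]: "y \<in> borel_measurable S"
  shows "resample_cf n y \<in> borel_measurable (Pi\<^sub>M UNIV (\<lambda>_. S))"
  unfolding resample_cf_def by measurable

lemma norm_data_cf_le: "cmod (data_cf n y x) \<le> 1"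
  by (simp add: data_cf_def prod_norm[symmetric])

lemma norm_resample_cf_le:
  assumes "0 < n" shows "cmod (resample_cf n y x) \<le> 1"
  unfolding resample_cf_def norm_power by (intro power_le_one norm_avg_le assms) simp_all

text \<open>Given the data, the resamples are independent and each is a sum of \<open>n\<close> i.i.d. terms.\<close>
lemma expectation_cis_sum_proc:
  assumes y [measurable]: "\<And>m. y m \<in> borel_measurable S" and n: "0 < n"
  shows "expectation (\<lambda>\<omega>. cis (\<Sum>m\<le>M. proc n m (y m) \<omega>))
    = expectation (\<lambda>\<omega>. data_cf n (y 0) (data \<omega>) * (\<Prod>m\<in>{1..M}. resample_cf n (y m) (data \<omega>)))"
proof -
  define a where "a m l x = cis ((y m (x l) - avg n (\<lambda>l. y m (x l))) / sqrt (real n))" for m l x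
  have [measurable]: "a m l \<in> borel_measurable (Pi\<^sub>M UNIV (\<lambda>_. S))" for m l
    unfolding a_def by measurable
  have "cis (\<Sum>m\<le>M. proc n m (y m) \<omega>)
      = data_cf n (y 0) (data \<omega>) * (\<Prod>m\<in>{1..M}. \<Prod>i<n. a m (J (n, m, i) \<omega>) (data \<omega>))" for \<omega>
  proof -
    have "cis (proc n 0 (y 0) \<omega>) = data_cf n (y 0) (data \<omega>)"
      using n by (simp add: proc_eq_sum resample_def data_cf_def cis_sum)
    moreover have "cis (proc n m (y m) \<omega>) = (\<Prod>i<n. a m (J (n, m, i) \<omega>) (data \<omega>))" if "m \<in> {1..M}" for m
      using that n by (simp add: proc_eq_sum resample_def a_def cis_sum)
    moreover have "{..M} = insert 0 {1..M}" by auto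
    ultimately show ?thesis by (subst cis_sum) simp
  qed
  then show ?thesis
    unfolding resample_cf_def
    using expectation_resample_prod[of "{1..M}" "data_cf n (y 0)" a 1 1 n] norm_data_cf_le measurable_data_cf[OF y]
    by (simp add: a_def)
qed

lemma data_cf_error:
  assumes [measurable]: "y \<in> borel_measurable S" and y: "\<And>s. \<bar>y s\<bar> \<le> c" and n: "0 < n"
  shows "cmod (expectation (\<lambda>\<omega>. data_cf n y (data \<omega>)) - exp (- evar y / 2)) \<le> cf_rate c / sqrt (real n)"
proof -
  let ?Y = "\<lambda>\<omega>. y (obs 0 \<omega>) - emean y"
  have "expectation (\<lambda>\<omega>. data_cf n y (data \<omega>)) = expectation (\<lambda>\<omega>. cis (?Y \<omega> / sqrt (real n))) ^ n"
    unfolding data_cf_def data_def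
    by (rule expectation_prod_obs[of "\<lambda>s. cis ((y s - emean y) / sqrt (real n))" 1]) auto
  moreover have "\<bar>?Y \<omega>\<bar> \<le> 2 * c" for \<omega>
    using y[of "obs 0 \<omega>"] abs_emean_le[of y c] y by fastforce
  moreover have "expectation ?Y = 0"
    using integrable_obs[of y c 0] y by (simp add: emean_def prob_space)
  ultimately show ?thesis
    using cf_power_approx[of ?Y "2 * c" n] n evar_eq_expectation[of y c] y by (simp add: cf_rate_def)
qed

definition resample_cf_rate :: "real \<Rightarrow> real" where
  "resample_cf_rate c = cf_rate c + 3 * c\<^sup>2 * (1 + moment_bound)"

lemma resample_cf_error:
  assumes ym [measurable]: "y \<in> borel_measurable S" and y: "\<And>s. \<bar>y s\<bar> \<le> c" and c: "0 < c" and n: "0 < n"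
  shows "expectation (\<lambda>\<omega>. cmod (resample_cf n y (data \<omega>) - exp (- evar y / 2))) \<le> resample_cf_rate c / sqrt (real n)"
proof -
  let ?v = "\<lambda>\<omega>. sample_var n (\<lambda>l. y (data \<omega> l))" and ?e = "exp (- evar y / 2)"
  have pointwise: "cmod (resample_cf n y (data \<omega>) - ?e) \<le> cf_rate c / sqrt (real n) + \<bar>?v \<omega> - evar y\<bar>" for \<omega>
  proof -
    have "cmod (resample_cf n y (data \<omega>) - exp (- ?v \<omega> / 2)) \<le> cf_rate c / sqrt (real n)"
      unfolding resample_cf_def by (rule avg_cis_power_approx[OF y n])
    moreover have "cmod (exp (- ?v \<omega> / 2) - ?e) \<le> \<bar>?v \<omega> - evar y\<bar>"
    proof -
      have "\<bar>exp (- (?v \<omega> / 2)) - exp (- (evar y / 2))\<bar> \<le> \<bar>?v \<omega> / 2 - evar y / 2\<bar>"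
        using sample_var_nonneg[OF n] evar_nonneg[OF ym y] by (intro abs_exp_minus_diff_le) auto
      then show ?thesis by (simp add: of_real_exp[symmetric] of_real_diff[symmetric] del: of_real_diff of_real_exp)
    qed
    ultimately show ?thesis
      using norm_triangle_ineq[of "resample_cf n y (data \<omega>) - exp (- ?v \<omega> / 2)" "exp (- ?v \<omega> / 2) - ?e"] by simp
  qed
  have i: "integrable P (\<lambda>\<omega>. cmod (resample_cf n y (data \<omega>) - ?e))"
  proof (rule integrable_const_bound[of _ "1 + cmod ?e"])
    show "AE \<omega> in P. norm (cmod (resample_cf n y (data \<omega>) - ?e)) \<le> 1 + cmod ?e"
      unfolding real_norm_def abs_norm_cancel
      by (intro AE_I2 order_trans[OF norm_triangle_ineq4] add_right_mono norm_resample_cf_le n)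
  qed (use measurable_resample_cf[OF ym] in measurable)
  have "expectation (\<lambda>\<omega>. cmod (resample_cf n y (data \<omega>) - ?e))
      \<le> expectation (\<lambda>\<omega>. cf_rate c / sqrt (real n) + \<bar>?v \<omega> - evar y\<bar>)"
    using expectation_abs_sample_var_error_le(1)[OF ym y c n]
    by (intro integral_mono i pointwise Bochner_Integration.integrable_add) auto
  also have "\<dots> \<le> cf_rate c / sqrt (real n) + 3 * c\<^sup>2 * (1 + moment_bound) / sqrt (real n)"
    using expectation_abs_sample_var_error_le[OF ym y c n] by (simp add: prob_space)
  finally show ?thesis by (simp add: resample_cf_rate_def add_divide_distrib)
qed

lemma cf_sum_proc_error:
  assumes ym [measurable]: "\<And>m. y m \<in> borel_measurable S" and y: "\<And>m s. \<bar>y m s\<bar> \<le> c"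
    and c: "0 < c" and n: "0 < n"
  shows "cmod (expectation (\<lambda>\<omega>. cis (\<Sum>m\<le>M. proc n m (y m) \<omega>)) - exp (- (\<Sum>m\<le>M. evar (y m)) / 2))
      \<le> (cf_rate c + real M * resample_cf_rate c) / sqrt (real n)"
proof -
  let ?e = "\<lambda>m. complex_of_real (exp (- evar (y m) / 2))"
  have "exp (- (\<Sum>m\<le>M. evar (y m)) / 2) = (\<Prod>m\<le>M. exp (- evar (y m) / 2))"
    by (subst exp_sum[symmetric]) (auto simp: sum_negf sum_divide_distrib)
  moreover have "{..M} = insert 0 {1..M}" by auto
  then have "(\<Prod>m\<le>M. ?e m) = ?e 0 * (\<Prod>m\<in>{1..M}. ?e m)" by simp
  ultimately have prod_e: "complex_of_real (exp (- (\<Sum>m\<le>M. evar (y m)) / 2)) = ?e 0 * (\<Prod>m\<in>{1..M}. ?e m)"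
    by (metis of_real_prod)
  have "cmod (expectation (\<lambda>\<omega>. data_cf n (y 0) (data \<omega>) * (\<Prod>m\<in>{1..M}. resample_cf n (y m) (data \<omega>)))
      - ?e 0 * (\<Prod>m\<in>{1..M}. ?e m))
    \<le> cmod (expectation (\<lambda>\<omega>. data_cf n (y 0) (data \<omega>)) - ?e 0)
      + (\<Sum>m\<in>{1..M}. expectation (\<lambda>\<omega>. cmod (resample_cf n (y m) (data \<omega>) - ?e m)))"
    using measurable_data_cf[OF ym] measurable_resample_cf[OF ym] evar_nonneg[OF ym y]
    by (intro cmod_expectation_mult_prod_diff_le norm_data_cf_le norm_resample_cf_le n
        measurable_compose[OF measurable_data]) auto
  also have "\<dots> \<le> cf_rate c / sqrt (real n) + (\<Sum>m\<in>{1..M}. resample_cf_rate c / sqrt (real n))"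
    by (intro add_mono sum_mono data_cf_error resample_cf_error ym y c n)
  also have "\<dots> = (cf_rate c + real M * resample_cf_rate c) / sqrt (real n)"
    by (simp add: add_divide_distrib)
  finally show ?thesis
    unfolding expectation_cis_sum_proc[OF ym n] prod_e .
qed

lemma cf_sum_proc_tendsto:
  assumes "\<And>m. y m \<in> borel_measurable S" "\<And>m s. \<bar>y m s\<bar> \<le> c" "0 < c"
  shows "(\<lambda>n. expectation (\<lambda>\<omega>. cis (\<Sum>m\<le>M. proc n m (y m) \<omega>))) \<longlonglongrightarrow> exp (- (\<Sum>m\<le>M. evar (y m)) / 2)"
proof -
  have "eventually (\<lambda>n. norm (expectation (\<lambda>\<omega>. cis (\<Sum>m\<le>M. proc n m (y m) \<omega>)) - exp (- (\<Sum>m\<le>M. evar (y m)) / 2))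
      \<le> (cf_rate c + real M * resample_cf_rate c) / sqrt (real n)) sequentially"
    using eventually_gt_at_top[of 0] by eventually_elim (rule cf_sum_proc_error[OF assms])
  then have "(\<lambda>n. expectation (\<lambda>\<omega>. cis (\<Sum>m\<le>M. proc n m (y m) \<omega>)) - exp (- (\<Sum>m\<le>M. evar (y m)) / 2)) \<longlonglongrightarrow> 0"
    using tendsto_const_over_sqrt by (rule Lim_null_comparison)
  then show ?thesis by (simp add: LIM_zero_iff)
qed

end

section \<open>Sandwiching the empirical copula\<close>

definition orthant :: "('p \<Rightarrow> real \<Rightarrow> real) \<Rightarrow> (real^'q) set \<Rightarrow> real^'p \<Rightarrow> (real^'p) \<times> (real^'q) \<Rightarrow> real" where
  "orthant F A u s = of_bool ((\<forall>k. F k (fst s $ k) \<le> u $ k) \<and> snd s \<in> A)"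

definition edge :: "'p \<Rightarrow> real \<Rightarrow> real^'p" where
  "edge k t = (\<chi> j. if j = k then t else 1)"

lemma edge_component: "edge k t $ j = (if j = k then t else 1)"
  by (simp add: edge_def)

lemma edge_one: "edge k 1 = 1"
  by (simp add: edge_def vec_eq_iff)

lemma edge_in_unit_cube: "0 \<le> t \<Longrightarrow> t \<le> 1 \<Longrightarrow> edge k t \<in> unit_cube"
  by (simp add: edge_component unit_cube_def)

lemma orthant_cases: "orthant F A u s = 0 \<or> orthant F A u s = 1"
  by (cases "(\<forall>k. F k (fst s $ k) \<le> u $ k) \<and> snd s \<in> A") (auto simp: orthant_def)

lemma abs_orthant_le: "\<bar>orthant F A u s\<bar> \<le> 1"
  by (simp add: orthant_def)

lemma orthant_mono: "u \<le> v \<Longrightarrow> orthant F A u s \<le> orthant F A v s"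
  by (auto simp: orthant_def less_eq_vec_def intro: order_trans)

lemma orthant_mult: "orthant F A u s * orthant F A v s = orthant F A (\<chi> k. min (u $ k) (v $ k)) s"
  by (auto simp: orthant_def)

lemma orthant_edge:
  assumes "\<And>k t. F k t \<le> 1"
  shows "orthant F A (edge k t) s = of_bool (F k (fst s $ k) \<le> t \<and> snd s \<in> A)"
proof -
  have "(\<forall>j. F j (fst s $ j) \<le> edge k t $ j) \<longleftrightarrow> F k (fst s $ k) \<le> t"
    using assms by (auto simp: edge_component)
  then show ?thesis by (simp add: orthant_def)
qed

lemma orthant_diff_le_sum_edge:
  assumes F: "\<And>k t. F k t \<le> 1" and uv: "u \<le> v"
  shows "orthant F A v s - orthant F A u s
    \<le> (\<Sum>k\<in>UNIV. orthant F A (edge k (v $ k)) s - orthant F A (edge k (u $ k)) s)" (is "_ \<le> sum ?f UNIV")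
proof -
  have nonneg: "0 \<le> ?f k" for k
    using uv by (simp add: orthant_edge[OF F] less_eq_vec_def) (meson order_trans)
  show ?thesis
  proof (cases "orthant F A v s = 1 \<and> orthant F A u s = 0")
    case True
    then have "\<forall>k. F k (fst s $ k) \<le> v $ k" "snd s \<in> A" "\<exists>k. \<not> F k (fst s $ k) \<le> u $ k"
      by (auto simp: orthant_def)
    then obtain k where "1 = ?f k" by (auto simp: orthant_edge[OF F])
    also have "?f k \<le> sum ?f UNIV" using nonneg by (intro member_le_sum) auto
    finally show ?thesis using True by simp
  next
    case False
    then have "orthant F A v s - orthant F A u s \<le> 0"
      using orthant_cases[of F A v s] orthant_cases[of F A u s] by auto
    also have "0 \<le> sum ?f UNIV" using nonneg by (intro sum_nonneg)
    finally show ?thesis .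
  qed
qed

definition emp_D :: "('p \<Rightarrow> real \<Rightarrow> real) \<Rightarrow> nat \<Rightarrow> (nat \<Rightarrow> (real^'p) \<times> (real^'q)) \<Rightarrow> (real^'q) set
    \<Rightarrow> real^'p \<Rightarrow> real" where
  "emp_D F n s A u = avg n (\<lambda>i. orthant F A u (s i))"

lemma mono_emp_D: "mono (emp_D F n s A)"
  unfolding emp_D_def by (intro monoI avg_mono orthant_mono)

lemma emp_pA_eq_avg: "emp_pA n s A = avg n (\<lambda>i. of_bool (snd (s i) \<in> A))"
  by (simp add: emp_pA_def avg_def of_bool_def)

lemma emp_D_one:
  assumes "\<And>k t. F k t \<le> 1" shows "emp_D F n s A 1 = emp_pA n s A"
  using assms by (simp add: emp_D_def emp_pA_eq_avg orthant_def)

lemma emp_F_mult_emp_pA: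
  assumes "0 < emp_pA n s A"
  shows "emp_F n s A k t * emp_pA n s A = avg n (\<lambda>i. of_bool (fst (s i) $ k \<le> t \<and> snd (s i) \<in> A))"
  using assms by (simp add: emp_F_def avg_def of_bool_def)

lemma emp_copula_mult_emp_pA:
  assumes "0 < emp_pA n s A"
  shows "emp_copula n s A u * emp_pA n s A
    = avg n (\<lambda>i. of_bool ((\<forall>k. ereal (fst (s i) $ k) \<le> ginv (emp_F n s A k) (u $ k)) \<and> snd (s i) \<in> A))"
  using assms by (simp add: emp_copula_def avg_def of_bool_def)

lemma emp_F_nonneg: "0 \<le> emp_F n s A k t"
  unfolding emp_F_def emp_pA_def by (intro divide_nonneg_nonneg sum_nonneg mult_nonneg_nonneg) auto

lemma mono_emp_F: "mono (emp_F n s A k)"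
proof (rule monoI)
  fix a b :: real assume "a \<le> b"
  then show "emp_F n s A k a \<le> emp_F n s A k b"
    unfolding emp_F_def emp_pA_def
    by (intro divide_right_mono sum_mono mult_nonneg_nonneg divide_nonneg_nonneg sum_nonneg) auto
qed

lemma emp_copula_01: "0 \<le> emp_copula n s A u \<and> emp_copula n s A u \<le> 1"
proof -
  let ?a = "\<Sum>i<n. if (\<forall>k. ereal (fst (s i) $ k) \<le> ginv (emp_F n s A k) (u $ k)) \<and> snd (s i) \<in> A then 1 else 0::real"
  let ?b = "\<Sum>i<n. if snd (s i) \<in> A then 1 else 0::real"
  have "?a \<le> ?b" "0 \<le> ?a" by (auto intro!: sum_mono sum_nonneg)
  moreover have "emp_copula n s A u = ?a / ?b"
    by (cases "n = 0") (auto simp: emp_copula_def emp_pA_def)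
  ultimately show ?thesis by (auto simp: divide_le_eq intro!: divide_nonneg_nonneg)
qed

lemma ginv_nonpos:
  assumes F: "\<And>t. 0 \<le> F t" and "u \<le> 0"
  shows "ginv F u = -\<infinity>"
proof -
  have "{ereal t | t. F t \<ge> u} = range ereal"
    using order_trans[OF assms(2) F] by blast
  moreover have "Inf (range ereal) = -\<infinity>"
    by (rule ereal_bot) (intro Inf_lower; simp)
  ultimately show ?thesis by (simp add: ginv_def)
qed

lemma ginv_right_continuous:
  assumes F: "mono F" and cont: "\<And>t. continuous (at_right t) F" and a: "F a < u" and b: "u \<le> F b"
  obtains x where "ginv F u = ereal x" "u \<le> F x" "\<And>t. t < x \<Longrightarrow> F t < u"
proof -
  define x where "x = Inf {t. u \<le> F t}"
  have bdd: "bdd_below {t. u \<le> F t}"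
  proof (rule bdd_belowI)
    fix t assume "t \<in> {t. u \<le> F t}"
    then show "a \<le> t" using a monoD[OF F, of t a] by force
  qed
  have below: "F t < u" if "t < x" for t
    using cInf_lower[OF _ bdd, of t] that by (force simp: x_def)
  have "u \<le> F t" if x_less: "x < t" for t
  proof -
    obtain t' where "u \<le> F t'" "t' < t"
      using x_less b cInf_lessD[of "{t. u \<le> F t}" t] by (auto simp: x_def)
    then show ?thesis using monoD[OF F, of t' t] by simp
  qed
  then have "eventually (\<lambda>t. u \<le> F t) (at_right x)"
    by (auto simp: eventually_at_right_field intro: exI[of _ "x + 1"])
  then have Fx: "u \<le> F x"
    using cont[of x] unfolding continuous_within by (intro tendsto_lowerbound) auto
  have "ginv F u = ereal x"
    unfolding ginv_def
  proof (rule Inf_eqI)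
    show "ereal x \<le> z" if "z \<in> {ereal t |t. u \<le> F t}" for z
      using that cInf_lower[OF _ bdd] by (auto simp: x_def)
  qed (use Fx in auto)
  then show thesis using Fx below by (rule that)
qed

lemma eventually_at_right_le_iff: "eventually (\<lambda>t. a \<le> t \<longleftrightarrow> a \<le> x) (at_right (x::real))"
proof (cases "a \<le> x")
  case True
  then show ?thesis unfolding eventually_at_right_field by (intro exI[of _ "x + 1"]) auto
next
  case False
  then show ?thesis unfolding eventually_at_right_field by (intro exI[of _ a]) auto
qed

lemma eventually_at_left_le_iff: "eventually (\<lambda>t. a \<le> t \<longleftrightarrow> a < x) (at_left (x::real))"
proof (cases "a < x")
  case True
  then show ?thesis unfolding eventually_at_left_field by (intro exI[of _ a]) auto
next
  case False
  then show ?thesis unfolding eventually_at_left_field by (intro exI[of _ "x - 1"]) auto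
qed

lemma emp_F_right_continuous: "continuous (at_right x) (emp_F n s A k)"
proof -
  have "eventually (\<lambda>t. \<forall>i\<in>{..<n}. fst (s i) $ k \<le> t \<longleftrightarrow> fst (s i) $ k \<le> x) (at_right x)"
    by (intro eventually_ball_finite ballI eventually_at_right_le_iff) simp
  then have "eventually (\<lambda>t. emp_F n s A k t = emp_F n s A k x) (at_right x)"
    by eventually_elim (simp add: emp_F_def cong: sum.cong_simp)
  then show ?thesis
    unfolding continuous_within by (rule tendsto_eventually)
qed

lemma ginv_emp_F:
  assumes pos: "0 < emp_pA n s A" and u: "0 < u" "u \<le> 1"
  obtains x where "ginv (emp_F n s A k) u = ereal x" "u \<le> emp_F n s A k x"
    "\<And>t. t < x \<Longrightarrow> emp_F n s A k t < u"
proof (rule ginv_right_continuous[OF mono_emp_F emp_F_right_continuous])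
  define b where "b = (\<Sum>i<n. \<bar>fst (s i) $ k\<bar>)"
  have bound: "\<bar>fst (s i) $ k\<bar> \<le> b" if "i < n" for i
    unfolding b_def using that by (intro member_le_sum) auto
  have "emp_F n s A k (- b - 1) * emp_pA n s A = 0"
    unfolding emp_F_mult_emp_pA[OF pos] avg_def using bound by (force intro!: sum.neutral)
  then show "emp_F n s A k (- b - 1) < u" using pos u by simp
  have "emp_F n s A k b * emp_pA n s A = emp_pA n s A"
    unfolding emp_F_mult_emp_pA[OF pos] unfolding emp_pA_eq_avg avg_def
    using bound by (intro arg_cong2[where f = "(/)"] sum.cong) (auto simp: abs_le_iff)
  then show "u \<le> emp_F n s A k b" using pos u by simp
qed (rule that)

definition quantile_point :: "('p \<Rightarrow> real \<Rightarrow> real) \<Rightarrow> nat \<Rightarrow> (nat \<Rightarrow> (real^'p) \<times> (real^'q)) \<Rightarrow> (real^'q) set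
    \<Rightarrow> real^'p \<Rightarrow> real^'p" where
  "quantile_point F n s A u =
     (\<chi> k. if 0 < u $ k then F k (real_of_ereal (ginv (emp_F n s A k) (u $ k))) else 0)"

text \<open>The empirical copula at \<open>u\<close> lies between the values of the empirical distribution of the \<open>F\<^sub>k(X\<^sub>k)\<close>
  at \<open>v = quantile_point F n s A u\<close> and just below it; ties of \<open>F\<^sub>k(X\<^sub>k)\<close> are harmless.\<close>
context
  fixes F :: "'p::finite \<Rightarrow> real \<Rightarrow> real" and n and s :: "nat \<Rightarrow> (real^'p) \<times> (real^'q)" and A and u v :: "real^'p"
  assumes F_01: "\<And>k t. 0 \<le> F k t \<and> F k t \<le> 1" and F_mono: "\<And>k. mono (F k)"
    and pos: "0 < emp_pA n s A"
    and F_pos: "\<And>i k. i < n \<Longrightarrow> snd (s i) \<in> A \<Longrightarrow> 0 < F k (fst (s i) $ k)"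
    and u: "u \<in> unit_cube"
  defines "v \<equiv> quantile_point F n s A u"
begin

lemma quantile_point_in_unit_cube: "v \<in> unit_cube"
  using F_01 by (simp add: v_def quantile_point_def unit_cube_def)

lemma quantile_point_zero: "u $ k = 0 \<Longrightarrow> v $ k = 0"
  by (simp add: v_def quantile_point_def)

lemma quantile_point_pos:
  assumes "0 < u $ k"
  obtains x where "ginv (emp_F n s A k) (u $ k) = ereal x" "v $ k = F k x" "u $ k \<le> emp_F n s A k x"
    "\<And>t. t < x \<Longrightarrow> emp_F n s A k t < u $ k"
proof -
  obtain x where x: "ginv (emp_F n s A k) (u $ k) = ereal x" "u $ k \<le> emp_F n s A k x"
    "\<And>t. t < x \<Longrightarrow> emp_F n s A k t < u $ k"
    using ginv_emp_F[OF pos assms unit_cube_component(2)[OF u]] by blast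
  have "v $ k = F k x" using assms x(1) by (simp add: v_def quantile_point_def)
  with x show thesis by (intro that)
qed

lemma emp_D_edge:
  "emp_D F n s A (edge k t) = avg n (\<lambda>i. of_bool (F k (fst (s i) $ k) \<le> t \<and> snd (s i) \<in> A))"
  using F_01 by (simp add: emp_D_def orthant_edge)

lemma emp_D_edge_quantile_ge: "u $ k * emp_pA n s A \<le> emp_D F n s A (edge k (v $ k))"
proof (cases "0 < u $ k")
  case True
  then obtain x where x: "v $ k = F k x" "u $ k \<le> emp_F n s A k x"
    using quantile_point_pos by blast
  have "u $ k * emp_pA n s A \<le> emp_F n s A k x * emp_pA n s A"
    using x pos by (intro mult_right_mono) auto
  also have "\<dots> \<le> emp_D F n s A (edge k (v $ k))"
    unfolding emp_F_mult_emp_pA[OF pos] emp_D_edge x(1) using monoD[OF F_mono]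
    by (intro avg_mono) auto
  finally show ?thesis .
next
  case False
  then have "u $ k = 0" using unit_cube_component(1)[OF u, of k] by simp
  then show ?thesis by (simp add: emp_D_edge avg_nonneg)
qed

lemma emp_D_edge_zero: "emp_D F n s A (edge k 0) = 0"
  unfolding emp_D_edge avg_def using F_pos by (auto simp: not_le[symmetric] intro!: sum.neutral)

lemma emp_D_edge_below_quantile_le:
  assumes a: "a < v $ k \<or> a = 0" "0 \<le> a"
  shows "emp_D F n s A (edge k a) \<le> u $ k * emp_pA n s A"
proof (cases "a = 0")
  case True
  then show ?thesis using unit_cube_component(1)[OF u, of k] pos by (simp add: emp_D_edge_zero)
next
  case False
  then have "u $ k \<noteq> 0" using a quantile_point_zero[of k] by auto
  then have "0 < u $ k" using unit_cube_component(1)[OF u, of k] by simp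
  then obtain x where x: "v $ k = F k x" "\<And>t. t < x \<Longrightarrow> emp_F n s A k t < u $ k"
    using quantile_point_pos by blast
  have "eventually (\<lambda>t. (\<forall>i\<in>{..<n}. fst (s i) $ k \<le> t \<longleftrightarrow> fst (s i) $ k < x) \<and> t < x) (at_left x)"
    by (intro eventually_conj eventually_ball_finite ballI eventually_at_left_le_iff eventually_at_leftI[of "x - 1"]) auto
  from eventually_happens'[OF trivial_limit_at_left_real this]
  obtain t where t: "t < x" "\<And>i. i < n \<Longrightarrow> fst (s i) $ k \<le> t \<longleftrightarrow> fst (s i) $ k < x" by auto
  have "emp_D F n s A (edge k a) \<le> emp_F n s A k t * emp_pA n s A"
    unfolding emp_F_mult_emp_pA[OF pos] emp_D_edge
  proof (rule avg_mono)
    fix i assume "i < n"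
    have "fst (s i) $ k < x" if "F k (fst (s i) $ k) \<le> a"
      using that a False x(1) monoD[OF F_mono[of k], of x "fst (s i) $ k"] by force
    then show "of_bool (F k (fst (s i) $ k) \<le> a \<and> snd (s i) \<in> A)
        \<le> (of_bool (fst (s i) $ k \<le> t \<and> snd (s i) \<in> A) :: real)"
      using t(2)[OF \<open>i < n\<close>] by auto
  qed
  also have "\<dots> \<le> u $ k * emp_pA n s A"
    using x(2)[OF t(1)] pos by (intro mult_right_mono) auto
  finally show ?thesis .
qed

lemma emp_D_below_quantile_le_emp_copula:
  assumes a: "\<And>k. a $ k < v $ k \<or> a $ k = 0"
  shows "emp_D F n s A a \<le> emp_copula n s A u * emp_pA n s A"
  unfolding emp_copula_mult_emp_pA[OF pos] emp_D_def orthant_def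
proof (rule avg_mono)
  fix i assume i: "i < n"
  have "ereal (fst (s i) $ k) \<le> ginv (emp_F n s A k) (u $ k)"
    if below: "\<forall>k. F k (fst (s i) $ k) \<le> a $ k" and A: "snd (s i) \<in> A" for k
  proof -
    have "0 < a $ k" using F_pos[OF i A, of k] below by (auto intro: less_le_trans)
    then have a_less_v: "a $ k < v $ k" "u $ k \<noteq> 0" using a[of k] quantile_point_zero[of k] by auto
    then have "0 < u $ k" using unit_cube_component(1)[OF u, of k] by simp
    then obtain x where x: "ginv (emp_F n s A k) (u $ k) = ereal x" "v $ k = F k x"
      using quantile_point_pos by blast
    have "F k (fst (s i) $ k) < F k x" using below a_less_v x by (metis le_less_trans)
    then show ?thesis using x monoD[OF F_mono[of k], of x "fst (s i) $ k"] by force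
  qed
  then show "of_bool ((\<forall>k. F k (fst (s i) $ k) \<le> a $ k) \<and> snd (s i) \<in> A)
      \<le> (of_bool ((\<forall>k. ereal (fst (s i) $ k) \<le> ginv (emp_F n s A k) (u $ k)) \<and> snd (s i) \<in> A) :: real)"
    by auto
qed

lemma emp_copula_le_emp_D_quantile: "emp_copula n s A u * emp_pA n s A \<le> emp_D F n s A v"
  unfolding emp_copula_mult_emp_pA[OF pos] emp_D_def orthant_def
proof (rule avg_mono)
  fix i
  have "F k (fst (s i) $ k) \<le> v $ k" if le: "ereal (fst (s i) $ k) \<le> ginv (emp_F n s A k) (u $ k)" for k
  proof (cases "0 < u $ k")
    case True
    then obtain x where x: "ginv (emp_F n s A k) (u $ k) = ereal x" "v $ k = F k x"
      using quantile_point_pos by blast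
    then show ?thesis using le monoD[OF F_mono] by simp
  next
    case False
    then have "ginv (emp_F n s A k) (u $ k) = -\<infinity>"
      by (intro ginv_nonpos emp_F_nonneg) simp
    then show ?thesis using le by simp
  qed
  then show "of_bool ((\<forall>k. ereal (fst (s i) $ k) \<le> ginv (emp_F n s A k) (u $ k)) \<and> snd (s i) \<in> A)
      \<le> (of_bool ((\<forall>k. F k (fst (s i) $ k) \<le> v $ k) \<and> snd (s i) \<in> A) :: real)"
    by auto
qed

end

section \<open>Linearization of the empirical copula\<close>

lemma Cinf_diff: "Cinf p C dC f u - Cinf p C dC g u = Cinf p C dC (\<lambda>v. f v - g v) u"
  unfolding Cinf_def
  by (simp add: diff_divide_distrib right_diff_distrib left_diff_distrib sum_subtractf sum.distrib algebra_simps)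

lemma mult_Cinf:
  assumes "p \<noteq> 0"
  shows "p * Cinf p C dC f u
    = f u - (\<Sum>k\<in>UNIV. dC u k * (f (edge k (u $ k)) - u $ k * f 1)) - C u * f 1"
  unfolding Cinf_def edge_def[symmetric] using assms
  by (simp add: power2_eq_square right_diff_distrib sum_distrib_left)

lemma abs_mult_le_of_unit:
  fixes a x b :: real
  assumes "0 \<le> a" "a \<le> 1" "\<bar>x\<bar> \<le> b" shows "\<bar>a * x\<bar> \<le> b"
  using mult_mono[OF assms(2,3)] assms by (simp add: abs_mult)

lemma Taylor_remainder_le:
  fixes C :: "real^'p \<Rightarrow> real" and C' :: "real^'p \<Rightarrow> (real^'p) \<Rightarrow>\<^sub>L real"
  assumes C: "\<And>u. u \<in> unit_cube \<Longrightarrow> (C has_derivative blinfun_apply (C' u)) (at u within unit_cube)"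
    and C': "oscillation_le \<delta> \<rho> C'"
    and u: "u \<in> unit_cube" and v: "v \<in> unit_cube" and vu: "\<And>k. \<bar>v $ k - u $ k\<bar> \<le> \<delta>"
  shows "\<bar>C v - C u - (\<Sum>k\<in>UNIV. (v $ k - u $ k) * C' u (axis k 1))\<bar> \<le> (\<Sum>k\<in>UNIV. \<bar>v $ k - u $ k\<bar>) * \<rho>"
proof -
  let ?S = "unit_cube \<inter> {w. \<forall>k. \<bar>w $ k - u $ k\<bar> \<le> \<delta>}"
  have \<delta>: "0 \<le> \<delta>" using order_trans[OF abs_ge_zero vu] .
  have near: "norm (C' w - C' u) \<le> \<rho>" if "w \<in> ?S" for w
    using oscillation_leD[OF C', of w u] that u by (simp add: dist_norm)
  have "norm (C v - C u - blinfun_apply (C' u) (v - u)) \<le> norm (v - u) * \<rho>"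
  proof (rule differentiable_bound_linearization[where S = ?S and f' = "\<lambda>x. blinfun_apply (C' x)"])
    fix t :: real assume t: "t \<in> {0..1}"
    have "u + t *\<^sub>R (v - u) = (1 - t) *\<^sub>R u + t *\<^sub>R v" by (simp add: algebra_simps)
    also have "\<dots> \<in> unit_cube" using convex_unit_cube u v t unfolding convex_def by auto
    finally have "u + t *\<^sub>R (v - u) \<in> unit_cube" .
    moreover have "\<bar>t * (v $ k - u $ k)\<bar> \<le> \<delta>" for k
      using t vu by (intro abs_mult_le_of_unit) auto
    ultimately show "u + t *\<^sub>R (v - u) \<in> ?S" by simp
  next
    fix x assume x: "x \<in> ?S"
    show "(C has_derivative blinfun_apply (C' x)) (at x within ?S)"
      using has_derivative_subset[OF C] x by blast
    show "onorm (blinfun_apply (C' x) - blinfun_apply (C' u)) \<le> \<rho>"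
      using near[OF x] by (simp add: norm_blinfun.rep_eq minus_blinfun.rep_eq fun_diff_def)
  qed (use u \<delta> in simp)
  also have "norm (v - u) * \<rho> \<le> (\<Sum>k\<in>UNIV. \<bar>v $ k - u $ k\<bar>) * \<rho>"
    using norm_le_l1_cart[of "v - u"] near[of u] u \<delta> by (intro mult_right_mono) auto
  also have "blinfun_apply (C' u) (v - u) = (\<Sum>k\<in>UNIV. (v $ k - u $ k) * C' u (axis k 1))"
  proof -
    have "v - u = (\<Sum>k\<in>UNIV. (v $ k - u $ k) *\<^sub>R axis k 1)"
      using basis_expansion[of "v - u"] by (simp add: scalar_mult_eq_scaleR)
    then have "blinfun_apply (C' u) (v - u) = blinfun_apply (C' u) (\<Sum>k\<in>UNIV. (v $ k - u $ k) *\<^sub>R axis k 1)"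
      by simp
    then show ?thesis by (simp add: blinfun.sum_right blinfun.scaleR_right)
  qed
  finally show ?thesis by simp
qed

locale copula_model =
  fixes F :: "'p::finite \<Rightarrow> real \<Rightarrow> real" and p :: real
    and C :: "real^'p \<Rightarrow> real" and C' :: "real^'p \<Rightarrow> (real^'p) \<Rightarrow>\<^sub>L real"
  assumes F_01: "\<And>k t. 0 \<le> F k t \<and> F k t \<le> 1" and F_mono: "\<And>k. mono (F k)"
    and p_pos: "0 < p" and p_le_1: "p \<le> 1"
    and C_01: "\<And>u. 0 \<le> C u \<and> C u \<le> 1"
    and C_edge: "\<And>k t. 0 \<le> t \<Longrightarrow> t \<le> 1 \<Longrightarrow> C (edge k t) = t"
    and l1_growth_C: "l1_growth (\<lambda>u. p * C u)"
    and C_deriv: "\<And>u. u \<in> unit_cube \<Longrightarrow> (C has_derivative blinfun_apply (C' u)) (at u within unit_cube)"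
    and C'_cont: "continuous_on unit_cube C'"
begin

abbreviation dC :: "real^'p \<Rightarrow> 'p \<Rightarrow> real" where
  "dC \<equiv> \<lambda>v k. blinfun_apply (C' v) (axis k 1)"

definition C'_bound :: real where
  "C'_bound = (SUP u\<in>unit_cube. norm (C' u))"

definition Cinf_bound :: real where
  "Cinf_bound = (2 + 2 * real CARD('p) * C'_bound) / p"

definition linear_error :: "real \<Rightarrow> real \<Rightarrow> real \<Rightarrow> real" where
  "linear_error \<kappa> \<eta> \<rho> =
     (real CARD('p) + 2 + 3 * real CARD('p) * C'_bound) * \<eta> + real CARD('p) * (2 * \<kappa> + 2 * \<eta>) * \<rho>"

lemma norm_C'_le: "u \<in> unit_cube \<Longrightarrow> norm (C' u) \<le> C'_bound"
  unfolding C'_bound_def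
  by (intro cSUP_upper bounded_imp_bdd_above compact_imp_bounded compact_continuous_image
      continuous_on_norm C'_cont compact_unit_cube)

lemma abs_dC_le: "u \<in> unit_cube \<Longrightarrow> \<bar>dC u k\<bar> \<le> C'_bound"
  using norm_blinfun[of "C' u" "axis k 1"] norm_C'_le[of u] by (simp add: norm_axis_1)

lemma C'_bound_nonneg: "0 \<le> C'_bound"
  using norm_C'_le[OF one_in_unit_cube] norm_ge_zero order_trans by blast

lemma Cinf_bound_pos: "0 < Cinf_bound"
  unfolding Cinf_bound_def using C'_bound_nonneg p_pos by (intro divide_pos_pos add_pos_nonneg) auto

lemma abs_Cinf_le:
  assumes u: "u \<in> unit_cube" and f: "\<And>v. v \<in> unit_cube \<Longrightarrow> \<bar>f v\<bar> \<le> a"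
  shows "\<bar>Cinf p C dC f u\<bar> \<le> Cinf_bound * a"
proof -
  note u01 = unit_cube_component[OF u] and f1 = f[OF one_in_unit_cube]
  have "\<bar>dC u k * (f (edge k (u $ k)) - u $ k * f 1)\<bar> \<le> C'_bound * (2 * a)" for k
  proof -
    have "\<bar>f (edge k (u $ k)) - u $ k * f 1\<bar> \<le> 2 * a"
      using f[OF edge_in_unit_cube[of "u $ k" k]] abs_mult_le_of_unit[OF u01[of k] f1] u01[of k] by linarith
    then show ?thesis unfolding abs_mult using abs_dC_le[OF u] C'_bound_nonneg by (intro mult_mono) auto
  qed
  then have "\<bar>\<Sum>k\<in>UNIV. dC u k * (f (edge k (u $ k)) - u $ k * f 1)\<bar> \<le> (\<Sum>k\<in>(UNIV::'p set). C'_bound * (2 * a))"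
    by (intro order_trans[OF sum_abs] sum_mono)
  moreover have "\<bar>C u * f 1\<bar> \<le> a" using C_01[of u] f1 by (intro abs_mult_le_of_unit) auto
  ultimately have "\<bar>p * Cinf p C dC f u\<bar> \<le> a + real CARD('p) * (C'_bound * (2 * a)) + a"
    using f[OF u] p_pos by (simp add: mult_Cinf)
  then have "p * \<bar>Cinf p C dC f u\<bar> \<le> (2 + 2 * real CARD('p) * C'_bound) * a"
    using p_pos by (simp add: abs_mult algebra_simps)
  then show ?thesis using p_pos by (simp add: Cinf_bound_def field_simps)
qed

end

locale copula_fluctuation = copula_model F p C C'
  for F :: "'p::finite \<Rightarrow> real \<Rightarrow> real" and p and C :: "real^'p \<Rightarrow> real" and C' +
  fixes n :: nat and s :: "nat \<Rightarrow> (real^'p) \<times> (real^'q)" and A :: "(real^'q) set"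
    and G :: "real^'p \<Rightarrow> real" and \<kappa> \<eta> \<delta> :: real
  assumes G_eq: "\<And>u. G u = sqrt (real n) * (emp_D F n s A u - p * C u)"
    and F_pos: "\<And>i k. i < n \<Longrightarrow> snd (s i) \<in> A \<Longrightarrow> 0 < F k (fst (s i) $ k)"
    and G_le: "\<And>u. u \<in> unit_cube \<Longrightarrow> \<bar>G u\<bar> \<le> \<kappa>"
    and G_osc: "oscillation_le \<delta> \<eta> G"
    and n_pos: "0 < n" and \<eta>_pos: "0 < \<eta>" and \<delta>_pos: "0 < \<delta>"
    and n_large: "2 * \<kappa> \<le> sqrt (real n) * p" "2 * \<kappa> + 2 * \<eta> \<le> \<delta> * (sqrt (real n) * p)"
begin

abbreviation r :: real where "r \<equiv> sqrt (real n)"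
abbreviation q :: real where "q \<equiv> emp_pA n s A"
abbreviation D\<^sub>n :: "real^'p \<Rightarrow> real" where "D\<^sub>n \<equiv> emp_D F n s A"
abbreviation v :: "real^'p \<Rightarrow> real^'p" where "v \<equiv> quantile_point F n s A"

lemma r_pos: "0 < r"
  using n_pos by simp

lemma emp_D_eq: "D\<^sub>n u = p * C u + G u / r"
  using n_pos by (simp add: G_eq)

lemma emp_pA_eq: "q = p + G 1 / r"
  using emp_D_eq[of 1] emp_D_one[of F n s A] F_01 C_edge[of 1] by (simp add: edge_one)

lemma emp_pA_ge: "p / 2 \<le> q"
proof -
  have "\<bar>G 1\<bar> \<le> p / 2 * r" using G_le[OF one_in_unit_cube] n_large(1) by (simp add: mult.commute)
  then have "\<bar>G 1 / r\<bar> \<le> p / 2" using r_pos by (simp add: abs_divide divide_le_eq)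
  then show ?thesis unfolding emp_pA_eq by linarith
qed

lemma emp_pA_pos: "0 < q"
  using emp_pA_ge p_pos by linarith

lemmas sandwich_assms = F_01 F_mono emp_pA_pos F_pos

lemma quantile_point_cube: "u \<in> unit_cube \<Longrightarrow> v u \<in> unit_cube"
  using quantile_point_in_unit_cube[OF sandwich_assms] by blast

lemma G_close:
  assumes "u \<in> unit_cube" "w \<in> unit_cube" "\<And>k. \<bar>u $ k - w $ k\<bar> \<le> \<delta>"
  shows "\<bar>G u - G w\<bar> \<le> \<eta>"
  using oscillation_leD[OF G_osc assms] by (simp add: dist_real_def)

definition below :: "real^'p \<Rightarrow> real^'p" where
  "below u = (\<chi> k. max 0 (v u $ k - min \<delta> (\<eta> / r)))"

lemma below_bounds:
  assumes "u \<in> unit_cube"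
  shows "below u \<in> unit_cube" "below u \<le> v u" "\<And>k. v u $ k - below u $ k \<le> min \<delta> (\<eta> / r)"
    "\<And>k. below u $ k < v u $ k \<or> below u $ k = 0"
proof -
  have "0 < min \<delta> (\<eta> / r)" using \<delta>_pos \<eta>_pos r_pos by simp
  then have "0 \<le> below u $ k" "below u $ k \<le> v u $ k" "v u $ k - below u $ k \<le> min \<delta> (\<eta> / r)"
    "below u $ k < v u $ k \<or> below u $ k = 0" for k
    using unit_cube_component[OF quantile_point_cube[OF assms], of k] unfolding below_def vec_lambda_beta
    by linarith+
  moreover from this have "below u $ k \<le> 1" for k
    using unit_cube_component(2)[OF quantile_point_cube[OF assms]] order_trans by blast
  ultimately show "below u \<in> unit_cube" "below u \<le> v u" "\<And>k. v u $ k - below u $ k \<le> min \<delta> (\<eta> / r)"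
    "\<And>k. below u $ k < v u $ k \<or> below u $ k = 0"
    by (auto simp: unit_cube_def less_eq_vec_def)
qed

lemma G_edge_close:
  assumes "u \<in> unit_cube" "w \<in> unit_cube" "\<bar>u $ k - w $ k\<bar> \<le> \<delta>"
  shows "\<bar>G (edge k (u $ k)) - G (edge k (w $ k))\<bar> \<le> \<eta>"
  using assms unit_cube_component \<delta>_pos by (intro G_close edge_in_unit_cube) (auto simp: edge_component)

lemma emp_D_edge_eq:
  "w \<in> unit_cube \<Longrightarrow> D\<^sub>n (edge k (w $ k)) = p * w $ k + G (edge k (w $ k)) / r"
  by (simp add: emp_D_eq C_edge unit_cube_def)

lemma quantile_point_expansion:
  assumes u: "u \<in> unit_cube"
  shows "0 \<le> r * p * (v u $ k - u $ k) - (u $ k * G 1 - G (edge k (v u $ k)))"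
    and "r * p * (v u $ k - u $ k) - (u $ k * G 1 - G (edge k (v u $ k))) \<le> 2 * \<eta>"
proof -
  note vu = quantile_point_cube[OF u] and bu = below_bounds[OF u]
  have "u $ k * q \<le> D\<^sub>n (edge k (v u $ k))"
    by (rule emp_D_edge_quantile_ge[OF sandwich_assms u])
  then have "r * (u $ k * (p + G 1 / r)) \<le> r * (p * v u $ k + G (edge k (v u $ k)) / r)"
    unfolding emp_D_edge_eq[OF vu] emp_pA_eq using r_pos by (intro mult_left_mono) auto
  then show "0 \<le> r * p * (v u $ k - u $ k) - (u $ k * G 1 - G (edge k (v u $ k)))"
    using r_pos by (simp add: algebra_simps)
  have "D\<^sub>n (edge k (below u $ k)) \<le> u $ k * q"
    by (rule emp_D_edge_below_quantile_le[OF sandwich_assms u bu(4) unit_cube_component(1)[OF bu(1)]])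
  then have "r * (p * below u $ k + G (edge k (below u $ k)) / r) \<le> r * (u $ k * (p + G 1 / r))"
    unfolding emp_D_edge_eq[OF bu(1)] emp_pA_eq using r_pos by (intro mult_left_mono) auto
  then have "r * p * below u $ k + G (edge k (below u $ k)) \<le> r * p * u $ k + u $ k * G 1"
    using r_pos by (simp add: algebra_simps)
  moreover have "r * p * (v u $ k - below u $ k) \<le> \<eta>"
  proof -
    have "p * (r * (v u $ k - below u $ k)) \<le> 1 * (r * (\<eta> / r))"
      using p_pos p_le_1 r_pos bu(2) bu(3)[of k] by (intro mult_mono) (auto simp: less_eq_vec_def)
    then show ?thesis using r_pos by (simp add: mult.assoc mult.left_commute)
  qed
  moreover have "\<bar>G (edge k (v u $ k)) - G (edge k (below u $ k))\<bar> \<le> \<eta>"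
    using bu(2) bu(3)[of k] by (intro G_edge_close vu bu) (auto simp: less_eq_vec_def)
  ultimately show "r * p * (v u $ k - u $ k) - (u $ k * G 1 - G (edge k (v u $ k))) \<le> 2 * \<eta>"
    unfolding right_diff_distrib by linarith
qed

lemma quantile_point_diff_le:
  assumes u: "u \<in> unit_cube"
  shows "\<bar>r * p * (v u $ k - u $ k)\<bar> \<le> 2 * \<kappa> + 2 * \<eta>" and "\<bar>v u $ k - u $ k\<bar> \<le> \<delta>"
proof -
  have "\<bar>u $ k * G 1\<bar> \<le> \<kappa>"
    using unit_cube_component[OF u] G_le[OF one_in_unit_cube] by (rule abs_mult_le_of_unit)
  moreover have "\<bar>G (edge k (v u $ k))\<bar> \<le> \<kappa>"
    using unit_cube_component[OF quantile_point_cube[OF u]] by (intro G_le edge_in_unit_cube)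
  ultimately show bound: "\<bar>r * p * (v u $ k - u $ k)\<bar> \<le> 2 * \<kappa> + 2 * \<eta>"
    using quantile_point_expansion[OF u, of k] by linarith
  have "r * p * \<bar>v u $ k - u $ k\<bar> \<le> 2 * \<kappa> + 2 * \<eta>"
    using bound r_pos p_pos by (simp add: abs_mult)
  also have "\<dots> \<le> r * p * \<delta>" using n_large(2) by (simp add: mult.commute)
  finally show "\<bar>v u $ k - u $ k\<bar> \<le> \<delta>"
    by (rule mult_left_le_imp_le) (simp add: n_pos p_pos)
qed

lemma quantile_point_residual_le:
  assumes u: "u \<in> unit_cube"
  shows "\<bar>r * p * (v u $ k - u $ k) - (u $ k * G 1 - G (edge k (u $ k)))\<bar> \<le> 3 * \<eta>"
  using quantile_point_expansion[OF u, of k] \<eta>_pos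
    G_edge_close[OF quantile_point_cube[OF u] u quantile_point_diff_le(2)[OF u], of k]
  by linarith

lemma emp_copula_residual_le:
  assumes u: "u \<in> unit_cube"
  shows "\<bar>r * (emp_copula n s A u * q - D\<^sub>n (v u))\<bar> \<le> (real CARD('p) + 1) * \<eta>"
proof -
  note vu = quantile_point_cube[OF u] and bu = below_bounds[OF u]
  have "D\<^sub>n (below u) \<le> emp_copula n s A u * q"
    by (rule emp_D_below_quantile_le_emp_copula[OF sandwich_assms u bu(4)])
  then have "\<bar>emp_copula n s A u * q - D\<^sub>n (v u)\<bar> \<le> D\<^sub>n (v u) - D\<^sub>n (below u)"
    using emp_copula_le_emp_D_quantile[OF sandwich_assms u] by simp
  also have "\<dots> = (p * C (v u) - p * C (below u)) + (G (v u) - G (below u)) / r"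
    unfolding emp_D_eq by (simp add: diff_divide_distrib)
  also have "\<dots> \<le> real CARD('p) * (\<eta> / r) + \<eta> / r"
  proof (intro add_mono divide_right_mono)
    show "p * C (v u) - p * C (below u) \<le> real CARD('p) * (\<eta> / r)"
      using bu(3) by (intro l1_growth_le[OF l1_growth_C bu(1) vu bu(2)]) simp
    have "\<bar>G (v u) - G (below u)\<bar> \<le> \<eta>"
      using bu(2,3) by (intro G_close vu bu) (auto simp: less_eq_vec_def)
    then show "G (v u) - G (below u) \<le> \<eta>" by simp
  qed (use r_pos in simp)
  finally have "r * \<bar>emp_copula n s A u * q - D\<^sub>n (v u)\<bar> \<le> r * (real CARD('p) * (\<eta> / r) + \<eta> / r)"
    using r_pos by (intro mult_left_mono) auto
  then show ?thesis using r_pos by (simp add: abs_mult distrib_left distrib_right)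
qed

lemma Taylor_residual_le:
  assumes u: "u \<in> unit_cube" and C': "oscillation_le \<delta> \<rho> C'"
  shows "\<bar>r * p * (C (v u) - C u - (\<Sum>k\<in>UNIV. (v u $ k - u $ k) * dC u k))\<bar> \<le> real CARD('p) * (2 * \<kappa> + 2 * \<eta>) * \<rho>"
proof -
  have \<rho>: "0 \<le> \<rho>" using oscillation_leD[OF C' u u] \<delta>_pos by simp
  have "r * p * \<bar>C (v u) - C u - (\<Sum>k\<in>UNIV. (v u $ k - u $ k) * dC u k)\<bar>
      \<le> r * p * ((\<Sum>k\<in>UNIV. \<bar>v u $ k - u $ k\<bar>) * \<rho>)"
    using r_pos p_pos
    by (intro mult_left_mono Taylor_remainder_le[OF C_deriv C' u quantile_point_cube[OF u] quantile_point_diff_le(2)[OF u]]) auto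
  also have "\<dots> = (\<Sum>k\<in>UNIV. \<bar>r * p * (v u $ k - u $ k)\<bar>) * \<rho>"
    using r_pos p_pos by (simp add: sum_distrib_left abs_mult mult.assoc)
  also have "\<dots> \<le> (\<Sum>k\<in>(UNIV::'p set). 2 * \<kappa> + 2 * \<eta>) * \<rho>"
    by (intro mult_right_mono sum_mono quantile_point_diff_le u \<rho>)
  finally show ?thesis using r_pos p_pos by (simp add: abs_mult)
qed

lemma emp_copula_decomposition:
  "r * (emp_copula n s A u - C u) * q - p * Cinf p C dC G u =
    r * (emp_copula n s A u * q - D\<^sub>n (v u)) + (G (v u) - G u)
    + (\<Sum>k\<in>UNIV. (r * p * (v u $ k - u $ k) - (u $ k * G 1 - G (edge k (u $ k)))) * dC u k)
    + r * p * (C (v u) - C u - (\<Sum>k\<in>UNIV. (v u $ k - u $ k) * dC u k))"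
proof -
  have "(\<Sum>k\<in>UNIV. (r * p * (v u $ k - u $ k) - (u $ k * G 1 - G (edge k (u $ k)))) * dC u k)
      = r * p * (\<Sum>k\<in>UNIV. (v u $ k - u $ k) * dC u k)
        + (\<Sum>k\<in>UNIV. dC u k * (G (edge k (u $ k)) - u $ k * G 1))"
    by (simp add: sum_distrib_left sum.distrib[symmetric] algebra_simps)
  moreover have "r * D\<^sub>n (v u) = r * p * C (v u) + G (v u)"
    unfolding emp_D_eq using r_pos by (simp add: distrib_left)
  moreover have "r * (emp_copula n s A u - C u) * q = r * (emp_copula n s A u * q) - C u * (r * q)"
    by (simp add: algebra_simps)
  moreover have "r * q = r * p + G 1"
    unfolding emp_pA_eq using r_pos by (simp add: distrib_left)
  moreover have "p * Cinf p C dC G u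
      = G u - (\<Sum>k\<in>UNIV. dC u k * (G (edge k (u $ k)) - u $ k * G 1)) - C u * G 1"
    using p_pos by (intro mult_Cinf) simp
  ultimately show ?thesis by (simp add: algebra_simps)
qed

lemma emp_copula_linear_error_le:
  assumes u: "u \<in> unit_cube" and C': "oscillation_le \<delta> \<rho> C'"
  shows "\<bar>r * (emp_copula n s A u - C u) * q - p * Cinf p C dC G u\<bar> \<le> linear_error \<kappa> \<eta> \<rho>"
proof -
  let ?e = "\<lambda>k. r * p * (v u $ k - u $ k) - (u $ k * G 1 - G (edge k (u $ k)))"
  have "\<bar>\<Sum>k\<in>UNIV. ?e k * dC u k\<bar> \<le> (\<Sum>k\<in>(UNIV::'p set). (3 * \<eta>) * C'_bound)"
    using quantile_point_residual_le[OF u] abs_dC_le[OF u] \<eta>_pos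
    by (intro order_trans[OF sum_abs] sum_mono) (auto simp: abs_mult intro!: mult_mono)
  then have "\<bar>\<Sum>k\<in>UNIV. ?e k * dC u k\<bar> \<le> real CARD('p) * (3 * \<eta> * C'_bound)" by simp
  moreover have "\<bar>G (v u) - G u\<bar> \<le> \<eta>"
    by (rule G_close[OF quantile_point_cube[OF u] u quantile_point_diff_le(2)[OF u]])
  ultimately have "\<bar>r * (emp_copula n s A u - C u) * q - p * Cinf p C dC G u\<bar>
      \<le> (real CARD('p) + 1) * \<eta> + \<eta> + real CARD('p) * (3 * \<eta> * C'_bound) + real CARD('p) * (2 * \<kappa> + 2 * \<eta>) * \<rho>"
    unfolding emp_copula_decomposition
    using emp_copula_residual_le[OF u] Taylor_residual_le[OF u C'] by linarith
  then show ?thesis by (simp add: linear_error_def algebra_simps)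
qed

lemma emp_copula_linearization:
  assumes u: "u \<in> unit_cube" and C': "oscillation_le \<delta> \<rho> C'"
  shows "\<bar>r * (emp_copula n s A u - C u) - Cinf p C dC G u\<bar>
    \<le> 2 / p * linear_error \<kappa> \<eta> \<rho> + 2 * \<kappa> / (r * p) * (Cinf_bound * \<kappa>)"
proof -
  have \<kappa>_nonneg: "0 \<le> \<kappa>" using G_le[OF one_in_unit_cube] by linarith
  let ?L = "Cinf p C dC G u" and ?err = "r * (emp_copula n s A u - C u) * q - p * Cinf p C dC G u"
  have "r * (emp_copula n s A u - C u) - ?L = ?err / q + ?L * (p - q) / q"
    using emp_pA_pos by (simp add: field_simps)
  also have "\<bar>\<dots>\<bar> \<le> \<bar>?err\<bar> / q + \<bar>?L\<bar> * \<bar>p - q\<bar> / q"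
    using emp_pA_pos by (intro order_trans[OF abs_triangle_ineq]) (simp add: abs_mult)
  also have "\<dots> \<le> linear_error \<kappa> \<eta> \<rho> / (p / 2) + Cinf_bound * \<kappa> * (\<kappa> / r) / (p / 2)"
  proof (intro add_mono frac_le mult_mono mult_nonneg_nonneg)
    show "\<bar>p - q\<bar> \<le> \<kappa> / r"
      unfolding emp_pA_eq using r_pos G_le[OF one_in_unit_cube] by (simp add: divide_right_mono)
    show "\<bar>?L\<bar> \<le> Cinf_bound * \<kappa>" by (rule abs_Cinf_le[OF u G_le])
    show "\<bar>?err\<bar> \<le> linear_error \<kappa> \<eta> \<rho>" by (rule emp_copula_linear_error_le[OF u C'])
    then show "0 \<le> linear_error \<kappa> \<eta> \<rho>" by linarith
  qed (use p_pos emp_pA_ge Cinf_bound_pos r_pos \<kappa>_nonneg in auto)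
  also have "\<dots> = 2 / p * linear_error \<kappa> \<eta> \<rho> + 2 * \<kappa> / (r * p) * (Cinf_bound * \<kappa>)"
    using p_pos r_pos by (simp add: field_simps)
  finally show ?thesis .
qed

end

section \<open>The sample conditional on the covariate\<close>

context real_distribution
begin

lemma cdf_sublevel_set:
  assumes cont: "continuous_on UNIV (cdf M)" and a: "a < 1" and nonempty: "{t. cdf M t \<le> a} \<noteq> {}"
  obtains s where "{t. cdf M t \<le> a} = {..s}" "cdf M s = a"
proof -
  have "eventually (\<lambda>t. a < cdf M t) at_top"
    using cdf_lim_at_top_prob a by (rule order_tendstoD)
  from eventually_happens[OF this] obtain T where T: "a < cdf M T" by auto
  have less_T: "t < T" if "cdf M t \<le> a" for t
    using that T cdf_nondecreasing[of T t] by (meson not_le order_trans)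
  then have bdd: "bdd_above {t. cdf M t \<le> a}" by (intro bdd_aboveI[of _ T]) (auto intro: less_imp_le)
  define s where "s = Sup {t. cdf M t \<le> a}"
  have "closed {t. cdf M t \<le> a}" using cont by (intro closed_Collect_le) auto
  then have s: "cdf M s \<le> a" using closed_contains_Sup[OF nonempty bdd] by (simp add: s_def)
  have le_s: "t \<le> s" if "cdf M t \<le> a" for t
    unfolding s_def using that bdd by (intro cSup_upper) auto
  obtain x where "s \<le> x" "cdf M x = a"
    using IVT'[of "cdf M" s a T] s T less_T[OF s] continuous_on_subset[OF cont] by (metis less_imp_le subset_UNIV)
  then have "cdf M s = a" using le_s[of x] by simp
  moreover have "{t. cdf M t \<le> a} = {..s}"
    using le_s s cdf_nondecreasing order_trans by blast
  ultimately show thesis by (intro that)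
qed

lemma prob_cdf_le:
  assumes cont: "continuous_on UNIV (cdf M)" and a: "0 \<le> a" "a \<le> 1"
  shows "prob {t. cdf M t \<le> a} = a"
proof -
  consider "a = 1" | "{t. cdf M t \<le> a} = {}" | "a < 1" "{t. cdf M t \<le> a} \<noteq> {}"
    using a by linarith
  then show ?thesis
  proof cases
    case 1
    then have "{t. cdf M t \<le> a} = space M" using cdf_bounded_prob by simp
    then show ?thesis using prob_space 1 by simp
  next
    case 2
    have "a = 0"
    proof (rule ccontr)
      assume "a \<noteq> 0"
      then have "eventually (\<lambda>t. cdf M t < a) at_bot"
        using a cdf_lim_at_bot by (intro order_tendstoD(2)[where y = 0]) auto
      from eventually_happens[OF this] show False using 2 less_imp_le by auto
    qed
    then show ?thesis using 2 by simp
  next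
    case 3
    obtain s where "{t. cdf M t \<le> a} = {..s}" "cdf M s = a"
      using cdf_sublevel_set[OF cont 3] .
    then show ?thesis by (simp add: cdf_def)
  qed
qed

end

lemma borel_measurable_vec_component [measurable (raw)]:
  fixes f :: "'a \<Rightarrow> real^'p"
  assumes "f \<in> borel_measurable M" shows "(\<lambda>x. f x $ k) \<in> borel_measurable M"
  by (rule measurable_compose[OF assms]) (intro borel_measurable_continuous_onI continuous_intros)

locale copula_sample = iid_bootstrap P borel "\<lambda>i \<omega>. (X i \<omega>, Z i \<omega>)" J
  for P :: "'a measure" and X :: "nat \<Rightarrow> 'a \<Rightarrow> real^'p" and Z :: "nat \<Rightarrow> 'a \<Rightarrow> real^'q" and J +
  fixes A :: "(real^'q) set" and C' :: "real^'p \<Rightarrow> (real^'p) \<Rightarrow>\<^sub>L real"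
  assumes A_borel [measurable]: "A \<in> sets borel" and pA_pos: "0 < pA P (Z 0) A"
    and margins_cont: "\<And>k. continuous_on UNIV (condF P (X 0) (Z 0) A k)"
    and condC_deriv: "\<And>u. u \<in> unit_cube \<Longrightarrow>
          (condC P (X 0) (Z 0) A has_derivative blinfun_apply (C' u)) (at u within unit_cube)"
    and continuous_C': "continuous_on unit_cube C'"
begin

abbreviation F :: "'p \<Rightarrow> real \<Rightarrow> real" where "F \<equiv> condF P (X 0) (Z 0) A"
abbreviation p :: real where "p \<equiv> pA P (Z 0) A"
abbreviation C :: "real^'p \<Rightarrow> real" where "C \<equiv> condC P (X 0) (Z 0) A"

lemma measurable_X [measurable]: "X i \<in> borel_measurable P"
  using measurable_compose[OF measurable_obs, of fst borel]
  by (simp add: borel_measurable_continuous_onI continuous_on_fst continuous_on_id)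

lemma measurable_Z [measurable]: "Z i \<in> borel_measurable P"
  using measurable_compose[OF measurable_obs, of snd borel]
  by (simp add: borel_measurable_continuous_onI continuous_on_snd continuous_on_id)

definition margin :: "'p \<Rightarrow> real measure" where
  "margin k = distr (uniform_measure P {\<omega>\<in>space P. Z 0 \<omega> \<in> A}) borel (\<lambda>\<omega>. X 0 \<omega> $ k)"

lemma real_distribution_margin: "real_distribution (margin k)"
proof -
  have "prob_space (uniform_measure P {\<omega>\<in>space P. Z 0 \<omega> \<in> A})"
    using pA_pos by (intro prob_space_uniform_measure) (auto simp: pA_def emeasure_eq_measure)
  then have "prob_space (margin k)"
    unfolding margin_def by (rule prob_space.prob_space_distr) simp
  then show ?thesis
    by (simp add: real_distribution_def real_distribution_axioms_def margin_def)
qed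

lemma measure_margin:
  assumes [measurable]: "B \<in> sets borel"
  shows "measure (margin k) B = prob {\<omega>\<in>space P. X 0 \<omega> $ k \<in> B \<and> Z 0 \<omega> \<in> A} / p"
proof -
  have "measure (margin k) B
      = prob ({\<omega>\<in>space P. Z 0 \<omega> \<in> A} \<inter> ((\<lambda>\<omega>. X 0 \<omega> $ k) -` B \<inter> space P)) / prob {\<omega>\<in>space P. Z 0 \<omega> \<in> A}"
    unfolding margin_def using pA_pos
    by (subst measure_distr) (auto simp: pA_def emeasure_eq_measure intro!: measure_uniform_measure measurable_sets)
  moreover have "{\<omega>\<in>space P. Z 0 \<omega> \<in> A} \<inter> ((\<lambda>\<omega>. X 0 \<omega> $ k) -` B \<inter> space P)
      = {\<omega>\<in>space P. X 0 \<omega> $ k \<in> B \<and> Z 0 \<omega> \<in> A}" by auto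
  ultimately show ?thesis by (simp add: pA_def)
qed

lemma F_eq_cdf_margin: "F k = cdf (margin k)"
  by (simp add: fun_eq_iff cdf_def measure_margin condF_def)

lemma F_01: "0 \<le> F k t \<and> F k t \<le> 1"
  unfolding F_eq_cdf_margin
  using real_distribution.cdf_bounded_prob[OF real_distribution_margin] by (simp add: cdf_def)

lemma F_le_1: "F k t \<le> 1"
  using F_01 by blast

lemma F_mono: "mono (F k)"
  unfolding F_eq_cdf_margin
  by (intro monoI finite_borel_measure.cdf_nondecreasing real_distribution.finite_borel_measure_M real_distribution_margin)

lemma measurable_F [measurable]: "F k \<in> borel_measurable borel"
  by (rule borel_measurable_continuous_onI[OF margins_cont])

lemma measurable_orthant [measurable]: "orthant F A u \<in> borel_measurable borel"
proof -
  have [measurable]: "fst \<in> borel_measurable (borel :: ((real^'p) \<times> (real^'q)) measure)"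
    "snd \<in> borel_measurable (borel :: ((real^'p) \<times> (real^'q)) measure)"
    by (intro borel_measurable_continuous_onI continuous_intros)+
  show ?thesis unfolding orthant_def by measurable
qed

lemma integrable_orthant: "integrable P (\<lambda>\<omega>. orthant F A u (X i \<omega>, Z i \<omega>))"
  by (rule integrable_obs[OF measurable_orthant abs_orthant_le])

lemma emean_orthant: "emean (orthant F A u) = p * C u"
proof -
  have "emean (orthant F A u) = expectation (indicator {\<omega>\<in>space P. (\<forall>k. F k (X 0 \<omega> $ k) \<le> u $ k) \<and> Z 0 \<omega> \<in> A})"
    unfolding emean_def by (intro Bochner_Integration.integral_cong) (auto simp: orthant_def indicator_def)
  also have "\<dots> = condD P (X 0) (Z 0) A u" by (simp add: condD_def Int_absorb1)
  finally show ?thesis using pA_pos by (simp add: condC_def)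
qed

lemma C_01: "0 \<le> C u \<and> C u \<le> 1"
proof -
  have "condD P (X 0) (Z 0) A u \<le> p" unfolding condD_def pA_def by (intro finite_measure_mono) auto
  then show ?thesis using pA_pos by (simp add: condC_def condD_def divide_le_eq)
qed

lemma C_edge:
  assumes "0 \<le> t" "t \<le> 1" shows "C (edge k t) = t"
proof -
  have "(\<forall>j. F j (x $ j) \<le> edge k t $ j) \<longleftrightarrow> F k (x $ k) \<le> t" for x :: "real^'p"
    using F_le_1 by (auto simp: edge_component)
  then have "C (edge k t) = measure (margin k) {s. F k s \<le> t}"
    by (simp add: condC_def condD_def measure_margin)
  also have "\<dots> = t"
    unfolding F_eq_cdf_margin using margins_cont[of k] assms
    by (intro real_distribution.prob_cdf_le[OF real_distribution_margin]) (simp_all add: F_eq_cdf_margin)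
  finally show ?thesis .
qed

lemma p_le_1: "p \<le> 1"
  by (simp add: pA_def)

lemma l1_growth_D: "l1_growth (\<lambda>u. p * C u)"
  unfolding l1_growth_def
proof (intro ballI impI)
  fix u v :: "real^'p" assume u: "u \<in> unit_cube" and v: "v \<in> unit_cube" and uv: "u \<le> v"
  let ?o = "\<lambda>u. orthant F A u" and ?s = "\<lambda>\<omega>. (X 0 \<omega>, Z 0 \<omega>)"
  have "p * C v - p * C u = expectation (\<lambda>\<omega>. ?o v (?s \<omega>) - ?o u (?s \<omega>))"
    using integrable_orthant by (simp add: emean_orthant[symmetric] emean_def)
  also have "\<dots> \<le> expectation (\<lambda>\<omega>. \<Sum>k\<in>UNIV. ?o (edge k (v $ k)) (?s \<omega>) - ?o (edge k (u $ k)) (?s \<omega>))"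
    using integrable_orthant orthant_diff_le_sum_edge[OF F_le_1 uv]
    by (intro integral_mono Bochner_Integration.integrable_sum Bochner_Integration.integrable_diff) auto
  also have "\<dots> = (\<Sum>k\<in>UNIV. p * C (edge k (v $ k)) - p * C (edge k (u $ k)))"
    using integrable_orthant by (simp add: Bochner_Integration.integral_sum emean_orthant[symmetric] emean_def)
  also have "\<dots> \<le> (\<Sum>k\<in>UNIV. v $ k - u $ k)"
  proof (rule sum_mono)
    fix k
    have "p * (v $ k - u $ k) \<le> v $ k - u $ k"
      using mult_right_mono[OF p_le_1, of "v $ k - u $ k"] uv by (simp add: less_eq_vec_def)
    then show "p * C (edge k (v $ k)) - p * C (edge k (u $ k)) \<le> v $ k - u $ k"
      using u v by (simp add: C_edge unit_cube_def right_diff_distrib)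
  qed
  finally show "p * C v - p * C u \<le> (\<Sum>k\<in>UNIV. v $ k - u $ k)" .
qed

lemma AE_F_pos: "AE \<omega> in P. \<forall>i k. Z i \<omega> \<in> A \<longrightarrow> 0 < F k (X i \<omega> $ k)"
proof -
  have "AE \<omega> in P. Z i \<omega> \<in> A \<longrightarrow> 0 < F k (X i \<omega> $ k)" for i k
  proof -
    let ?f = "\<lambda>\<omega>. orthant F A (edge k 0) (X i \<omega>, Z i \<omega>)"
    have "expectation ?f = 0"
      using expectation_obs_eq[of "orthant F A (edge k 0)" i] emean_orthant[of "edge k 0"] C_edge[of 0 k]
      by (simp add: emean_def)
    moreover have "AE \<omega> in P. 0 \<le> ?f \<omega>" by (simp add: orthant_def)
    ultimately have "AE \<omega> in P. ?f \<omega> = 0"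
      using integral_nonneg_eq_0_iff_AE[OF integrable_orthant] by blast
    then show ?thesis
    proof eventually_elim
      case (elim \<omega>)
      then show ?case using F_01[of k "X i \<omega> $ k"] by (auto simp: orthant_edge[OF F_le_1])
    qed
  qed
  then have "AE \<omega> in P. \<forall>k\<in>UNIV. Z i \<omega> \<in> A \<longrightarrow> 0 < F k (X i \<omega> $ k)" for i
    by (subst AE_finite_all) auto
  then show ?thesis by (simp add: AE_all_countable)
qed

sublocale copula_model F p C C'
  by unfold_locales
    (use F_01 F_mono pA_pos p_le_1 C_01 C_edge l1_growth_D condC_deriv continuous_C' in auto)

definition cov :: "real^'p \<Rightarrow> real^'p \<Rightarrow> real" where
  "cov u v = p * C (\<chi> k. min (u $ k) (v $ k)) - p\<^sup>2 * C u * C v"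

lemma evar_orthant_sum:
  "evar (\<lambda>s. \<Sum>i\<in>I. c i * orthant F A (x i) s) = (\<Sum>i\<in>I. \<Sum>j\<in>I. c i * c j * cov (x i) (x j))"
proof -
  have mean: "emean (\<lambda>s. \<Sum>i\<in>I. c i * orthant F A (x i) s) = (\<Sum>i\<in>I. c i * (p * C (x i)))"
    using emean_sum[OF measurable_orthant abs_orthant_le] by (simp add: emean_orthant)
  have "emean (\<lambda>s. (\<Sum>i\<in>I. c i * orthant F A (x i) s)\<^sup>2)
      = emean (\<lambda>s. \<Sum>i\<in>I. \<Sum>j\<in>I. c i * c j * orthant F A (\<chi> k. min (x i $ k) (x j $ k)) s)"
    unfolding power2_eq_square sum_product orthant_mult[symmetric] by (simp add: mult_ac)
  also have "\<dots> = (\<Sum>i\<in>I. \<Sum>j\<in>I. c i * c j * (p * C (\<chi> k. min (x i $ k) (x j $ k))))"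
    using integrable_orthant unfolding emean_def
    by (simp add: Bochner_Integration.integral_sum emean_orthant[unfolded emean_def])
  finally show ?thesis
    unfolding evar_def mean unfolding power2_eq_square sum_product cov_def
    by (simp add: sum_subtractf[symmetric]) (simp add: algebra_simps)
qed

lemma cov_increment_le:
  assumes "u \<in> unit_cube" "grid_succ j k u \<in> unit_cube"
  shows "cov (grid_succ j k u) (grid_succ j k u) - 2 * cov (grid_succ j k u) u + cov u u \<le> 1 / 2 ^ j"
proof -
  let ?v = "grid_succ j k u"
  have min: "(\<chi> i. min (?v $ i) (u $ i)) = u" "(\<chi> i. min (w $ i) (w $ i)) = w" for w :: "real^'p"
    using le_grid_succ[of u j k] by (simp_all add: vec_eq_iff less_eq_vec_def)
  have "cov ?v ?v - 2 * cov ?v u + cov u u = (p * C ?v - p * C u) - (p * C ?v - p * C u)\<^sup>2"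
    unfolding cov_def min by (simp add: power2_eq_square algebra_simps)
  also have "\<dots> \<le> p * C ?v - p * C u" by simp
  finally show ?thesis using l1_growth_grid_succ[OF l1_growth_C assms] by linarith
qed

lemma continuous_on_C: "continuous_on unit_cube C"
  using C_deriv by (rule has_derivative_continuous_on)

lemma continuous_on_cov: "continuous_on (unit_cube \<times> unit_cube) (\<lambda>(u, v). cov u v)"
proof -
  have "continuous_on (unit_cube \<times> unit_cube) (\<lambda>x. C (\<chi> k. min (fst x $ k) (snd x $ k)))"
    by (rule continuous_on_compose2[OF continuous_on_C])
      (auto simp: unit_cube_def min_le_iff_disj intro!: continuous_on_vec_lambda continuous_intros)
  moreover have "continuous_on (unit_cube \<times> unit_cube) (\<lambda>x. C (fst x))"
    "continuous_on (unit_cube \<times> unit_cube) (\<lambda>x. C (snd x))"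
    by (auto intro!: continuous_on_compose2[OF continuous_on_C] continuous_intros)
  ultimately show ?thesis
    unfolding cov_def split_beta by (intro continuous_intros)
qed

end

section \<open>Asymptotic linearity of the copula process\<close>

lemma exists_pos_mult_le:
  assumes "0 < (\<epsilon>::real)" shows "\<exists>x>0. x \<le> \<epsilon> \<and> a * x \<le> \<epsilon>"
proof (intro exI conjI)
  have "0 < 1 + \<bar>a\<bar>" "1 \<le> 1 + \<bar>a\<bar>" "a \<le> 1 + \<bar>a\<bar>" by linarith+
  then show "0 < \<epsilon> / (1 + \<bar>a\<bar>)" "\<epsilon> / (1 + \<bar>a\<bar>) \<le> \<epsilon>" "a * (\<epsilon> / (1 + \<bar>a\<bar>)) \<le> \<epsilon>"
    using assms mult_left_mono[of a "1 + \<bar>a\<bar>" \<epsilon>] by (auto simp: field_simps)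
qed

lemma obtain_power_4_8:
  assumes "8 * 2 ^ l \<le> (n::nat)"
  obtains L where "l \<le> L" "4 * 2 ^ L \<le> n" "n < 8 * 2 ^ L"
proof -
  have "1 \<le> n div 4" using assms one_le_power[of "2::nat" l] by linarith
  then obtain L where "2 ^ L \<le> n div 4" "n div 4 < 2 ^ (L + 1)"
    using ex_power_ivl1[of 2 "n div 4"] by auto
  then have L: "4 * 2 ^ L \<le> n" "n < 8 * 2 ^ L" by auto
  then have "(2::nat) ^ l < 2 ^ L" using assms by linarith
  then have "l \<le> L" by simp
  with L show thesis by (intro that)
qed

context copula_sample
begin

abbreviation W :: "nat \<Rightarrow> nat \<Rightarrow> 'a \<Rightarrow> real^'p \<Rightarrow> real" where
  "W n m \<omega> u \<equiv> proc n m (orthant F A u) \<omega>"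

definition deviation :: "nat \<Rightarrow> nat \<Rightarrow> 'a \<Rightarrow> real^'p \<Rightarrow> real" where
  "deviation n m \<omega> u = sqrt (real n) * (emp_D F n (resample n m \<omega>) A u - p * C u)"

lemma deviation_eq_W: "deviation n m \<omega> u = (if m = 0 then W n 0 \<omega> u else W n 0 \<omega> u + W n m \<omega> u)"
proof -
  have "resample n 0 \<omega> = data \<omega>" by (simp add: resample_def fun_eq_iff)
  then show ?thesis
    by (simp add: deviation_def proc_def emp_D_def emean_orthant right_diff_distrib)
qed

lemma emean_orthant_increment_square_le:
  assumes "u \<in> unit_cube" "grid_succ j k u \<in> unit_cube"
  shows "emean (\<lambda>s. (orthant F A (grid_succ j k u) s - orthant F A u s)\<^sup>2) \<le> 1 / 2 ^ j"
proof -
  let ?y = "\<lambda>s. orthant F A (grid_succ j k u) s - orthant F A u s"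
  have "(?y s)\<^sup>2 = ?y s" for s
    using orthant_mono[OF le_grid_succ, of F A u s j k] orthant_cases[of F A u s]
      orthant_cases[of F A "grid_succ j k u" s] by auto
  then have "emean (\<lambda>s. (?y s)\<^sup>2) = p * C (grid_succ j k u) - p * C u"
    using integrable_orthant by (simp add: emean_orthant[symmetric] emean_def)
  also have "\<dots> \<le> 1 / 2 ^ j" by (rule l1_growth_grid_succ[OF l1_growth_C assms])
  finally show ?thesis .
qed

lemma nearly_surely_grid_increments_W:
  assumes n: "4 * 2 ^ j \<le> n"
  shows "nearly_surely (chain_prob CARD('p) j) (\<lambda>\<omega>. grid_increments_le j (chain_step CARD('p) j) (W n m \<omega>))"
proof (rule nearly_surely_grid_increments_le)
  fix u :: "real^'p" and k \<theta> assume grid: "u \<in> dyadic_grid j" "grid_succ j k u \<in> dyadic_grid j" and \<theta>: "\<theta>\<^sup>2 = (2::real) ^ j"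
  let ?y = "\<lambda>s. orthant F A (grid_succ j k u) s - orthant F A u s"
  have y: "\<bar>?y s\<bar> \<le> 1" for s
    using orthant_cases[of F A u s] orthant_cases[of F A "grid_succ j k u" s] by auto
  have "real (4 * 2 ^ j) \<le> real n" using n by (rule of_nat_mono)
  then have "(2 * \<bar>\<theta>\<bar>)\<^sup>2 \<le> real n" using \<theta> by (simp add: power_mult_distrib)
  then have \<theta>_le: "\<bar>\<theta>\<bar> \<le> sqrt (real n) / 2" using real_le_rsqrt by fastforce
  have "mgf_le \<theta> (exp (2 * \<theta>\<^sup>2 * emean (\<lambda>s. (?y s)\<^sup>2))) (proc n m ?y)"
    by (rule mgf_le_proc[OF _ y \<theta>_le]) measurable
  moreover have "exp (2 * \<theta>\<^sup>2 * emean (\<lambda>s. (?y s)\<^sup>2)) \<le> exp 2"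
    using emean_orthant_increment_square_le[OF grid[THEN dyadic_grid_in_unit_cube]]
    by (simp add: \<theta> field_simps)
  moreover have "proc n m ?y = (\<lambda>\<omega>. W n m \<omega> (grid_succ j k u) - W n m \<omega> u)"
    using proc_diff[OF measurable_orthant measurable_orthant abs_orthant_le abs_orthant_le] by auto
  ultimately show "mgf_le \<theta> (exp 2) (\<lambda>\<omega>. W n m \<omega> (grid_succ j k u) - W n m \<omega> u)"
    using mgf_le_mono by (simp only:)
qed measurable

lemma deviation_oscillation_le:
  assumes l: "l \<le> L"
    and W: "\<And>i j. i \<le> m \<Longrightarrow> l \<le> j \<Longrightarrow> j \<le> L \<Longrightarrow> grid_increments_le j (chain_step CARD('p) j) (W n i \<omega>)"
  shows "oscillation_le (1 / 2 ^ l)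
    (real CARD('p) * (10 * chain_tail CARD('p) l + 2 * sqrt (real n) / 2 ^ L)) (deviation n m \<omega>)"
proof (rule oscillation_le_chaining[OF mono_emp_D l1_growth_C _ l])
  show "deviation n m \<omega> = (\<lambda>u. sqrt (real n) * (emp_D F n (resample n m \<omega>) A u - p * C u))"
    by (simp add: fun_eq_iff deviation_def)
  show "grid_increments_le j (2 * chain_step CARD('p) j) (deviation n m \<omega>)" if "l \<le> j" "j \<le> L" for j
    unfolding grid_increments_le_def
  proof (intro ballI allI impI)
    fix u :: "real^'p" and k assume u: "u \<in> dyadic_grid j" "grid_succ j k u \<in> dyadic_grid j"
    have "\<bar>W n i \<omega> (grid_succ j k u) - W n i \<omega> u\<bar> \<le> chain_step CARD('p) j" if "i \<le> m" for i
      using W[OF that \<open>l \<le> j\<close> \<open>j \<le> L\<close>] u unfolding grid_increments_le_def by blast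
    from this[of 0] this[of m]
    show "\<bar>deviation n m \<omega> (grid_succ j k u) - deviation n m \<omega> u\<bar> \<le> 2 * chain_step CARD('p) j"
      unfolding deviation_eq_W using chain_step_nonneg[of "CARD('p)" j] by auto
  qed
qed simp

lemma nearly_surely_deviation_oscillation_le:
  assumes n: "8 * 2 ^ l \<le> n"
  shows "nearly_surely (real (Suc M) * (2 * chain_prob CARD('p) l))
    (\<lambda>\<omega>. \<forall>m\<le>M. oscillation_le (1 / 2 ^ l)
       (real CARD('p) * (10 * chain_tail CARD('p) l) + 16 * real CARD('p) / sqrt (real n)) (deviation n m \<omega>))"
proof -
  let ?d = "CARD('p)"
  obtain L where L: "l \<le> L" "4 * 2 ^ L \<le> n" "n < 8 * 2 ^ L"
    using obtain_power_4_8[OF n] .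
  have "4 * 2 ^ j \<le> n" if "j \<le> L" for j
    using power_increasing[OF that, of "2::nat"] L(2) by linarith
  then have "nearly_surely (\<Sum>m\<le>M. \<Sum>j=l..L. chain_prob ?d j)
      (\<lambda>\<omega>. \<forall>m\<in>{..M}. \<forall>j\<in>{l..L}. grid_increments_le j (chain_step ?d j) (W n m \<omega>))"
    by (intro nearly_surely_ball_finite nearly_surely_grid_increments_W) auto
  then show ?thesis
  proof (rule nearly_surely_mono)
    show "(\<Sum>m\<le>M. \<Sum>j=l..L. chain_prob ?d j) \<le> real (Suc M) * (2 * chain_prob ?d l)"
      using sum_chain_prob_le[of ?d l L] by (simp add: mult_left_mono)
    fix \<omega> assume W: "\<forall>m\<in>{..M}. \<forall>j\<in>{l..L}. grid_increments_le j (chain_step ?d j) (W n m \<omega>)"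
    have "0 < sqrt (real n)" using L(2) by (auto intro: gr0I)
    moreover have "real n < real (8 * 2 ^ L)" using L(3) by (simp only: of_nat_less_iff)
    then have "sqrt (real n) * sqrt (real n) \<le> 8 * 2 ^ L" by simp
    ultimately have mesh: "2 * sqrt (real n) / 2 ^ L \<le> 16 / sqrt (real n)" by (simp add: field_simps)
    have "real ?d * (2 * sqrt (real n) / 2 ^ L) \<le> real ?d * (16 / sqrt (real n))"
      by (rule mult_left_mono[OF mesh]) simp
    then have bound: "real ?d * (10 * chain_tail ?d l + 2 * sqrt (real n) / 2 ^ L)
        \<le> real ?d * (10 * chain_tail ?d l) + 16 * real ?d / sqrt (real n)"
      unfolding distrib_left times_divide_eq_right mult.commute[of 16] by (rule add_left_mono)
    then show "\<forall>m\<le>M. oscillation_le (1 / 2 ^ l)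
        (real ?d * (10 * chain_tail ?d l) + 16 * real ?d / sqrt (real n)) (deviation n m \<omega>)"
      using W by (auto intro!: oscillation_le_mono[OF deviation_oscillation_le[OF L(1)] bound])
  qed
qed

lemma eventually_deviation_oscillation_le:
  assumes \<epsilon>: "0 < \<epsilon>"
  shows "eventually (\<lambda>l. eventually (\<lambda>n.
    nearly_surely \<epsilon> (\<lambda>\<omega>. \<forall>m\<le>M. oscillation_le (1 / 2 ^ l) \<epsilon> (deviation n m \<omega>))) sequentially) sequentially"
proof -
  let ?d = "CARD('p)"
  have "(\<lambda>l. real ?d * (10 * chain_tail ?d l)) \<longlonglongrightarrow> real ?d * (10 * 0)"
    by (intro tendsto_intros chain_tail_tendsto_0)
  from order_tendstoD(2)[OF this, of "\<epsilon> / 2"] \<epsilon>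
  have "eventually (\<lambda>l. real ?d * (10 * chain_tail ?d l) < \<epsilon> / 2) sequentially" by simp
  moreover have "(\<lambda>l. real (Suc M) * (2 * chain_prob ?d l)) \<longlonglongrightarrow> real (Suc M) * (2 * 0)"
    by (intro tendsto_intros summable_LIMSEQ_zero[OF summable_chain_prob])
  from order_tendstoD(2)[OF this, of \<epsilon>] \<epsilon>
  have "eventually (\<lambda>l. real (Suc M) * (2 * chain_prob ?d l) < \<epsilon>) sequentially" by simp
  ultimately show ?thesis
  proof eventually_elim
    case l: (elim l)
    have "eventually (\<lambda>n. 16 * real ?d / sqrt (real n) < \<epsilon> / 2) sequentially"
      using \<epsilon> by (intro order_tendstoD(2)[OF tendsto_const_over_sqrt]) simp
    moreover have "eventually (\<lambda>n. 8 * 2 ^ l \<le> n) sequentially" by (rule eventually_ge_at_top)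
    ultimately show ?case
    proof eventually_elim
      case (elim n)
      have bound: "real ?d * (10 * chain_tail ?d l) + 16 * real ?d / sqrt (real n) \<le> \<epsilon>"
        using l(1) elim(1) by linarith
      show ?case
        by (rule nearly_surely_mono[OF nearly_surely_deviation_oscillation_le[OF elim(2)] less_imp_le[OF l(2)]])
          (use bound in \<open>auto intro: oscillation_le_mono\<close>)
    qed
  qed
qed

lemma nearly_surely_abs_W_le:
  assumes "0 < \<kappa>" shows "nearly_surely (moment_bound / \<kappa>\<^sup>2) (\<lambda>\<omega>. \<bar>W n m \<omega> u\<bar> \<le> \<kappa>)"
proof (rule nearly_surelyI)
  have "prob {\<omega>\<in>space P. \<not> \<bar>W n m \<omega> u\<bar> \<le> \<kappa>} \<le> prob {\<omega>\<in>space P. \<kappa>\<^sup>2 \<le> (W n m \<omega> u)\<^sup>2}"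
    using assms by (intro finite_measure_mono) (auto simp: abs_le_square_iff[symmetric])
  also have "\<dots> \<le> expectation (\<lambda>\<omega>. (W n m \<omega> u)\<^sup>2) / \<kappa>\<^sup>2"
    using proc_second_moment(1)[OF measurable_orthant abs_orthant_le] assms
    by (intro integral_Markov_inequality_measure[of _ _ "{}"]) auto
  also have "\<dots> \<le> moment_bound / \<kappa>\<^sup>2"
    using proc_second_moment(2)[OF measurable_orthant abs_orthant_le] by (intro divide_right_mono) auto
  finally show "prob {\<omega>\<in>space P. \<not> \<bar>W n m \<omega> u\<bar> \<le> \<kappa>} \<le> moment_bound / \<kappa>\<^sup>2" .
qed measurable

lemma nearly_surely_W_grid_le:
  assumes "0 < \<epsilon>"
  shows "\<exists>\<kappa>>0. \<forall>n. nearly_surely \<epsilon> (\<lambda>\<omega>. \<forall>m\<in>{..M}. \<forall>u\<in>dyadic_grid l. \<bar>W n m \<omega> u\<bar> \<le> \<kappa>)"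
proof -
  define a where "a = real (Suc M) * (real (card (dyadic_grid l :: (real^'p) set)) * moment_bound)"
  have a: "0 \<le> a" by (simp add: a_def moment_bound_def)
  let ?\<kappa> = "1 + a / \<epsilon>"
  have \<kappa>: "1 \<le> ?\<kappa>" using a assms by simp
  have "a \<le> \<epsilon> * ?\<kappa>" using assms by (simp add: distrib_left)
  also have "\<dots> \<le> \<epsilon> * ?\<kappa>\<^sup>2" using \<kappa> assms by (intro mult_left_mono self_le_power) auto
  finally have "a / ?\<kappa>\<^sup>2 \<le> \<epsilon>" using \<kappa> by (simp add: pos_divide_le_eq)
  then have sum_le: "(\<Sum>m\<in>{..M}. \<Sum>u\<in>(dyadic_grid l :: (real^'p) set). moment_bound / ?\<kappa>\<^sup>2) \<le> \<epsilon>"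
    by (simp add: a_def)
  have "nearly_surely (\<Sum>m\<in>{..M}. \<Sum>u\<in>(dyadic_grid l :: (real^'p) set). moment_bound / ?\<kappa>\<^sup>2)
      (\<lambda>\<omega>. \<forall>m\<in>{..M}. \<forall>u\<in>dyadic_grid l. \<bar>W n m \<omega> u\<bar> \<le> ?\<kappa>)" for n
    using \<kappa> by (intro nearly_surely_ball_finite nearly_surely_abs_W_le finite_dyadic_grid) auto
  from nearly_surely_mono[OF this sum_le]
  have "nearly_surely \<epsilon> (\<lambda>\<omega>. \<forall>m\<in>{..M}. \<forall>u\<in>dyadic_grid l. \<bar>W n m \<omega> u\<bar> \<le> ?\<kappa>)" for n .
  moreover have "0 < ?\<kappa>" using \<kappa> by linarith
  ultimately show ?thesis by blast
qed

lemma eventually_abs_deviation_le: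
  assumes \<epsilon>: "0 < \<epsilon>"
  shows "\<exists>\<kappa>>0. eventually (\<lambda>n.
    nearly_surely \<epsilon> (\<lambda>\<omega>. \<forall>m\<le>M. \<forall>u\<in>unit_cube. \<bar>deviation n m \<omega> u\<bar> \<le> \<kappa>)) sequentially"
proof -
  have \<epsilon>2: "0 < \<epsilon> / 2" using \<epsilon> by simp
  from eventually_happens[OF eventually_deviation_oscillation_le[OF \<epsilon>2]]
  obtain l where osc: "eventually (\<lambda>n. nearly_surely (\<epsilon> / 2)
      (\<lambda>\<omega>. \<forall>m\<le>M. oscillation_le (1 / 2 ^ l) (\<epsilon> / 2) (deviation n m \<omega>))) sequentially" by auto
  obtain \<kappa> where \<kappa>: "0 < \<kappa>"
    and W: "\<And>n. nearly_surely (\<epsilon> / 2) (\<lambda>\<omega>. \<forall>m\<in>{..M}. \<forall>u\<in>dyadic_grid l. \<bar>W n m \<omega> u\<bar> \<le> \<kappa>)"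
    using nearly_surely_W_grid_le[OF \<epsilon>2] by blast
  have "eventually (\<lambda>n. nearly_surely \<epsilon>
      (\<lambda>\<omega>. \<forall>m\<le>M. \<forall>u\<in>unit_cube. \<bar>deviation n m \<omega> u\<bar> \<le> 2 * \<kappa> + \<epsilon> / 2)) sequentially"
    using osc
  proof eventually_elim
    case (elim n)
    show ?case
    proof (rule nearly_surely_mono[OF nearly_surely_conj[OF elim W]])
      fix \<omega> assume good: "(\<forall>m\<le>M. oscillation_le (1 / 2 ^ l) (\<epsilon> / 2) (deviation n m \<omega>))
        \<and> (\<forall>m\<in>{..M}. \<forall>u\<in>dyadic_grid l. \<bar>W n m \<omega> u\<bar> \<le> \<kappa>)"
      have "\<bar>deviation n m \<omega> u\<bar> \<le> 2 * \<kappa> + \<epsilon> / 2" if "m \<le> M" "u \<in> unit_cube" for m u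
      proof -
        let ?v = "dyadic_floor l u"
        have v: "?v \<in> dyadic_grid l" using that by (intro dyadic_floor_in_grid)
        have "\<bar>deviation n m \<omega> u - deviation n m \<omega> ?v\<bar> \<le> \<epsilon> / 2"
          unfolding dist_real_def[symmetric] using good that
          by (intro oscillation_leD[of "1 / 2 ^ l"] dyadic_grid_in_unit_cube[OF v] abs_diff_dyadic_floor_le) auto
        moreover have "\<bar>W n 0 \<omega> ?v\<bar> \<le> \<kappa>" "\<bar>W n m \<omega> ?v\<bar> \<le> \<kappa>" using good v that by auto
        then have "\<bar>deviation n m \<omega> ?v\<bar> \<le> 2 * \<kappa>"
          using \<kappa> unfolding deviation_eq_W by (cases "m = 0") auto
        ultimately show ?thesis by linarith
      qed
      then show "\<forall>m\<le>M. \<forall>u\<in>unit_cube. \<bar>deviation n m \<omega> u\<bar> \<le> 2 * \<kappa> + \<epsilon> / 2" by blast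
    qed simp
  qed
  then show ?thesis using \<kappa> \<epsilon> by (intro exI[of _ "2 * \<kappa> + \<epsilon> / 2"]) simp
qed

lemma resample_linearization:
  assumes pos: "\<And>i k. Z i \<omega> \<in> A \<Longrightarrow> 0 < F k (X i \<omega> $ k)"
    and G: "\<And>u. u \<in> unit_cube \<Longrightarrow> \<bar>deviation n m \<omega> u\<bar> \<le> \<kappa>" "oscillation_le \<delta> \<eta> (deviation n m \<omega>)"
    and C': "oscillation_le \<delta> \<rho> C'"
    and n: "0 < n" and \<eta>: "0 < \<eta>" and \<delta>: "0 < \<delta>"
    and large: "2 * \<kappa> \<le> sqrt (real n) * p" "2 * \<kappa> + 2 * \<eta> \<le> \<delta> * (sqrt (real n) * p)"
    and u: "u \<in> unit_cube"
  shows "\<bar>sqrt (real n) * (emp_copula n (resample n m \<omega>) A u - C u) - Cinf p C dC (deviation n m \<omega>) u\<bar>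
    \<le> 2 / p * linear_error \<kappa> \<eta> \<rho> + 2 * \<kappa> / (sqrt (real n) * p) * (Cinf_bound * \<kappa>)"
proof -
  interpret fluctuation: copula_fluctuation F p C C' n "resample n m \<omega>" A "deviation n m \<omega>" \<kappa> \<eta> \<delta>
  proof
    show "0 < F k (fst (resample n m \<omega> i) $ k)" if "snd (resample n m \<omega> i) \<in> A" for i k
      using that pos by (auto simp: resample_def data_def split: if_splits)
  qed (rule deviation_def G n \<eta> \<delta> large | assumption)+
  show ?thesis by (rule fluctuation.emp_copula_linearization[OF u C'])
qed
lemma exists_linear_error_le:
  assumes \<epsilon>: "0 < \<epsilon>"
  shows "\<exists>\<eta> \<rho>. 0 < \<eta> \<and> \<eta> \<le> \<epsilon> \<and> 0 < \<rho> \<and> 2 / p * linear_error \<kappa> \<eta> \<rho> \<le> 2 * \<epsilon>"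
proof -
  let ?d = "real CARD('p)"
  obtain \<eta> where \<eta>: "0 < \<eta>" "\<eta> \<le> \<epsilon>" "2 / p * (?d + 2 + 3 * ?d * C'_bound) * \<eta> \<le> \<epsilon>"
    using exists_pos_mult_le[OF \<epsilon>] by blast
  obtain \<rho> where \<rho>: "0 < \<rho>" "2 / p * (?d * (2 * \<kappa> + 2 * \<eta>)) * \<rho> \<le> \<epsilon>"
    using exists_pos_mult_le[OF \<epsilon>] by blast
  have "2 / p * linear_error \<kappa> \<eta> \<rho>
      = 2 / p * (?d + 2 + 3 * ?d * C'_bound) * \<eta> + 2 / p * (?d * (2 * \<kappa> + 2 * \<eta>)) * \<rho>"
    unfolding linear_error_def distrib_left[of "2 / p" "(?d + 2 + 3 * ?d * C'_bound) * \<eta>"] by (simp only: mult.assoc)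
  then show ?thesis using \<eta> \<rho> by (intro exI[of _ \<eta>] exI[of _ \<rho>]) simp
qed

lemma eventually_linearization_scale:
  assumes "0 < \<delta>" "0 < \<epsilon>"
  shows "eventually (\<lambda>n. 0 < n \<and> 2 * \<kappa> \<le> sqrt (real n) * p \<and> 2 * \<kappa> + 2 * \<eta> \<le> \<delta> * (sqrt (real n) * p)
    \<and> 2 * \<kappa> / (sqrt (real n) * p) * (Cinf_bound * \<kappa>) < \<epsilon>) sequentially"
proof -
  note small = order_tendstoD(2)[OF tendsto_const_over_sqrt]
  have "eventually (\<lambda>n. 2 * \<kappa> / p * (Cinf_bound * \<kappa>) / sqrt (real n) < \<epsilon>) sequentially"
    "eventually (\<lambda>n. 2 * \<kappa> / p / sqrt (real n) < 1) sequentially"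
    "eventually (\<lambda>n. (2 * \<kappa> + 2 * \<eta>) / p / sqrt (real n) < \<delta>) sequentially"
    by (rule small[OF assms(2)] small[OF zero_less_one] small[OF assms(1)])+
  with eventually_gt_at_top[of 0] show ?thesis
  proof eventually_elim
    case (elim n)
    have "0 < sqrt (real n)" using elim(1) by simp
    then show ?case using elim p_pos by (simp add: divide_less_eq mult_ac)
  qed
qed

lemma eventually_resample_linearization:
  assumes \<epsilon>: "0 < \<epsilon>"
  shows "eventually (\<lambda>n. nearly_surely \<epsilon> (\<lambda>\<omega>. \<forall>m\<le>M. \<forall>u\<in>unit_cube.
    \<bar>sqrt (real n) * (emp_copula n (resample n m \<omega>) A u - C u) - Cinf p C dC (deviation n m \<omega>) u\<bar> \<le> \<epsilon>)) sequentially"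
proof -
  have \<epsilon>3: "0 < \<epsilon> / 3" using \<epsilon> by simp
  obtain \<kappa> where \<kappa>: "0 < \<kappa>" and bounded: "eventually (\<lambda>n. nearly_surely (\<epsilon> / 3)
      (\<lambda>\<omega>. \<forall>m\<le>M. \<forall>u\<in>unit_cube. \<bar>deviation n m \<omega> u\<bar> \<le> \<kappa>)) sequentially"
    using eventually_abs_deviation_le[OF \<epsilon>3] by blast
  obtain \<eta> \<rho> where \<eta>: "0 < \<eta>" "\<eta> \<le> \<epsilon> / 3" and \<rho>: "0 < \<rho>"
    and error: "2 / p * linear_error \<kappa> \<eta> \<rho> \<le> 2 * (\<epsilon> / 3)"
    using exists_linear_error_le[OF \<epsilon>3] by blast
  obtain l where "oscillation_le (1 / 2 ^ l) \<rho> C'" and osc: "eventually (\<lambda>n. nearly_surely \<eta>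
      (\<lambda>\<omega>. \<forall>m\<le>M. oscillation_le (1 / 2 ^ l) \<eta> (deviation n m \<omega>))) sequentially"
    using eventually_happens[OF eventually_conj[OF continuous_on_imp_oscillation_le[OF C'_cont \<rho>]
      eventually_deviation_oscillation_le[OF \<eta>(1), of M]]] by auto
  note C' = this(1)
  have "0 < (1 / 2 ^ l :: real)" by simp
  from bounded osc eventually_linearization_scale[OF this \<epsilon>3, of \<kappa> \<eta>] show ?thesis
  proof eventually_elim
    case (elim n)
    then have n: "0 < n" and large: "2 * \<kappa> \<le> sqrt (real n) * p" "2 * \<kappa> + 2 * \<eta> \<le> 1 / 2 ^ l * (sqrt (real n) * p)"
      and rest: "2 * \<kappa> / (sqrt (real n) * p) * (Cinf_bound * \<kappa>) < \<epsilon> / 3" by auto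
    show ?case
    proof (rule nearly_surely_mono[OF nearly_surely_conj[OF nearly_surely_conj[OF elim(1,2)] nearly_surely_of_AE[OF AE_F_pos]]])
      show "\<epsilon> / 3 + \<eta> + 0 \<le> \<epsilon>" using \<eta>(2) \<epsilon> by simp
      fix \<omega> assume good: "((\<forall>m\<le>M. \<forall>u\<in>unit_cube. \<bar>deviation n m \<omega> u\<bar> \<le> \<kappa>)
          \<and> (\<forall>m\<le>M. oscillation_le (1 / 2 ^ l) \<eta> (deviation n m \<omega>)))
          \<and> (\<forall>i k. Z i \<omega> \<in> A \<longrightarrow> 0 < F k (X i \<omega> $ k))"
      have "\<bar>sqrt (real n) * (emp_copula n (resample n m \<omega>) A u - C u) - Cinf p C dC (deviation n m \<omega>) u\<bar> \<le> \<epsilon>"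
        if "m \<le> M" "u \<in> unit_cube" for m u
      proof -
        have "\<bar>sqrt (real n) * (emp_copula n (resample n m \<omega>) A u - C u) - Cinf p C dC (deviation n m \<omega>) u\<bar>
            \<le> 2 / p * linear_error \<kappa> \<eta> \<rho> + 2 * \<kappa> / (sqrt (real n) * p) * (Cinf_bound * \<kappa>)"
          using good that by (intro resample_linearization[OF _ _ _ C' n \<eta>(1) _ large]) auto
        then show ?thesis using error rest by linarith
      qed
      then show "\<forall>m\<le>M. \<forall>u\<in>unit_cube. \<bar>sqrt (real n) * (emp_copula n (resample n m \<omega>) A u - C u)
          - Cinf p C dC (deviation n m \<omega>) u\<bar> \<le> \<epsilon>"
        by blast
    qed
  qed
qed

lemma copula_proc_eq:
  "copula_proc P X Z J A n \<omega> m u =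
     sqrt (real n) * (emp_copula n (resample n m \<omega>) A u - C u)
     - (if m = 0 then 0 else sqrt (real n) * (emp_copula n (resample n 0 \<omega>) A u - C u))"
  by (simp add: copula_proc_def Let_def resample_def[abs_def] data_def right_diff_distrib)

lemma copula_proc_linearization:
  assumes \<epsilon>: "0 < \<epsilon>"
  shows "eventually (\<lambda>n. nearly_surely \<epsilon> (\<lambda>\<omega>. \<forall>m\<le>M. \<forall>u\<in>unit_cube.
    \<bar>copula_proc P X Z J A n \<omega> m u - Cinf p C dC (W n m \<omega>) u\<bar> \<le> \<epsilon>)) sequentially"
proof -
  have "0 < \<epsilon> / 2" using \<epsilon> by simp
  from eventually_resample_linearization[OF this, of M] show ?thesis
  proof eventually_elim
    case (elim n)
    show ?case
    proof (rule nearly_surely_mono[OF elim])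
      let ?R = "\<lambda>\<omega> m u. sqrt (real n) * (emp_copula n (resample n m \<omega>) A u - C u) - Cinf p C dC (deviation n m \<omega>) u"
      fix \<omega> assume good: "\<forall>m\<le>M. \<forall>u\<in>unit_cube. \<bar>?R \<omega> m u\<bar> \<le> \<epsilon> / 2"
      have "\<bar>copula_proc P X Z J A n \<omega> m u - Cinf p C dC (W n m \<omega>) u\<bar> \<le> \<epsilon>"
        if mu: "m \<le> M" "u \<in> unit_cube" for m u
      proof -
        have R: "\<bar>?R \<omega> m u\<bar> \<le> \<epsilon> / 2" "\<bar>?R \<omega> 0 u\<bar> \<le> \<epsilon> / 2" using good mu by auto
        show ?thesis
        proof (cases "m = 0")
          case True
          then show ?thesis using R \<epsilon> by (simp add: copula_proc_eq deviation_eq_W[abs_def])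
        next
          case False
          then have "Cinf p C dC (W n m \<omega>) u = Cinf p C dC (deviation n m \<omega>) u - Cinf p C dC (deviation n 0 \<omega>) u"
            unfolding Cinf_diff by (simp add: deviation_eq_W)
          moreover have "copula_proc P X Z J A n \<omega> m u = sqrt (real n) * (emp_copula n (resample n m \<omega>) A u - C u)
              - sqrt (real n) * (emp_copula n (resample n 0 \<omega>) A u - C u)"
            using False by (simp add: copula_proc_eq)
          ultimately show ?thesis using R by linarith
        qed
      qed
      then show "\<forall>m\<le>M. \<forall>u\<in>unit_cube. \<bar>copula_proc P X Z J A n \<omega> m u - Cinf p C dC (W n m \<omega>) u\<bar> \<le> \<epsilon>"
        by blast
    qed (use \<epsilon> in simp)
  qed
qed

end

section \<open>Gaussian processes with continuous paths\<close>

definition psd_kernel :: "('i \<Rightarrow> 'i \<Rightarrow> real) \<Rightarrow> bool" where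
  "psd_kernel K \<longleftrightarrow> (\<forall>i j. K i j = K j i) \<and>
     (\<forall>(n::nat) c x. 0 \<le> (\<Sum>i<n. \<Sum>j<n. c i * c j * K (x i) (x j)))"

lemma psd_kernel_sym: "psd_kernel K \<Longrightarrow> K i j = K j i"
  unfolding psd_kernel_def by blast

lemma psd_kernel_quadratic_form:
  fixes n :: nat
  shows "psd_kernel K \<Longrightarrow> 0 \<le> (\<Sum>i<n. \<Sum>j<n. c i * c j * K (x i) (x j))"
  unfolding psd_kernel_def by blast

lemma psd_kernel_pullback:
  assumes "psd_kernel K" shows "psd_kernel (\<lambda>i j. K (x i) (x j))"
  unfolding psd_kernel_def
  using psd_kernel_sym[OF assms] psd_kernel_quadratic_form[OF assms, where x = "\<lambda>i. x (_ i)"] by blast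

lemma psd_kernel_extra_point:
  fixes n :: nat
  assumes K: "psd_kernel K"
  shows "0 \<le> (\<Sum>i<n. \<Sum>j<n. c i * c j * K (x i) (x j)) + 2 * t * (\<Sum>i<n. c i * K (x i) l) + t\<^sup>2 * K l l"
proof -
  let ?c = "c(n := t)" and ?x = "x(n := l)"
  have "0 \<le> (\<Sum>i<Suc n. \<Sum>j<Suc n. ?c i * ?c j * K (?x i) (?x j))"
    by (rule psd_kernel_quadratic_form[OF K])
  also have "\<dots> = (\<Sum>i<n. \<Sum>j<n. c i * c j * K (x i) (x j)) + (\<Sum>i<n. c i * t * K (x i) l)
      + ((\<Sum>j<n. t * c j * K l (x j)) + t * t * K l l)"
    by (simp add: sum.distrib)
  also have "(\<Sum>j<n. t * c j * K l (x j)) = (\<Sum>i<n. c i * t * K (x i) l)"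
    by (intro sum.cong) (auto simp: psd_kernel_sym[OF K, of l])
  finally show ?thesis by (simp add: sum_distrib_left power2_eq_square mult_ac)
qed

lemma psd_kernel_diag_nonneg: "psd_kernel K \<Longrightarrow> 0 \<le> K l l"
  using psd_kernel_extra_point[where n = 0 and t = 1] by fastforce

lemma psd_kernel_zero_row:
  assumes K: "psd_kernel K" "K l l = 0" shows "K i l = 0"
proof (rule ccontr)
  assume "K i l \<noteq> 0"
  moreover have "0 \<le> K i i + 2 * t * K i l" for t
    using psd_kernel_extra_point[OF K(1), where n = 1 and c = "\<lambda>_. 1" and x = "\<lambda>_. i" and t = t and l = l] K(2) by simp
  from this[of "- (K i i + 1) / (2 * K i l)"] show False using \<open>K i l \<noteq> 0\<close> by (simp add: field_simps)
qed

text \<open>If the pivot vanishes, so does its row, and division by zero makes the step the identity.\<close>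
definition schur_complement :: "('i \<Rightarrow> 'i \<Rightarrow> real) \<Rightarrow> 'i \<Rightarrow> 'i \<Rightarrow> 'i \<Rightarrow> real" where
  "schur_complement K l i j = K i j - K i l * K j l / K l l"

lemma psd_schur_complement:
  assumes K: "psd_kernel K" shows "psd_kernel (schur_complement K l)"
  unfolding psd_kernel_def
proof (intro conjI allI)
  show "schur_complement K l i j = schur_complement K l j i" for i j
    using psd_kernel_sym[OF K, of i j] by (simp add: schur_complement_def)
  fix n :: nat and c x
  let ?Q = "\<Sum>i<n. \<Sum>j<n. c i * c j * K (x i) (x j)" and ?b = "\<Sum>i<n. c i * K (x i) l"
  have "0 \<le> ?Q + 2 * (- ?b / K l l) * ?b + (- ?b / K l l)\<^sup>2 * K l l"
    by (rule psd_kernel_extra_point[OF K])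
  also have "\<dots> = ?Q - ?b * ?b / K l l"
    by (cases "K l l = 0") (simp_all add: field_simps power2_eq_square)
  also have "\<dots> = (\<Sum>i<n. \<Sum>j<n. c i * c j * schur_complement K l (x i) (x j))"
    unfolding schur_complement_def sum_product sum_divide_distrib
    by (simp add: sum_subtractf[symmetric] algebra_simps)
  finally show "0 \<le> (\<Sum>i<n. \<Sum>j<n. c i * c j * schur_complement K l (x i) (x j))" .
qed

fun schur_iterate :: "(nat \<Rightarrow> nat \<Rightarrow> real) \<Rightarrow> nat \<Rightarrow> nat \<Rightarrow> nat \<Rightarrow> real" where
  "schur_iterate K 0 = K"
| "schur_iterate K (Suc l) = schur_complement (schur_iterate K l) l"

lemma psd_schur_iterate: "psd_kernel K \<Longrightarrow> psd_kernel (schur_iterate K l)"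
  by (induction l) (simp_all add: psd_schur_complement)

lemma schur_iterate_eliminated:
  assumes K: "psd_kernel K" shows "i < l \<Longrightarrow> schur_iterate K l i j = 0"
proof (induction l arbitrary: j)
  case (Suc l)
  note S = psd_schur_iterate[OF K, of l]
  show ?case
  proof (cases "i = l")
    case True
    then show ?thesis
      using psd_kernel_zero_row[OF S, of l j] psd_kernel_sym[OF S, of l j] by (auto simp: schur_complement_def)
  qed (use Suc in \<open>simp add: schur_complement_def\<close>)
qed simp

definition cholesky :: "(nat \<Rightarrow> nat \<Rightarrow> real) \<Rightarrow> nat \<Rightarrow> nat \<Rightarrow> real" where
  "cholesky K i l = schur_iterate K l i l / sqrt (schur_iterate K l l l)"

lemma cholesky_upper_zero: "psd_kernel K \<Longrightarrow> i < l \<Longrightarrow> cholesky K i l = 0"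
  by (simp add: cholesky_def schur_iterate_eliminated)

lemma cholesky_decomposition:
  assumes K: "psd_kernel K" and "i < n"
  shows "K i j = (\<Sum>l<n. cholesky K i l * cholesky K j l)"
proof -
  have "cholesky K i l * cholesky K j l
      = schur_iterate K l i l * schur_iterate K l j l / schur_iterate K l l l" for l
    using psd_kernel_diag_nonneg[OF psd_schur_iterate[OF K, of l], of l] by (simp add: cholesky_def)
  then have "K i j = (\<Sum>l<n. cholesky K i l * cholesky K j l) + schur_iterate K n i j" for n
    by (induction n) (simp_all add: schur_complement_def)
  then show ?thesis
    using schur_iterate_eliminated[OF K \<open>i < n\<close>, of j] by (metis add.right_neutral)
qed

lemma indep_vars_PiM_coords:
  assumes "\<And>i. prob_space (M i)"
  shows "prob_space.indep_vars (Pi\<^sub>M UNIV M) M (\<lambda>i x. x i) UNIV"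
proof -
  interpret product_prob_space M UNIV by (rule product_prob_spaceI) (rule assms)
  have "distr (Pi\<^sub>M UNIV M) (Pi\<^sub>M UNIV M) (\<lambda>x. \<lambda>i\<in>UNIV. x i) = Pi\<^sub>M UNIV M"
    by (simp only: restrict_UNIV distr_id)
  also have "\<dots> = Pi\<^sub>M UNIV (\<lambda>i. distr (Pi\<^sub>M UNIV M) (M i) (\<lambda>x. x i))"
    by (simp add: PiM_component)
  finally show ?thesis by (subst P.indep_vars_iff_distr_eq_PiM') auto
qed

definition gauss_seq :: "(nat \<Rightarrow> real) measure" where
  "gauss_seq = Pi\<^sub>M UNIV (\<lambda>_. std_normal_distribution)"

lemma prob_space_std_normal_distribution: "prob_space std_normal_distribution"
  by (rule prob_space_normal_density) simp

lemma prob_space_gauss_seq: "prob_space gauss_seq"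
  unfolding gauss_seq_def by (intro prob_space_PiM prob_space_std_normal_distribution)

lemma measurable_gauss_seq_coord [measurable]: "(\<lambda>\<zeta>. \<zeta> l) \<in> borel_measurable gauss_seq"
proof -
  have "(\<lambda>\<zeta>. \<zeta> l) \<in> measurable gauss_seq std_normal_distribution" unfolding gauss_seq_def by measurable
  then show ?thesis by (simp cong: measurable_cong_sets)
qed

lemma expectation_cis_std_normal: "(\<integral>x. cis (t * x) \<partial>std_normal_distribution) = exp (- t\<^sup>2 / 2)"
proof -
  have "char std_normal_distribution t = complex_of_real (exp (- t\<^sup>2 / 2))"
    using char_std_normal_distribution by (simp add: fun_eq_iff)
  then show ?thesis by (simp add: char_def cis_conv_exp)
qed

lemma expectation_exp_std_normal:
  "integrable std_normal_distribution (\<lambda>x. exp (t * x))"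
  "(\<integral>x. exp (t * x) \<partial>std_normal_distribution) = exp (t\<^sup>2 / 2)"
proof -
  have eq: "std_normal_density x * exp (t * x) = exp (t\<^sup>2 / 2) * normal_density t 1 x" for x
    unfolding std_normal_density_def normal_density_def by (simp add: exp_add[symmetric] power2_eq_square field_simps)
  have "integrable lborel (\<lambda>x. std_normal_density x *\<^sub>R exp (t * x))"
    by (simp add: eq integrable_normal_density)
  then show "integrable std_normal_distribution (\<lambda>x. exp (t * x))"
    by (subst integrable_density) auto
  show "(\<integral>x. exp (t * x) \<partial>std_normal_distribution) = exp (t\<^sup>2 / 2)"
    by (subst integral_density) (auto simp: eq)
qed

lemma gauss_seq_prod:
  fixes f :: "real \<Rightarrow> real \<Rightarrow> 'c::{real_normed_field, banach, second_countable_topology}"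
  assumes [measurable]: "\<And>t. f t \<in> borel_measurable borel"
    and i: "\<And>t. integrable std_normal_distribution (f t)"
  shows "integrable gauss_seq (\<lambda>\<zeta>. \<Prod>l<n. f (b l) (\<zeta> l))"
    "(\<integral>\<zeta>. (\<Prod>l<n. f (b l) (\<zeta> l)) \<partial>gauss_seq) = (\<Prod>l<n. \<integral>x. f (b l) x \<partial>std_normal_distribution)"
proof -
  interpret prob_space gauss_seq by (rule prob_space_gauss_seq)
  have "indep_vars (\<lambda>_. std_normal_distribution) (\<lambda>l \<zeta>. \<zeta> l) UNIV"
    using indep_vars_PiM_coords[of "\<lambda>_::nat. std_normal_distribution"] prob_space_std_normal_distribution
    by (simp add: gauss_seq_def)
  then have ind: "indep_vars (\<lambda>_. borel) (\<lambda>l \<zeta>. f (b l) (\<zeta> l)) {..<n}"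
    using indep_vars_compose2[of "\<lambda>_. std_normal_distribution" "\<lambda>l \<zeta>. \<zeta> l" UNIV "\<lambda>l. f (b l)" "\<lambda>_. borel"]
    by (auto intro: indep_vars_subset)
  have coord: "(\<lambda>\<zeta>. \<zeta> l) \<in> measurable gauss_seq std_normal_distribution" for l
    unfolding gauss_seq_def by measurable
  have distr: "distr gauss_seq std_normal_distribution (\<lambda>\<zeta>. \<zeta> l) = std_normal_distribution" for l
    unfolding gauss_seq_def by (rule distr_PiM_component) (auto intro: prob_space_std_normal_distribution)
  have int: "integrable gauss_seq (\<lambda>\<zeta>. f t (\<zeta> l))" for t l
    using i[of t] integrable_distr_eq[OF coord, of "f t" l] by (simp add: distr)
  have eq: "(\<integral>\<zeta>. f t (\<zeta> l) \<partial>gauss_seq) = (\<integral>x. f t x \<partial>std_normal_distribution)" for t l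
    using integral_distr[OF coord, of "f t" l] by (simp add: distr)
  show "integrable gauss_seq (\<lambda>\<zeta>. \<Prod>l<n. f (b l) (\<zeta> l))"
    by (rule indep_vars_integrable[OF _ ind]) (auto intro: int)
  show "(\<integral>\<zeta>. (\<Prod>l<n. f (b l) (\<zeta> l)) \<partial>gauss_seq) = (\<Prod>l<n. \<integral>x. f (b l) x \<partial>std_normal_distribution)"
    using indep_vars_lebesgue_integral[OF _ ind int] by (simp add: eq)
qed

lemma expectation_cis_gauss_seq:
  "(\<integral>\<zeta>. cis (\<Sum>l<n. b l * \<zeta> l) \<partial>gauss_seq) = exp (- (\<Sum>l<n. (b l)\<^sup>2) / 2)"
proof -
  interpret S: prob_space std_normal_distribution by (rule prob_space_std_normal_distribution)
  have "(\<integral>\<zeta>. cis (\<Sum>l<n. b l * \<zeta> l) \<partial>gauss_seq) = (\<Prod>l<n. \<integral>x. cis (b l * x) \<partial>std_normal_distribution)"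
    unfolding cis_sum
    by (rule gauss_seq_prod(2)[of "\<lambda>t x. cis (t * x)"]) (auto intro: S.integrable_const_bound[of _ 1])
  also have "\<dots> = complex_of_real (\<Prod>l<n. exp (- (b l)\<^sup>2 / 2))" by (simp add: expectation_cis_std_normal)
  also have "(\<Prod>l<n. exp (- (b l)\<^sup>2 / 2)) = exp (- (\<Sum>l<n. (b l)\<^sup>2) / 2)"
    by (subst exp_sum[symmetric]) (auto simp: sum_negf sum_divide_distrib)
  finally show ?thesis .
qed

lemma expectation_exp_gauss_seq:
  "integrable gauss_seq (\<lambda>\<zeta>. exp (\<Sum>l<n. b l * \<zeta> l))"
  "(\<integral>\<zeta>. exp (\<Sum>l<n. b l * \<zeta> l) \<partial>gauss_seq) = exp ((\<Sum>l<n. (b l)\<^sup>2) / 2)"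
proof -
  have prod: "exp (\<Sum>l<n. b l * \<zeta> l) = (\<Prod>l<n. exp (b l * \<zeta> l))" for \<zeta> :: "nat \<Rightarrow> real"
    by (rule exp_sum) simp
  show "integrable gauss_seq (\<lambda>\<zeta>. exp (\<Sum>l<n. b l * \<zeta> l))"
    unfolding prod by (rule gauss_seq_prod(1)[of "\<lambda>t x. exp (t * x)"]) (auto intro: expectation_exp_std_normal)
  have "(\<integral>\<zeta>. exp (\<Sum>l<n. b l * \<zeta> l) \<partial>gauss_seq) = (\<Prod>l<n. \<integral>x. exp (b l * x) \<partial>std_normal_distribution)"
    unfolding prod by (rule gauss_seq_prod(2)[of "\<lambda>t x. exp (t * x)"]) (auto intro: expectation_exp_std_normal)
  then show "(\<integral>\<zeta>. exp (\<Sum>l<n. b l * \<zeta> l) \<partial>gauss_seq) = exp ((\<Sum>l<n. (b l)\<^sup>2) / 2)"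
    by (simp add: expectation_exp_std_normal exp_sum[symmetric] sum_divide_distrib)
qed

definition gauss_field :: "('i \<Rightarrow> 'i \<Rightarrow> real) \<Rightarrow> 'i set \<Rightarrow> 'i \<Rightarrow> (nat \<Rightarrow> real) \<Rightarrow> real" where
  "gauss_field K T u \<zeta> =
     (\<Sum>l\<le>to_nat_on T u. cholesky (\<lambda>i j. K (from_nat_into T i) (from_nat_into T j)) (to_nat_on T u) l * \<zeta> l)"

lemma measurable_gauss_field [measurable]: "gauss_field K T u \<in> borel_measurable gauss_seq"
  unfolding gauss_field_def[abs_def] by measurable

lemma gauss_field_combination:
  assumes K: "psd_kernel K" and T: "countable T" and I: "finite I" "x ` I \<subseteq> T"
  obtains n b where "\<And>\<zeta>. (\<Sum>i\<in>I. c i * gauss_field K T (x i) \<zeta>) = (\<Sum>l<n. b l * \<zeta> l)"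
    "(\<Sum>l<n. (b l)\<^sup>2) = (\<Sum>i\<in>I. \<Sum>j\<in>I. c i * c j * K (x i) (x j))"
proof -
  let ?K = "\<lambda>i j. K (from_nat_into T i) (from_nat_into T j)" and ?t = "\<lambda>i. to_nat_on T (x i)"
  note K' = psd_kernel_pullback[OF K, of "from_nat_into T"]
  obtain n where "?t ` I \<subseteq> {..<n}"
    using finite_nat_iff_bounded[of "?t ` I"] I(1) by auto
  then have n: "?t i < n" if "i \<in> I" for i using that by auto
  define b where "b l = (\<Sum>i\<in>I. c i * cholesky ?K (?t i) l)" for l
  show thesis
  proof (rule that[of b n])
    have "gauss_field K T (x i) \<zeta> = (\<Sum>l<n. cholesky ?K (?t i) l * \<zeta> l)" if "i \<in> I" for i \<zeta>
      unfolding gauss_field_def using n[OF that]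
      by (intro sum.mono_neutral_left) (auto intro: cholesky_upper_zero[OF K'])
    then show "(\<Sum>i\<in>I. c i * gauss_field K T (x i) \<zeta>) = (\<Sum>l<n. b l * \<zeta> l)" for \<zeta>
      unfolding b_def sum_distrib_left sum_distrib_right by (subst sum.swap) (simp add: sum_distrib_left mult.assoc)
    have "?K (?t i) (?t j) = K (x i) (x j)" if "i \<in> I" "j \<in> I" for i j
      using that I(2) T by (simp add: image_subset_iff)
    then have "K (x i) (x j) = (\<Sum>l<n. cholesky ?K (?t i) l * cholesky ?K (?t j) l)" if "i \<in> I" "j \<in> I" for i j
      using that cholesky_decomposition[OF K' n, of i "?t j"] by simp
    then have "(\<Sum>i\<in>I. \<Sum>j\<in>I. c i * c j * K (x i) (x j))
        = (\<Sum>i\<in>I. \<Sum>j\<in>I. \<Sum>l<n. c i * c j * (cholesky ?K (?t i) l * cholesky ?K (?t j) l))"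
      by (simp add: sum_distrib_left)
    also have "\<dots> = (\<Sum>l<n. \<Sum>i\<in>I. \<Sum>j\<in>I. c i * c j * (cholesky ?K (?t i) l * cholesky ?K (?t j) l))"
      by (subst (2) sum.swap) (intro sum.cong refl sum.swap)
    finally show "(\<Sum>l<n. (b l)\<^sup>2) = (\<Sum>i\<in>I. \<Sum>j\<in>I. c i * c j * K (x i) (x j))"
      by (simp add: b_def power2_eq_square sum_product mult_ac)
  qed
qed

lemma expectation_cis_gauss_field:
  assumes "psd_kernel K" "countable T" "finite I" "x ` I \<subseteq> T"
  shows "(\<integral>\<zeta>. cis (\<Sum>i\<in>I. c i * gauss_field K T (x i) \<zeta>) \<partial>gauss_seq)
    = exp (- (\<Sum>i\<in>I. \<Sum>j\<in>I. c i * c j * K (x i) (x j)) / 2)"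
proof -
  obtain n b where "\<And>\<zeta>. (\<Sum>i\<in>I. c i * gauss_field K T (x i) \<zeta>) = (\<Sum>l<n. b l * \<zeta> l)"
    "(\<Sum>l<n. (b l)\<^sup>2) = (\<Sum>i\<in>I. \<Sum>j\<in>I. c i * c j * K (x i) (x j))"
    using gauss_field_combination[OF assms, of c] by blast
  then show ?thesis using expectation_cis_gauss_seq[of b n] by simp
qed

lemma mgf_le_gauss_field_diff:
  assumes K: "psd_kernel K" "countable T" and uv: "u \<in> T" "v \<in> T"
  shows "prob_space.mgf_le gauss_seq \<theta> (exp (\<theta>\<^sup>2 * (K u u - 2 * K u v + K v v) / 2))
    (\<lambda>\<zeta>. gauss_field K T u \<zeta> - gauss_field K T v \<zeta>)"
proof -
  interpret prob_space gauss_seq by (rule prob_space_gauss_seq)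
  let ?c = "\<lambda>i. if i then \<theta> else - \<theta>" and ?x = "\<lambda>i. if i then u else v"
  have points: "?x ` UNIV \<subseteq> T" using uv by auto
  obtain n b where b: "\<And>\<zeta>. (\<Sum>i\<in>UNIV. ?c i * gauss_field K T (?x i) \<zeta>) = (\<Sum>l<n. b l * \<zeta> l)"
    "(\<Sum>l<n. (b l)\<^sup>2) = (\<Sum>i\<in>UNIV. \<Sum>j\<in>UNIV. ?c i * ?c j * K (?x i) (?x j))"
    using gauss_field_combination[OF K finite points, of ?c] by blast
  have "\<theta> * (gauss_field K T u \<zeta> - gauss_field K T v \<zeta>) = (\<Sum>l<n. b l * \<zeta> l)" for \<zeta>
    unfolding b(1)[symmetric] by (simp add: UNIV_bool right_diff_distrib)
  moreover have "(\<Sum>l<n. (b l)\<^sup>2) = \<theta>\<^sup>2 * (K u u - 2 * K u v + K v v)"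
    unfolding b(2) using psd_kernel_sym[OF K(1), of u v] by (simp add: UNIV_bool power2_eq_square algebra_simps)
  ultimately show ?thesis by (simp add: mgf_le_def expectation_exp_gauss_seq)
qed

lemma oscillation_le_imp_continuous_on:
  fixes f :: "real^'p \<Rightarrow> real"
  assumes f: "\<And>e. 0 < e \<Longrightarrow> \<exists>l::nat. oscillation_le (1 / 2 ^ l) e f"
  shows "continuous_on unit_cube f"
  unfolding continuous_on_iff
proof (intro ballI allI impI)
  fix u :: "real^'p" and e :: real assume u: "u \<in> unit_cube" and e: "0 < e"
  then obtain l :: nat where l: "oscillation_le (1 / 2 ^ l) (e / 2) f" using f[of "e / 2"] by auto
  have "dist (f v) (f u) < e" if "v \<in> unit_cube" "dist v u < 1 / 2 ^ l" for v
  proof -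
    have "\<bar>v $ k - u $ k\<bar> \<le> 1 / 2 ^ l" for k
      using component_le_norm_cart[of "v - u" k] that(2) by (simp add: dist_norm)
    then show ?thesis using oscillation_leD[OF l that(1) u] e by fastforce
  qed
  then show "\<exists>d>0. \<forall>v\<in>unit_cube. dist v u < d \<longrightarrow> dist (f v) (f u) < e"
    by (intro exI[of _ "1 / 2 ^ l"]) simp
qed

definition chain_regular :: "(real^'p \<Rightarrow> real) \<Rightarrow> bool" where
  "chain_regular f \<longleftrightarrow> eventually (\<lambda>j. grid_increments_le j (chain_step CARD('p) j) f) sequentially"

definition dyadic_limit :: "(real^'p \<Rightarrow> real) \<Rightarrow> real^'p \<Rightarrow> real" where
  "dyadic_limit f u = lim (\<lambda>l. f (dyadic_floor l u))"

context
  fixes f :: "real^'p \<Rightarrow> real"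
  assumes f: "chain_regular f"
begin

lemma chain_regular_levels:
  obtains l0 where
    "\<And>j. l0 \<le> j \<Longrightarrow> grid_increments_le j (chain_step CARD('p) j) f"
    "\<And>l L u. l0 \<le> l \<Longrightarrow> l \<le> L \<Longrightarrow> u \<in> unit_cube \<Longrightarrow>
       \<bar>f (dyadic_floor L u) - f (dyadic_floor l u)\<bar> \<le> real CARD('p) * chain_tail CARD('p) l"
proof -
  obtain l0 where l0: "\<And>j. l0 \<le> j \<Longrightarrow> grid_increments_le j (chain_step CARD('p) j) f"
    using f unfolding chain_regular_def eventually_sequentially by blast
  have "\<bar>f (dyadic_floor L u) - f (dyadic_floor l u)\<bar> \<le> real CARD('p) * chain_tail CARD('p) l"
    if "l0 \<le> l" "l \<le> L" "u \<in> unit_cube" for l L u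
    using abs_diff_dyadic_floor_le_chain_tail[of l L 1 f u] l0 that by simp
  with l0 show thesis by (rule that)
qed

lemma tendsto_card_mult_chain_tail: "(\<lambda>l. a * chain_tail CARD('p) l) \<longlonglongrightarrow> 0"
  using tendsto_mult[OF tendsto_const chain_tail_tendsto_0] by simp

lemma dyadic_limit_tendsto:
  assumes u: "u \<in> unit_cube"
  shows "(\<lambda>l. f (dyadic_floor l u)) \<longlonglongrightarrow> dyadic_limit f u"
proof -
  obtain l0 where chain: "\<And>l L. l0 \<le> l \<Longrightarrow> l \<le> L \<Longrightarrow>
      \<bar>f (dyadic_floor L u) - f (dyadic_floor l u)\<bar> \<le> real CARD('p) * chain_tail CARD('p) l"
    using chain_regular_levels u by metis
  have "Cauchy (\<lambda>l. f (dyadic_floor l u))"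
  proof (rule CauchyI')
    fix e :: real assume "0 < e"
    then have "eventually (\<lambda>l. real CARD('p) * chain_tail CARD('p) l < e) sequentially"
      by (rule order_tendstoD(2)[OF tendsto_card_mult_chain_tail])
    then obtain l1 where l1: "\<And>l. l1 \<le> l \<Longrightarrow> real CARD('p) * chain_tail CARD('p) l < e"
      unfolding eventually_sequentially by blast
    have "norm (f (dyadic_floor m u) - f (dyadic_floor n u)) < e" if "max l0 l1 \<le> m" "m < n" for m n
      using chain[of m n] l1[of m] that by (simp add: abs_minus_commute)
    then show "\<exists>N. \<forall>m\<ge>N. \<forall>n>m. dist (f (dyadic_floor m u)) (f (dyadic_floor n u)) < e"
      unfolding dist_norm by blast
  qed
  then show ?thesis unfolding dyadic_limit_def by (simp add: Cauchy_convergent convergent_LIMSEQ_iff[symmetric])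
qed

lemma continuous_on_dyadic_limit: "continuous_on unit_cube (dyadic_limit f)"
proof (rule oscillation_le_imp_continuous_on)
  fix e :: real assume e: "0 < e"
  let ?d = "CARD('p)"
  obtain l0 where step: "\<And>j. l0 \<le> j \<Longrightarrow> grid_increments_le j (chain_step ?d j) f"
    and chain: "\<And>l L u. l0 \<le> l \<Longrightarrow> l \<le> L \<Longrightarrow> u \<in> unit_cube \<Longrightarrow>
       \<bar>f (dyadic_floor L u) - f (dyadic_floor l u)\<bar> \<le> real ?d * chain_tail ?d l"
    using chain_regular_levels by metis
  have "eventually (\<lambda>l. 3 * real ?d * chain_tail ?d l < e \<and> l0 \<le> l) sequentially"
    using e by (intro eventually_conj order_tendstoD(2)[OF tendsto_card_mult_chain_tail] eventually_ge_at_top)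
  from eventually_happens[OF this] obtain l where l: "3 * real ?d * chain_tail ?d l < e" "l0 \<le> l" by auto
  have limit: "\<bar>dyadic_limit f u - f (dyadic_floor l u)\<bar> \<le> real ?d * chain_tail ?d l" if "u \<in> unit_cube" for u
    using chain[OF l(2) _ that] dyadic_limit_tendsto[OF that]
    by (intro tendsto_upperbound[OF tendsto_rabs[OF tendsto_diff[OF _ tendsto_const]]])
      (auto simp: eventually_sequentially intro!: exI[of _ l])
  have "\<bar>dyadic_limit f u - dyadic_limit f v\<bar> \<le> e"
    if uv: "u \<in> unit_cube" "v \<in> unit_cube" "\<And>k. \<bar>u $ k - v $ k\<bar> \<le> 1 / 2 ^ l" for u v
  proof -
    have "\<bar>f (dyadic_floor l u) - f (dyadic_floor l v)\<bar> \<le> real ?d * chain_step ?d l"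
      using l(2) by (intro grid_increments_le_adjacent[OF step] dyadic_floor_in_grid dyadic_floor_diff uv)
    also have "\<dots> \<le> real ?d * chain_tail ?d l" by (intro mult_left_mono chain_step_le_tail) auto
    finally show ?thesis using limit[OF uv(1)] limit[OF uv(2)] l(1) by linarith
  qed
  then show "\<exists>l::nat. oscillation_le (1 / 2 ^ l) e (dyadic_limit f)"
    by (intro exI[of _ l]) (auto simp: oscillation_le_def dist_real_def)
qed

end

definition path_space :: "(real^'p \<Rightarrow> real) measure" where
  "path_space = vimage_algebra {f. continuous_on unit_cube f} (\<lambda>f. restrict f unit_cube)
     (Pi\<^sub>M unit_cube (\<lambda>_. borel))"

lemma space_path_space: "space path_space = {f. continuous_on unit_cube f}"
  by (simp add: path_space_def)

lemma measurable_restrict_path_space: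
  "(\<lambda>f. restrict f unit_cube) \<in> measurable path_space (Pi\<^sub>M unit_cube (\<lambda>_. borel))"
  unfolding path_space_def by (rule measurable_vimage_algebra1) (auto simp: space_PiM)

lemma measurable_path_space_eval:
  assumes "u \<in> unit_cube" shows "(\<lambda>f. f u) \<in> borel_measurable path_space"
  using measurable_compose[OF measurable_restrict_path_space measurable_component_singleton[OF assms]] assms
  by simp

lemma measurable_path_spaceI:
  assumes "\<And>\<omega>. \<omega> \<in> space M \<Longrightarrow> continuous_on unit_cube (B \<omega>)"
    and "\<And>u. u \<in> unit_cube \<Longrightarrow> (\<lambda>\<omega>. B \<omega> u) \<in> borel_measurable M"
  shows "B \<in> measurable M path_space"
  unfolding path_space_def
  by (rule measurable_vimage_algebra2) (use assms in \<open>auto intro: measurable_restrict\<close>)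

definition cube_dyadics :: "(real^'p) set" where
  "cube_dyadics = (\<Union>j. dyadic_grid j)"

lemma countable_cube_dyadics: "countable cube_dyadics"
  unfolding cube_dyadics_def by (intro countable_UN countableI_type countable_finite finite_dyadic_grid)

lemma dyadic_grid_in_cube_dyadics: "u \<in> dyadic_grid j \<Longrightarrow> u \<in> cube_dyadics"
  by (auto simp: cube_dyadics_def)

locale gaussian_kernel =
  fixes K :: "real^'p \<Rightarrow> real^'p \<Rightarrow> real"
  assumes psd: "psd_kernel K"
    and increment_le: "\<And>j k u. u \<in> unit_cube \<Longrightarrow> grid_succ j k u \<in> unit_cube \<Longrightarrow>
          K (grid_succ j k u) (grid_succ j k u) - 2 * K (grid_succ j k u) u + K u u \<le> 1 / 2 ^ j"
    and cont: "continuous_on (unit_cube \<times> unit_cube) (\<lambda>(u, v). K u v)"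
begin

abbreviation field :: "(nat \<Rightarrow> real) \<Rightarrow> real^'p \<Rightarrow> real" where
  "field \<zeta> u \<equiv> gauss_field K cube_dyadics u \<zeta>"

definition path :: "(nat \<Rightarrow> real) \<Rightarrow> real^'p \<Rightarrow> real" where
  "path \<zeta> = (if chain_regular (field \<zeta>) then dyadic_limit (field \<zeta>) else (\<lambda>_. 0))"

definition path_measure :: "(real^'p \<Rightarrow> real) measure" where
  "path_measure = distr gauss_seq path_space path"

lemma AE_chain_regular: "AE \<zeta> in gauss_seq. chain_regular (field \<zeta>)"
proof -
  interpret prob_space gauss_seq by (rule prob_space_gauss_seq)
  have "nearly_surely (chain_prob CARD('p) j) (\<lambda>\<zeta>. grid_increments_le j (chain_step CARD('p) j) (field \<zeta>))" for j
  proof (rule nearly_surely_grid_increments_le)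
    fix u :: "real^'p" and k \<theta> assume grid: "u \<in> dyadic_grid j" "grid_succ j k u \<in> dyadic_grid j" and \<theta>: "\<theta>\<^sup>2 = (2::real) ^ j"
    let ?v = "grid_succ j k u"
    have "2 ^ j * (K ?v ?v - 2 * K ?v u + K u u) \<le> 2 ^ j * (1 / 2 ^ j)"
      by (intro mult_left_mono increment_le dyadic_grid_in_unit_cube[of _ j] grid) simp
    then have "exp (\<theta>\<^sup>2 * (K ?v ?v - 2 * K ?v u + K u u) / 2) \<le> exp 2" by (simp add: \<theta>)
    then show "mgf_le \<theta> (exp 2) (\<lambda>\<zeta>. field \<zeta> ?v - field \<zeta> u)"
      using grid by (intro mgf_le_mono[OF mgf_le_gauss_field_diff[OF psd countable_cube_dyadics]] dyadic_grid_in_cube_dyadics)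
  qed measurable
  then show ?thesis
    unfolding chain_regular_def by (rule AE_eventually_of_nearly_surely) (rule summable_chain_prob)
qed

lemma continuous_on_path: "continuous_on unit_cube (path \<zeta>)"
  by (simp add: path_def continuous_on_dyadic_limit)

lemma measurable_path_component [measurable]: "(\<lambda>\<zeta>. path \<zeta> u) \<in> borel_measurable gauss_seq"
proof -
  have [measurable]: "Measurable.pred gauss_seq (\<lambda>\<zeta>. grid_increments_le j x (field \<zeta>))" for j x
    unfolding grid_increments_le_def
    by (intro pred_intros_finite finite_dyadic_grid pred_intros_imp' pred_intros_logic) measurable
  have [measurable]: "Measurable.pred gauss_seq (\<lambda>\<zeta>. chain_regular (field \<zeta>))"
    unfolding chain_regular_def eventually_sequentially by measurable
  have "(\<lambda>\<zeta>. path \<zeta> u) = (\<lambda>\<zeta>. if chain_regular (field \<zeta>) then lim (\<lambda>l. field \<zeta> (dyadic_floor l u)) else 0)"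
    by (auto simp: path_def dyadic_limit_def)
  also have "\<dots> \<in> borel_measurable gauss_seq" by measurable
  finally show ?thesis .
qed

lemma measurable_path: "path \<in> measurable gauss_seq path_space"
  by (intro measurable_path_spaceI continuous_on_path measurable_path_component)

lemma prob_space_path_measure: "prob_space path_measure"
  unfolding path_measure_def by (rule prob_space.prob_space_distr[OF prob_space_gauss_seq measurable_path])

lemma sets_path_measure: "sets path_measure = sets path_space"
  by (simp add: path_measure_def)

lemma expectation_cis_dyadic_approx_tendsto:
  assumes S: "finite S" "S \<subseteq> unit_cube"
  shows "(\<lambda>l. \<integral>\<zeta>. cis (\<Sum>u\<in>S. c u * field \<zeta> (dyadic_floor l u)) \<partial>gauss_seq)
    \<longlonglongrightarrow> exp (- (\<Sum>u\<in>S. \<Sum>v\<in>S. c u * c v * K u v) / 2)"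
proof -
  have K: "(\<lambda>l. K (dyadic_floor l u) (dyadic_floor l v)) \<longlonglongrightarrow> K u v" if "u \<in> S" "v \<in> S" for u v
  proof -
    have "u \<in> unit_cube" "v \<in> unit_cube" using that S(2) by auto
    then show ?thesis
      using continuous_on_tendsto_compose[OF cont tendsto_Pair[OF dyadic_floor_tendsto dyadic_floor_tendsto], of u v]
      by (simp add: dyadic_floor_in_unit_cube)
  qed
  have "(\<integral>\<zeta>. cis (\<Sum>u\<in>S. c u * field \<zeta> (dyadic_floor l u)) \<partial>gauss_seq)
      = exp (- (\<Sum>u\<in>S. \<Sum>v\<in>S. c u * c v * K (dyadic_floor l u) (dyadic_floor l v)) / 2)" for l
    using S dyadic_grid_in_cube_dyadics[OF dyadic_floor_in_grid]
    by (intro expectation_cis_gauss_field psd countable_cube_dyadics) auto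
  then show ?thesis
    by (simp only:) (intro tendsto_intros K; simp)
qed

lemma expectation_cis_path_measure:
  assumes S: "finite S" "S \<subseteq> unit_cube"
  shows "(\<integral>f. cis (\<Sum>u\<in>S. c u * f u) \<partial>path_measure) = exp (- (\<Sum>u\<in>S. \<Sum>v\<in>S. c u * c v * K u v) / 2)"
proof -
  interpret prob_space gauss_seq by (rule prob_space_gauss_seq)
  have "(\<integral>f. cis (\<Sum>u\<in>S. c u * f u) \<partial>path_measure) = (\<integral>\<zeta>. cis (\<Sum>u\<in>S. c u * path \<zeta> u) \<partial>gauss_seq)"
    unfolding path_measure_def using S(2) measurable_path_space_eval
    by (intro integral_distr[OF measurable_path] borel_measurable_cis borel_measurable_sum borel_measurable_times) auto
  moreover have "(\<lambda>l. \<integral>\<zeta>. cis (\<Sum>u\<in>S. c u * field \<zeta> (dyadic_floor l u)) \<partial>gauss_seq)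
      \<longlonglongrightarrow> (\<integral>\<zeta>. cis (\<Sum>u\<in>S. c u * path \<zeta> u) \<partial>gauss_seq)"
  proof (rule integral_dominated_convergence[where w = "\<lambda>_. 1"])
    show "AE \<zeta> in gauss_seq. (\<lambda>l. cis (\<Sum>u\<in>S. c u * field \<zeta> (dyadic_floor l u))) \<longlonglongrightarrow> cis (\<Sum>u\<in>S. c u * path \<zeta> u)"
      using AE_chain_regular
    proof eventually_elim
      case (elim \<zeta>)
      have "(\<lambda>l. field \<zeta> (dyadic_floor l u)) \<longlonglongrightarrow> path \<zeta> u" if "u \<in> S" for u
        using dyadic_limit_tendsto[OF elim] that S(2) elim by (auto simp: path_def)
      then show ?case unfolding cis_conv_exp by (intro tendsto_intros)
    qed
  qed auto
  ultimately show ?thesis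
    using LIMSEQ_unique[OF _ expectation_cis_dyadic_approx_tendsto[OF S, of c]] by simp
qed

end

section \<open>Gaussian laws from characteristic functions\<close>

context prob_space
begin

lemma distr_eq_scaled_std_normal:
  assumes [measurable]: "Y \<in> borel_measurable M" and \<sigma>: "0 \<le> \<sigma>"
    and cf: "\<And>t. (\<integral>\<omega>. cis (t * Y \<omega>) \<partial>M) = exp (- (t\<^sup>2 * \<sigma>\<^sup>2) / 2)"
  shows "distr M borel Y = distr std_normal_distribution borel (\<lambda>x. \<sigma> * x)"
proof (rule Levy_uniqueness)
  interpret S: prob_space std_normal_distribution by (rule prob_space_std_normal_distribution)
  show "real_distribution (distr M borel Y)" "real_distribution (distr std_normal_distribution borel (\<lambda>x. \<sigma> * x))"
    by (auto simp: real_distribution_def real_distribution_axioms_def intro!: prob_space_distr S.prob_space_distr)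
  show "char (distr M borel Y) = char (distr std_normal_distribution borel (\<lambda>x. \<sigma> * x))"
  proof
    fix t
    have "char (distr M borel Y) t = (\<integral>\<omega>. cis (t * Y \<omega>) \<partial>M)"
      unfolding char_def cis_conv_exp by (subst integral_distr) auto
    moreover have "char (distr std_normal_distribution borel (\<lambda>x. \<sigma> * x)) t = (\<integral>x. cis ((t * \<sigma>) * x) \<partial>std_normal_distribution)"
      unfolding char_def cis_conv_exp by (subst integral_distr) (auto simp: mult.assoc)
    ultimately show "char (distr M borel Y) t = char (distr std_normal_distribution borel (\<lambda>x. \<sigma> * x)) t"
      unfolding cf expectation_cis_std_normal by (simp add: power_mult_distrib)
  qed
qed

context
  fixes Y :: "'a \<Rightarrow> real" and \<sigma> :: real
  assumes Y [measurable]: "Y \<in> borel_measurable M" and \<sigma>: "0 \<le> \<sigma>"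
    and distr_Y: "distr M borel Y = distr std_normal_distribution borel (\<lambda>x. \<sigma> * x)"
begin

lemma transfer_scaled_std_normal:
  fixes g :: "real \<Rightarrow> real"
  assumes [measurable]: "g \<in> borel_measurable borel"
  shows "integrable M (\<lambda>\<omega>. g (Y \<omega>)) \<longleftrightarrow> integrable std_normal_distribution (\<lambda>x. g (\<sigma> * x))"
    "expectation (\<lambda>\<omega>. g (Y \<omega>)) = (\<integral>x. g (\<sigma> * x) \<partial>std_normal_distribution)"
proof -
  have "integrable (distr M borel Y) g \<longleftrightarrow> integrable M (\<lambda>\<omega>. g (Y \<omega>))"
    "(\<integral>x. g x \<partial>distr M borel Y) = expectation (\<lambda>\<omega>. g (Y \<omega>))"
    by (rule integrable_distr_eq integral_distr; simp)+
  moreover have "integrable (distr std_normal_distribution borel (\<lambda>x. \<sigma> * x)) g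
      \<longleftrightarrow> integrable std_normal_distribution (\<lambda>x. g (\<sigma> * x))"
    "(\<integral>x. g x \<partial>distr std_normal_distribution borel (\<lambda>x. \<sigma> * x)) = (\<integral>x. g (\<sigma> * x) \<partial>std_normal_distribution)"
    by (rule integrable_distr_eq integral_distr; simp)+
  ultimately show "integrable M (\<lambda>\<omega>. g (Y \<omega>)) \<longleftrightarrow> integrable std_normal_distribution (\<lambda>x. g (\<sigma> * x))"
    "expectation (\<lambda>\<omega>. g (Y \<omega>)) = (\<integral>x. g (\<sigma> * x) \<partial>std_normal_distribution)"
    by (simp_all add: distr_Y)
qed

lemma scaled_std_normal_mean: "integrable M Y" "expectation Y = 0"
  using transfer_scaled_std_normal[of "\<lambda>x. x"] integrable_std_normal_distribution_moment[of 1]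
    integral_std_normal_distribution_moment_odd[of 1] by auto

lemma scaled_std_normal_second_moment: "integrable M (\<lambda>\<omega>. (Y \<omega>)\<^sup>2)" "expectation (\<lambda>\<omega>. (Y \<omega>)\<^sup>2) = \<sigma>\<^sup>2"
  using transfer_scaled_std_normal[of "\<lambda>x. x\<^sup>2"] std_normal_distribution_even_moments[of 1]
  by (auto simp: power_mult_distrib)

lemma gaussian_rv_scaled_std_normal: "gaussian_rv M Y"
proof (cases "\<sigma> = 0")
  case True
  then have "AE \<omega> in M. (Y \<omega>)\<^sup>2 = 0"
    using integral_nonneg_eq_0_iff_AE[OF scaled_std_normal_second_moment(1)] scaled_std_normal_second_moment(2) by simp
  then have "AE \<omega> in M. Y \<omega> = 0" by simp
  then show ?thesis unfolding gaussian_rv_def using Y by blast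
next
  case False
  interpret S: prob_space std_normal_distribution by (rule prob_space_std_normal_distribution)
  have "distributed std_normal_distribution lborel (\<lambda>x. x) std_normal_density"
    unfolding distributed_def by (simp add: distr_id2)
  then have "distributed std_normal_distribution lborel (\<lambda>x. 0 + \<sigma> * x) (normal_density (0 + \<sigma> * 0) (\<bar>\<sigma>\<bar> * 1))"
    using False by (intro S.normal_density_affine) auto
  then have "distr std_normal_distribution lborel (\<lambda>x. \<sigma> * x) = density lborel (normal_density 0 \<sigma>)"
    using \<sigma> by (simp add: distributed_def)
  moreover have "distr std_normal_distribution lborel (\<lambda>x. \<sigma> * x) = distr std_normal_distribution borel (\<lambda>x. \<sigma> * x)"
    "distr M lborel Y = distr M borel Y" by (auto intro!: distr_cong)
  ultimately have "distributed M lborel Y (\<lambda>x. ennreal (normal_density 0 \<sigma> x))"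
    unfolding distributed_def using distr_Y by simp
  then show ?thesis unfolding gaussian_rv_def using Y \<sigma> False
    by (intro conjI disjI1 exI[of _ 0] exI[of _ \<sigma>]) auto
qed

end

lemma centered_gaussian_of_cf:
  assumes Y: "Y \<in> borel_measurable M"
    and cf: "\<And>t. (\<integral>\<omega>. cis (t * Y \<omega>) \<partial>M) = exp (- (t\<^sup>2 * v) / 2)"
  shows "gaussian_rv M Y" "integrable M Y" "expectation Y = 0"
    "integrable M (\<lambda>\<omega>. (Y \<omega>)\<^sup>2)" "expectation (\<lambda>\<omega>. (Y \<omega>)\<^sup>2) = v"
proof -
  have "cmod (\<integral>\<omega>. cis (1 * Y \<omega>) \<partial>M) \<le> (\<integral>\<omega>. cmod (cis (1 * Y \<omega>)) \<partial>M)" by (rule integral_norm_bound)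
  then have "0 \<le> v" unfolding cf by (simp add: prob_space)
  then have v: "0 \<le> sqrt v" "(sqrt v)\<^sup>2 = v" by auto
  have "distr M borel Y = distr std_normal_distribution borel (\<lambda>x. sqrt v * x)"
    using cf by (intro distr_eq_scaled_std_normal Y v) (simp add: v)
  note normal = Y v(1) this
  show "gaussian_rv M Y" "integrable M Y" "expectation Y = 0" "integrable M (\<lambda>\<omega>. (Y \<omega>)\<^sup>2)"
    by (rule gaussian_rv_scaled_std_normal[OF normal] scaled_std_normal_mean[OF normal]
        scaled_std_normal_second_moment(1)[OF normal])+
  show "expectation (\<lambda>\<omega>. (Y \<omega>)\<^sup>2) = v"
    using scaled_std_normal_second_moment(2)[OF normal] v by simp
qed

context
  fixes S :: "'i set" and B :: "'a \<Rightarrow> 'i \<Rightarrow> real" and K :: "'i \<Rightarrow> 'i \<Rightarrow> real"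
  assumes B: "\<And>u. u \<in> S \<Longrightarrow> (\<lambda>\<omega>. B \<omega> u) \<in> borel_measurable M"
    and sym: "\<And>u v. K u v = K v u"
    and cf: "\<And>F c. finite F \<Longrightarrow> F \<subseteq> S \<Longrightarrow>
       (\<integral>\<omega>. cis (\<Sum>u\<in>F. c u * B \<omega> u) \<partial>M) = exp (- (\<Sum>u\<in>F. \<Sum>v\<in>F. c u * c v * K u v) / 2)"
begin

lemma gaussian_combination_of_cf:
  assumes F: "finite F" "F \<subseteq> S"
  shows "gaussian_rv M (\<lambda>\<omega>. \<Sum>u\<in>F. c u * B \<omega> u)" "integrable M (\<lambda>\<omega>. \<Sum>u\<in>F. c u * B \<omega> u)"
    "expectation (\<lambda>\<omega>. \<Sum>u\<in>F. c u * B \<omega> u) = 0" "integrable M (\<lambda>\<omega>. (\<Sum>u\<in>F. c u * B \<omega> u)\<^sup>2)"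
    "expectation (\<lambda>\<omega>. (\<Sum>u\<in>F. c u * B \<omega> u)\<^sup>2) = (\<Sum>u\<in>F. \<Sum>v\<in>F. c u * c v * K u v)"
proof -
  have "(\<lambda>\<omega>. \<Sum>u\<in>F. c u * B \<omega> u) \<in> borel_measurable M"
    using F(2) B by (intro borel_measurable_sum borel_measurable_times) auto
  moreover have "(\<integral>\<omega>. cis (t * (\<Sum>u\<in>F. c u * B \<omega> u)) \<partial>M)
      = exp (- (t\<^sup>2 * (\<Sum>u\<in>F. \<Sum>v\<in>F. c u * c v * K u v)) / 2)" for t
    using cf[OF F, of "\<lambda>u. t * c u"] by (simp add: sum_distrib_left mult.assoc power2_eq_square mult.left_commute)
  ultimately show "gaussian_rv M (\<lambda>\<omega>. \<Sum>u\<in>F. c u * B \<omega> u)" "integrable M (\<lambda>\<omega>. \<Sum>u\<in>F. c u * B \<omega> u)"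
    "expectation (\<lambda>\<omega>. \<Sum>u\<in>F. c u * B \<omega> u) = 0" "integrable M (\<lambda>\<omega>. (\<Sum>u\<in>F. c u * B \<omega> u)\<^sup>2)"
    "expectation (\<lambda>\<omega>. (\<Sum>u\<in>F. c u * B \<omega> u)\<^sup>2) = (\<Sum>u\<in>F. \<Sum>v\<in>F. c u * c v * K u v)"
    by (rule centered_gaussian_of_cf)+
qed

lemma centered_gaussian_process_of_cf: "centered_gaussian_process M B S K"
proof -
  note comb = gaussian_combination_of_cf
  have square: "integrable M (\<lambda>\<omega>. (B \<omega> u)\<^sup>2)" "expectation (\<lambda>\<omega>. (B \<omega> u)\<^sup>2) = K u u" if "u \<in> S" for u
    using comb(4,5)[of "{u}" "\<lambda>_. 1"] that by auto
  have product: "integrable M (\<lambda>\<omega>. B \<omega> u * B \<omega> v) \<and> expectation (\<lambda>\<omega>. B \<omega> u * B \<omega> v) = K u v"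
    if uv: "u \<in> S" "v \<in> S" for u v
  proof (cases "u = v")
    case True
    then show ?thesis using square[OF uv(1)] by (simp add: power2_eq_square)
  next
    case False
    have polarization: "B \<omega> u * B \<omega> v = ((B \<omega> u + B \<omega> v)\<^sup>2 - (B \<omega> u)\<^sup>2 - (B \<omega> v)\<^sup>2) / 2" for \<omega>
      by (simp add: power2_eq_square algebra_simps)
    have "integrable M (\<lambda>\<omega>. (B \<omega> u + B \<omega> v)\<^sup>2)"
      "expectation (\<lambda>\<omega>. (B \<omega> u + B \<omega> v)\<^sup>2) = K u u + 2 * K u v + K v v"
      using comb(4,5)[of "{u, v}" "\<lambda>_. 1"] uv False sym[of v u] by auto
    then show ?thesis
      unfolding polarization using square[OF uv(1)] square[OF uv(2)] by simp
  qed
  show ?thesis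
    unfolding centered_gaussian_process_def
  proof (intro conjI allI ballI impI)
    show "gaussian_rv M (\<lambda>\<omega>. \<Sum>u\<in>F. c u * B \<omega> u)" if "finite F \<and> F \<subseteq> S" for F c
      using comb(1)[of F c] that by blast
    show "integrable M (\<lambda>\<omega>. B \<omega> u)" "expectation (\<lambda>\<omega>. B \<omega> u) = 0" if "u \<in> S" for u
      using comb(2,3)[of "{u}" "\<lambda>_. 1"] that by auto
  qed (use product in auto)
qed

end

end

section \<open>Weak convergence in the space of bounded functions\<close>

context prob_space
begin

lemma bdd_below_outer_exp:
  fixes f :: "'a \<Rightarrow> real"
  assumes "\<And>\<omega>. \<omega> \<in> space M \<Longrightarrow> - b \<le> f \<omega>"
  shows "bdd_below {integral\<^sup>L M U |U. integrable M U \<and> (\<forall>\<omega>\<in>space M. f \<omega> \<le> U \<omega>)}"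
proof (rule bdd_belowI[of _ "- b"], clarify)
  fix U assume U: "integrable M U" "\<forall>\<omega>\<in>space M. f \<omega> \<le> U \<omega>"
  have "(\<integral>\<omega>. - b \<partial>M) \<le> integral\<^sup>L M U"
    using U assms by (intro integral_mono) (auto intro: order_trans)
  then show "- b \<le> integral\<^sup>L M U" by (simp add: prob_space)
qed

lemma outer_exp_le:
  assumes "\<And>\<omega>. \<omega> \<in> space M \<Longrightarrow> - b \<le> f \<omega>"
    and "integrable M U" "\<And>\<omega>. \<omega> \<in> space M \<Longrightarrow> f \<omega> \<le> U \<omega>"
  shows "outer_exp M f \<le> expectation U"
  unfolding outer_exp_def using assms by (intro cInf_lower bdd_below_outer_exp) auto

lemma outer_exp_ge:
  assumes f: "\<And>\<omega>. \<omega> \<in> space M \<Longrightarrow> f \<omega> \<le> b"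
    and V: "integrable M V" "\<And>\<omega>. \<omega> \<in> space M \<Longrightarrow> V \<omega> \<le> f \<omega>"
  shows "expectation V \<le> outer_exp M f"
  unfolding outer_exp_def
proof (rule cInf_greatest, goal_cases)
  case 1
  have "integrable M (\<lambda>_. b) \<and> (\<forall>\<omega>\<in>space M. f \<omega> \<le> b)" using f by simp
  then show ?case by blast
next
  case (2 y)
  then obtain U where U: "y = integral\<^sup>L M U" "integrable M U" "\<And>\<omega>. \<omega> \<in> space M \<Longrightarrow> f \<omega> \<le> U \<omega>" by auto
  have "expectation V \<le> expectation U"
    using U V by (intro integral_mono) (auto intro: order_trans)
  then show ?case using U by simp
qed

lemma outer_exp_mono:
  assumes "\<And>\<omega>. \<omega> \<in> space M \<Longrightarrow> - b \<le> f \<omega>" "\<And>\<omega>. \<omega> \<in> space M \<Longrightarrow> f \<omega> \<le> g \<omega>" "\<And>\<omega>. \<omega> \<in> space M \<Longrightarrow> g \<omega> \<le> b"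
  shows "outer_exp M f \<le> outer_exp M g"
  unfolding outer_exp_def
proof (rule cInf_superset_mono)
  have "integrable M (\<lambda>_. b) \<and> (\<forall>\<omega>\<in>space M. g \<omega> \<le> b)" using assms by simp
  then show "{integral\<^sup>L M U |U. integrable M U \<and> (\<forall>\<omega>\<in>space M. g \<omega> \<le> U \<omega>)} \<noteq> {}" by blast
  show "{integral\<^sup>L M U |U. integrable M U \<and> (\<forall>\<omega>\<in>space M. g \<omega> \<le> U \<omega>)}
      \<subseteq> {integral\<^sup>L M U |U. integrable M U \<and> (\<forall>\<omega>\<in>space M. f \<omega> \<le> U \<omega>)}"
    using assms(2) by (blast intro: order_trans)
qed (rule bdd_below_outer_exp[OF assms(1)])

lemma outer_exp_approx:
  assumes e: "0 \<le> e" and f: "\<And>\<omega>. \<omega> \<in> space M \<Longrightarrow> \<bar>f \<omega>\<bar> \<le> b"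
    and g: "\<And>\<omega>. \<omega> \<in> space M \<Longrightarrow> \<bar>g \<omega>\<bar> \<le> b" "integrable M g"
    and fg: "nearly_surely \<delta> (\<lambda>\<omega>. \<bar>f \<omega> - g \<omega>\<bar> \<le> e)"
  shows "\<bar>outer_exp M f - expectation g\<bar> \<le> e + 2 * b * \<delta>"
proof -
  obtain E where E: "E \<in> events" "prob E \<le> \<delta>" and fg_E: "\<And>\<omega>. \<omega> \<in> space M - E \<Longrightarrow> \<bar>f \<omega> - g \<omega>\<bar> \<le> e"
    using fg unfolding nearly_surely_def by blast
  have integrable_E: "integrable M (indicator E :: _ \<Rightarrow> real)" using E by (simp add: emeasure_eq_measure)
  have bounds: "f \<omega> \<le> g \<omega> + e + 2 * b * indicator E \<omega>" "g \<omega> - e - 2 * b * indicator E \<omega> \<le> f \<omega>"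
    if "\<omega> \<in> space M" for \<omega>
    using f[OF that] g(1)[OF that] fg_E[of \<omega>] that e by (auto simp: indicator_def abs_le_iff)
  have "outer_exp M f \<le> (\<integral>\<omega>. g \<omega> + e + 2 * b * indicator E \<omega> \<partial>M)"
    by (rule outer_exp_le[of b]) (use f bounds g integrable_E in \<open>auto simp: abs_le_iff minus_le_iff\<close>)
  moreover have "(\<integral>\<omega>. g \<omega> - e - 2 * b * indicator E \<omega> \<partial>M) \<le> outer_exp M f"
    by (rule outer_exp_ge[of _ b]) (use f bounds g integrable_E in \<open>auto simp: abs_le_iff\<close>)
  ultimately have "\<bar>outer_exp M f - expectation g\<bar> \<le> e + 2 * b * prob E"
    using g integrable_E sets.Int_space_eq2[OF E(1)] by (simp add: prob_space)
  moreover obtain \<omega> where "\<omega> \<in> space M" using not_empty by blast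
  then have "0 \<le> b" using f order_trans[OF abs_ge_zero] by blast
  then have "2 * b * prob E \<le> 2 * b * \<delta>" using E(2) by (intro mult_left_mono) auto
  ultimately show ?thesis by linarith
qed

end

lemma bdd_above_sup_dist:
  assumes "f \<in> linf T" "g \<in> linf T"
  shows "bdd_above ((\<lambda>x. \<bar>f (fst x) (snd x) - g (fst x) (snd x)\<bar>) ` T)"
proof -
  obtain a b where a: "\<forall>(m, u)\<in>T. \<bar>f m u\<bar> \<le> a" and b: "\<forall>(m, u)\<in>T. \<bar>g m u\<bar> \<le> b"
    using assms unfolding linf_def bdd_above_def by fast
  show ?thesis
  proof (rule bdd_aboveI2[of _ _ "a + b"])
    fix x assume "x \<in> T"
    then have "\<bar>f (fst x) (snd x)\<bar> \<le> a" "\<bar>g (fst x) (snd x)\<bar> \<le> b" using a b by auto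
    then show "\<bar>f (fst x) (snd x) - g (fst x) (snd x)\<bar> \<le> a + b" by linarith
  qed
qed

lemma linfI: "(\<And>m u. (m, u) \<in> T \<Longrightarrow> \<bar>f m u\<bar> \<le> a) \<Longrightarrow> f \<in> linf T"
  unfolding linf_def by (intro CollectI bdd_aboveI2[of _ _ a]) auto

lemma abs_diff_le_sup_dist:
  assumes "f \<in> linf T" "g \<in> linf T" "(m, u) \<in> T" shows "\<bar>f m u - g m u\<bar> \<le> sup_dist T f g"
  unfolding sup_dist_def using cSUP_upper[OF assms(3) bdd_above_sup_dist[OF assms(1,2)]] by simp

lemma sup_dist_least:
  assumes "T \<noteq> {}" "\<And>m u. (m, u) \<in> T \<Longrightarrow> \<bar>f m u - g m u\<bar> \<le> c" shows "sup_dist T f g \<le> c"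
  unfolding sup_dist_def using assms by (intro cSUP_least) auto

lemma sup_dist_nonneg:
  assumes "T \<noteq> {}" "f \<in> linf T" "g \<in> linf T" shows "0 \<le> sup_dist T f g"
proof -
  obtain m u where "(m, u) \<in> T" using assms(1) by auto
  from abs_diff_le_sup_dist[OF assms(2,3) this] show ?thesis by linarith
qed

lemma sup_dist_self: "T \<noteq> {} \<Longrightarrow> sup_dist T f f = 0"
  by (simp add: sup_dist_def)

lemma sup_dist_commute: "sup_dist T f g = sup_dist T g f"
  by (simp add: sup_dist_def abs_minus_commute)

lemma sup_dist_triangle:
  assumes "T \<noteq> {}" "f \<in> linf T" "g \<in> linf T" "h \<in> linf T"
  shows "sup_dist T f h \<le> sup_dist T f g + sup_dist T g h"
proof (rule sup_dist_least[OF assms(1)])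
  fix m u assume "(m, u) \<in> T"
  from abs_diff_le_sup_dist[OF assms(2,3) this] abs_diff_le_sup_dist[OF assms(3,4) this]
  show "\<bar>f m u - h m u\<bar> \<le> sup_dist T f g + sup_dist T g h" by linarith
qed

definition bl_linf :: "(nat \<times> (real^'p)) set \<Rightarrow> real \<Rightarrow> real \<Rightarrow> ((nat \<Rightarrow> real^'p \<Rightarrow> real) \<Rightarrow> real) \<Rightarrow> bool" where
  "bl_linf T k b h \<longleftrightarrow> 0 \<le> k \<and> (\<forall>f\<in>linf T. \<bar>h f\<bar> \<le> b) \<and> (\<forall>f\<in>linf T. \<forall>g\<in>linf T. \<bar>h f - h g\<bar> \<le> k * sup_dist T f g)"

lemma bl_linfD:
  assumes "bl_linf T k b h"
  shows "0 \<le> k" "f \<in> linf T \<Longrightarrow> \<bar>h f\<bar> \<le> b" "f \<in> linf T \<Longrightarrow> g \<in> linf T \<Longrightarrow> \<bar>h f - h g\<bar> \<le> k * sup_dist T f g"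
  using assms by (simp_all add: bl_linf_def)

lemma bl_linf_uminus: "bl_linf T k b h \<Longrightarrow> bl_linf T k b (\<lambda>f. - h f)"
  by (simp add: bl_linf_def abs_minus_commute)

lemma bcont_linf_uminus: "bcont_linf T h \<Longrightarrow> bcont_linf T (\<lambda>f. - h f)"
  by (simp add: bcont_linf_def abs_minus_commute)

text \<open>Pasch--Hausdorff envelope: the largest \<open>k\<close>-Lipschitz minorant.\<close>
definition lower_env :: "(nat \<times> (real^'p)) set \<Rightarrow> real \<Rightarrow> ((nat \<Rightarrow> real^'p \<Rightarrow> real) \<Rightarrow> real)
    \<Rightarrow> (nat \<Rightarrow> real^'p \<Rightarrow> real) \<Rightarrow> real" where
  "lower_env T k h f = (INF g\<in>linf T. h g + k * sup_dist T f g)"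

context
  fixes T :: "(nat \<times> (real^'p)) set" and h :: "(nat \<Rightarrow> real^'p \<Rightarrow> real) \<Rightarrow> real" and b :: real
  assumes T: "T \<noteq> {}" and h: "\<And>f. f \<in> linf T \<Longrightarrow> \<bar>h f\<bar> \<le> b"
begin

lemma lower_env_term_ge:
  assumes "0 \<le> k" "f \<in> linf T" "g \<in> linf T" shows "- b \<le> h g + k * sup_dist T f g"
  using mult_nonneg_nonneg[OF assms(1) sup_dist_nonneg[OF T assms(2,3)]] h[OF assms(3)] by linarith

lemma bdd_below_lower_env:
  assumes "0 \<le> k" "f \<in> linf T" shows "bdd_below ((\<lambda>g. h g + k * sup_dist T f g) ` linf T)"
  using lower_env_term_ge[OF assms] by (rule bdd_belowI2)

lemma lower_env_le: "0 \<le> k \<Longrightarrow> f \<in> linf T \<Longrightarrow> lower_env T k h f \<le> h f"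
  unfolding lower_env_def using cINF_lower[OF bdd_below_lower_env, of k f f] by (simp add: sup_dist_self[OF T])

lemma abs_lower_env_le:
  assumes "0 \<le> k" "f \<in> linf T" shows "\<bar>lower_env T k h f\<bar> \<le> b"
proof -
  have "- b \<le> lower_env T k h f"
    unfolding lower_env_def using assms by (intro cINF_greatest lower_env_term_ge) auto
  then show ?thesis using lower_env_le[OF assms] h[OF assms(2)] by linarith
qed

lemma lower_env_le_add:
  assumes k: "0 \<le> k" and f: "f \<in> linf T" and g: "g \<in> linf T"
  shows "lower_env T k h f \<le> lower_env T k h g + k * sup_dist T f g"
proof -
  have "lower_env T k h f - k * sup_dist T f g \<le> lower_env T k h g"
    unfolding lower_env_def[of T k h g]
  proof (rule cINF_greatest)
    show "linf T \<noteq> {}" using f by blast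
    fix w assume w: "w \<in> linf T"
    have "lower_env T k h f \<le> h w + k * sup_dist T f w"
      unfolding lower_env_def by (rule cINF_lower[OF bdd_below_lower_env[OF k f] w])
    moreover have "k * sup_dist T f w \<le> k * (sup_dist T f g + sup_dist T g w)"
      using sup_dist_triangle[OF T f g w] k by (rule mult_left_mono)
    ultimately show "lower_env T k h f - k * sup_dist T f g \<le> h w + k * sup_dist T g w"
      by (simp add: distrib_left)
  qed
  then show ?thesis by simp
qed

lemma bl_linf_lower_env: "0 \<le> k \<Longrightarrow> bl_linf T k b (lower_env T k h)"
  unfolding bl_linf_def using abs_lower_env_le lower_env_le_add
  by (auto simp: abs_le_iff) (metis add.commute diff_le_eq sup_dist_commute)+

lemma lower_env_tendsto:
  assumes cont: "bcont_linf T h" and f: "f \<in> linf T"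
  shows "(\<lambda>k. lower_env T (real k) h f) \<longlonglongrightarrow> h f"
proof (rule LIMSEQ_I)
  fix e :: real assume e: "0 < e"
  obtain d where d: "0 < d" "\<And>g. g \<in> linf T \<Longrightarrow> sup_dist T f g < d \<Longrightarrow> \<bar>h f - h g\<bar> < e / 2"
    using cont f e unfolding bcont_linf_def by (meson half_gt_zero)
  obtain k0 :: nat where k0: "2 * b / d \<le> real k0" using real_arch_simple by blast
  have "norm (lower_env T (real k) h f - h f) < e" if "k0 \<le> k" for k
  proof -
    have "2 * b / d \<le> real k" using k0 that by linarith
    then have large_k: "2 * b \<le> real k * d" using d by (simp add: divide_le_eq)
    have "h f - e / 2 \<le> h g + real k * sup_dist T f g" if g: "g \<in> linf T" for g
    proof (cases "sup_dist T f g < d")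
      case True
      have "0 \<le> real k * sup_dist T f g" using sup_dist_nonneg[OF T f g] by simp
      then show ?thesis using d(2)[OF g True] by linarith
    next
      case False
      then have "real k * d \<le> real k * sup_dist T f g" by (intro mult_left_mono) auto
      then show ?thesis using large_k h[OF f] h[OF g] e by linarith
    qed
    then have "h f - e / 2 \<le> lower_env T (real k) h f"
      unfolding lower_env_def using f by (intro cINF_greatest) auto
    then show ?thesis using lower_env_le[OF of_nat_0_le_iff f, of k] e by simp
  qed
  then show "\<exists>no. \<forall>k\<ge>no. norm (lower_env T (real k) h f - h f) < e" by blast
qed

end

locale bl_convergence = P: prob_space P + N: prob_space N
  for P :: "'a measure" and N :: "'b measure" +
  fixes T :: "(nat \<times> (real^'p)) set" and X :: "nat \<Rightarrow> 'a \<Rightarrow> nat \<Rightarrow> real^'p \<Rightarrow> real" and G :: "'b \<Rightarrow> nat \<Rightarrow> real^'p \<Rightarrow> real"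
  assumes T_nonempty: "T \<noteq> {}"
    and X_linf: "\<And>n \<omega>. \<omega> \<in> space P \<Longrightarrow> X n \<omega> \<in> linf T" and G_linf: "\<And>\<omega>. \<omega> \<in> space N \<Longrightarrow> G \<omega> \<in> linf T"
    and measurable_bl: "\<And>k b h. bl_linf T k b h \<Longrightarrow> (\<lambda>\<omega>. h (G \<omega>)) \<in> borel_measurable N"
    and bl_tendsto: "\<And>k b h. bl_linf T k b h \<Longrightarrow>
        (\<lambda>n. outer_exp P (\<lambda>\<omega>. h (X n \<omega>))) \<longlonglongrightarrow> (\<integral>\<omega>. h (G \<omega>) \<partial>N)"
begin

lemma lower_env_expectation_tendsto:
  assumes h: "bcont_linf T h"
  shows "(\<lambda>\<omega>. h (G \<omega>)) \<in> borel_measurable N"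
    "(\<lambda>k. \<integral>\<omega>. lower_env T (real k) h (G \<omega>) \<partial>N) \<longlonglongrightarrow> (\<integral>\<omega>. h (G \<omega>) \<partial>N)"
proof -
  obtain b where b: "\<And>f. f \<in> linf T \<Longrightarrow> \<bar>h f\<bar> \<le> b" using h unfolding bcont_linf_def by blast
  have lim: "(\<lambda>k. lower_env T (real k) h (G \<omega>)) \<longlonglongrightarrow> h (G \<omega>)" if "\<omega> \<in> space N" for \<omega>
    by (rule lower_env_tendsto[OF T_nonempty b h G_linf[OF that]])
  have env: "(\<lambda>\<omega>. lower_env T (real k) h (G \<omega>)) \<in> borel_measurable N" for k
    by (rule measurable_bl[OF bl_linf_lower_env[OF T_nonempty b]]) simp_all
  then show hm: "(\<lambda>\<omega>. h (G \<omega>)) \<in> borel_measurable N"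
    using lim by (rule borel_measurable_LIMSEQ_metric)
  show "(\<lambda>k. \<integral>\<omega>. lower_env T (real k) h (G \<omega>) \<partial>N) \<longlonglongrightarrow> (\<integral>\<omega>. h (G \<omega>) \<partial>N)"
    by (rule integral_dominated_convergence[where w = "\<lambda>_. b"])
      (use hm env lim abs_lower_env_le[where h = h, OF T_nonempty b of_nat_0_le_iff G_linf] in auto)
qed

lemma eventually_less_outer_exp:
  assumes h: "bcont_linf T h" and a: "a < (\<integral>\<omega>. h (G \<omega>) \<partial>N)"
  shows "eventually (\<lambda>n. a < outer_exp P (\<lambda>\<omega>. h (X n \<omega>))) sequentially"
proof -
  obtain b where b: "\<And>f. f \<in> linf T \<Longrightarrow> \<bar>h f\<bar> \<le> b" using h unfolding bcont_linf_def by blast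
  note env = T_nonempty b of_nat_0_le_iff
  from order_tendstoD(1)[OF lower_env_expectation_tendsto(2)[OF h] a]
  obtain k where k: "a < (\<integral>\<omega>. lower_env T (real k) h (G \<omega>) \<partial>N)" by (auto simp: eventually_sequentially)
  have "outer_exp P (\<lambda>\<omega>. lower_env T (real k) h (X n \<omega>)) \<le> outer_exp P (\<lambda>\<omega>. h (X n \<omega>))" for n
    by (rule P.outer_exp_mono[of b])
      (use abs_lower_env_le[where h = h, OF env X_linf] lower_env_le[where h = h, OF env X_linf] b[OF X_linf]
        in \<open>auto simp: abs_le_iff minus_le_iff\<close>)
  with order_tendstoD(1)[OF bl_tendsto[OF bl_linf_lower_env[where h = h, OF env]] k]
  show ?thesis by (auto elim!: eventually_mono intro: less_le_trans)
qed

lemma eventually_outer_exp_less: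
  assumes h: "bcont_linf T h" and a: "(\<integral>\<omega>. h (G \<omega>) \<partial>N) < a"
  shows "eventually (\<lambda>n. outer_exp P (\<lambda>\<omega>. h (X n \<omega>)) < a) sequentially"
proof -
  let ?h = "\<lambda>f. - h f"
  let ?up = "\<lambda>k f. - lower_env T (real k) ?h f"
  obtain b where b: "\<And>f. f \<in> linf T \<Longrightarrow> \<bar>h f\<bar> \<le> b" using h unfolding bcont_linf_def by blast
  then have h_bound: "\<And>f. f \<in> linf T \<Longrightarrow> \<bar>?h f\<bar> \<le> b" by simp
  note env = T_nonempty h_bound of_nat_0_le_iff
  have "- a < (\<integral>\<omega>. ?h (G \<omega>) \<partial>N)" using a by simp
  from order_tendstoD(1)[OF lower_env_expectation_tendsto(2)[OF bcont_linf_uminus[OF h]] this]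
  obtain k where "- a < (\<integral>\<omega>. lower_env T (real k) ?h (G \<omega>) \<partial>N)" by (auto simp: eventually_sequentially)
  then have k: "(\<integral>\<omega>. ?up k (G \<omega>) \<partial>N) < a" by simp
  have "outer_exp P (\<lambda>\<omega>. h (X n \<omega>)) \<le> outer_exp P (\<lambda>\<omega>. ?up k (X n \<omega>))" for n
    by (rule P.outer_exp_mono[of b])
      (use abs_lower_env_le[where h = ?h, OF env X_linf] lower_env_le[where h = ?h, OF env X_linf] b[OF X_linf]
        in \<open>auto simp: abs_le_iff minus_le_iff le_minus_iff\<close>)
  with order_tendstoD(2)[OF bl_tendsto[OF bl_linf_uminus[OF bl_linf_lower_env[where h = ?h, OF env]]] k]
  show ?thesis by (auto elim!: eventually_mono intro: le_less_trans)
qed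

text \<open>Every bounded continuous function is a monotone limit of Lipschitz ones from either side, so testing against
  Lipschitz functions suffices; no tightness is needed.\<close>
lemma weak_conv: "weak_conv_linf T P X N G"
  unfolding weak_conv_linf_def
  by (intro allI impI conjI order_tendstoI lower_env_expectation_tendsto(1) eventually_less_outer_exp eventually_outer_exp_less)

end

locale linf_approximation = P: prob_space P + N: prob_space N
  for P :: "'a measure" and N :: "'b measure" +
  fixes T :: "(nat \<times> (real^'p)) set" and X :: "nat \<Rightarrow> 'a \<Rightarrow> nat \<Rightarrow> real^'p \<Rightarrow> real" and G :: "'b \<Rightarrow> nat \<Rightarrow> real^'p \<Rightarrow> real"
    and X\<^sub>a :: "nat \<Rightarrow> nat \<Rightarrow> 'a \<Rightarrow> nat \<Rightarrow> real^'p \<Rightarrow> real" and G\<^sub>a :: "nat \<Rightarrow> 'b \<Rightarrow> nat \<Rightarrow> real^'p \<Rightarrow> real"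
  assumes T_nonempty: "T \<noteq> {}"
    and X_linf: "\<And>n \<omega>. \<omega> \<in> space P \<Longrightarrow> X n \<omega> \<in> linf T" and G_linf: "\<And>\<omega>. \<omega> \<in> space N \<Longrightarrow> G \<omega> \<in> linf T"
    and Xa_linf: "\<And>l n \<omega>. \<omega> \<in> space P \<Longrightarrow> X\<^sub>a l n \<omega> \<in> linf T" and Ga_linf: "\<And>l \<omega>. \<omega> \<in> space N \<Longrightarrow> G\<^sub>a l \<omega> \<in> linf T"
    and measurable_Xa: "\<And>k b h l n. bl_linf T k b h \<Longrightarrow> (\<lambda>\<omega>. h (X\<^sub>a l n \<omega>)) \<in> borel_measurable P"
    and measurable_Ga: "\<And>k b h l. bl_linf T k b h \<Longrightarrow> (\<lambda>\<omega>. h (G\<^sub>a l \<omega>)) \<in> borel_measurable N"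
    and Xa_tendsto: "\<And>k b h l. bl_linf T k b h \<Longrightarrow>
        (\<lambda>n. P.expectation (\<lambda>\<omega>. h (X\<^sub>a l n \<omega>))) \<longlonglongrightarrow> N.expectation (\<lambda>\<omega>. h (G\<^sub>a l \<omega>))"
    and Ga_tendsto: "\<And>\<omega>. \<omega> \<in> space N \<Longrightarrow> (\<lambda>l. sup_dist T (G\<^sub>a l \<omega>) (G \<omega>)) \<longlonglongrightarrow> 0"
    and Xa_close: "\<And>\<eta>. 0 < \<eta> \<Longrightarrow> eventually (\<lambda>l. eventually (\<lambda>n.
        P.nearly_surely \<eta> (\<lambda>\<omega>. sup_dist T (X n \<omega>) (X\<^sub>a l n \<omega>) \<le> \<eta>)) sequentially) sequentially"
begin

lemma bl_Ga_tendsto: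
  assumes h: "bl_linf T k b h" and \<omega>: "\<omega> \<in> space N"
  shows "(\<lambda>l. h (G\<^sub>a l \<omega>)) \<longlonglongrightarrow> h (G \<omega>)"
proof -
  have "(\<lambda>l. k * sup_dist T (G\<^sub>a l \<omega>) (G \<omega>)) \<longlonglongrightarrow> k * 0"
    by (intro tendsto_intros Ga_tendsto \<omega>)
  then have lim: "(\<lambda>l. k * sup_dist T (G\<^sub>a l \<omega>) (G \<omega>)) \<longlonglongrightarrow> 0" by simp
  have "(\<lambda>l. h (G\<^sub>a l \<omega>) - h (G \<omega>)) \<longlonglongrightarrow> 0"
    using bl_linfD(3)[OF h Ga_linf[OF \<omega>] G_linf[OF \<omega>]]
    by (intro Lim_null_comparison[OF always_eventually lim]) simp
  then show ?thesis by (simp add: LIM_zero_iff)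
qed

lemma measurable_bl_G: "bl_linf T k b h \<Longrightarrow> (\<lambda>\<omega>. h (G \<omega>)) \<in> borel_measurable N"
  using measurable_Ga bl_Ga_tendsto by (rule borel_measurable_LIMSEQ_metric)

lemma expectation_Ga_tendsto:
  assumes h: "bl_linf T k b h"
  shows "(\<lambda>l. N.expectation (\<lambda>\<omega>. h (G\<^sub>a l \<omega>))) \<longlonglongrightarrow> N.expectation (\<lambda>\<omega>. h (G \<omega>))"
  by (rule integral_dominated_convergence[where w = "\<lambda>_. b"])
    (use measurable_bl_G[OF h] measurable_Ga[OF h] bl_Ga_tendsto[OF h] bl_linfD(2)[OF h Ga_linf] in auto)

lemma abs_outer_exp_diff_le:
  assumes h: "bl_linf T k b h" and close: "P.nearly_surely \<eta> (\<lambda>\<omega>. sup_dist T (X n \<omega>) (X\<^sub>a l n \<omega>) \<le> \<eta>)" and \<eta>: "0 < \<eta>"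
  shows "\<bar>outer_exp P (\<lambda>\<omega>. h (X n \<omega>)) - P.expectation (\<lambda>\<omega>. h (X\<^sub>a l n \<omega>))\<bar> \<le> (k + 2 * b) * \<eta>"
proof -
  have "P.nearly_surely \<eta> (\<lambda>\<omega>. \<bar>h (X n \<omega>) - h (X\<^sub>a l n \<omega>)\<bar> \<le> k * \<eta>)"
  proof (rule P.nearly_surely_mono[OF close order_refl])
    fix \<omega> assume \<omega>: "\<omega> \<in> space P" and le: "sup_dist T (X n \<omega>) (X\<^sub>a l n \<omega>) \<le> \<eta>"
    have "\<bar>h (X n \<omega>) - h (X\<^sub>a l n \<omega>)\<bar> \<le> k * sup_dist T (X n \<omega>) (X\<^sub>a l n \<omega>)"
      by (rule bl_linfD(3)[OF h X_linf[OF \<omega>] Xa_linf[OF \<omega>]])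
    also have "\<dots> \<le> k * \<eta>" using le bl_linfD(1)[OF h] by (rule mult_left_mono)
    finally show "\<bar>h (X n \<omega>) - h (X\<^sub>a l n \<omega>)\<bar> \<le> k * \<eta>" .
  qed
  moreover have "integrable P (\<lambda>\<omega>. h (X\<^sub>a l n \<omega>))"
    by (rule P.integrable_const_bound[of _ b]) (use measurable_Xa[OF h] bl_linfD(2)[OF h Xa_linf] in auto)
  ultimately have "\<bar>outer_exp P (\<lambda>\<omega>. h (X n \<omega>)) - P.expectation (\<lambda>\<omega>. h (X\<^sub>a l n \<omega>))\<bar> \<le> k * \<eta> + 2 * b * \<eta>"
    using bl_linfD(1)[OF h] \<eta> bl_linfD(2)[OF h X_linf] bl_linfD(2)[OF h Xa_linf]
    by (intro P.outer_exp_approx) auto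
  then show ?thesis by (simp add: distrib_right)
qed

lemma bl_outer_exp_tendsto:
  assumes h: "bl_linf T k b h"
  shows "(\<lambda>n. outer_exp P (\<lambda>\<omega>. h (X n \<omega>))) \<longlonglongrightarrow> N.expectation (\<lambda>\<omega>. h (G \<omega>))"
proof (rule LIMSEQ_I)
  fix \<epsilon> :: real assume "0 < \<epsilon>"
  then have \<epsilon>3: "0 < \<epsilon> / 3" by simp
  obtain \<eta> where \<eta>: "0 < \<eta>" "(k + 2 * b) * \<eta> \<le> \<epsilon> / 3"
    using exists_pos_mult_le[OF \<epsilon>3] by blast
  obtain l where l: "\<bar>N.expectation (\<lambda>\<omega>. h (G\<^sub>a l \<omega>)) - N.expectation (\<lambda>\<omega>. h (G \<omega>))\<bar> < \<epsilon> / 3"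
    and close: "eventually (\<lambda>n. P.nearly_surely \<eta> (\<lambda>\<omega>. sup_dist T (X n \<omega>) (X\<^sub>a l n \<omega>) \<le> \<eta>)) sequentially"
    using eventually_happens[OF eventually_conj[OF tendstoD[OF expectation_Ga_tendsto[OF h] \<epsilon>3] Xa_close[OF \<eta>(1)]]]
    by (auto simp: dist_real_def)
  have "eventually (\<lambda>n. dist (P.expectation (\<lambda>\<omega>. h (X\<^sub>a l n \<omega>))) (N.expectation (\<lambda>\<omega>. h (G\<^sub>a l \<omega>))) < \<epsilon> / 3) sequentially"
    using Xa_tendsto[OF h] \<epsilon>3 by (rule tendstoD)
  with close have "eventually (\<lambda>n. norm (outer_exp P (\<lambda>\<omega>. h (X n \<omega>)) - N.expectation (\<lambda>\<omega>. h (G \<omega>))) < \<epsilon>) sequentially"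
  proof eventually_elim
    case (elim n)
    show ?case
      using abs_outer_exp_diff_le[OF h elim(1) \<eta>(1)] elim(2) \<eta>(2) l unfolding dist_real_def real_norm_def by linarith
  qed
  then show "\<exists>no. \<forall>n\<ge>no. norm (outer_exp P (\<lambda>\<omega>. h (X n \<omega>)) - N.expectation (\<lambda>\<omega>. h (G \<omega>))) < \<epsilon>"
    by (simp add: eventually_sequentially)
qed

sublocale bl_convergence P N T X G
  by unfold_locales (rule T_nonempty X_linf G_linf measurable_bl_G bl_outer_exp_tendsto; assumption)+

end

section \<open>The limit process\<close>

context gaussian_kernel
begin

definition path_copies :: "(nat \<Rightarrow> real^'p \<Rightarrow> real) measure" where
  "path_copies = Pi\<^sub>M UNIV (\<lambda>_. path_measure)"

lemma prob_space_path_copies: "prob_space path_copies"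
  unfolding path_copies_def by (rule prob_space_PiM) (rule prob_space_path_measure)

lemma continuous_on_path_copies: "\<omega> \<in> space path_copies \<Longrightarrow> continuous_on unit_cube (\<omega> m)"
  using sets_eq_imp_space_eq[OF sets_path_measure] space_path_space
  by (auto simp: path_copies_def space_PiM PiE_iff)

lemma measurable_copy: "(\<lambda>\<omega>. \<omega> m) \<in> measurable path_copies path_measure"
  unfolding path_copies_def by measurable

lemma measurable_path_measure_eval: "u \<in> unit_cube \<Longrightarrow> (\<lambda>f. f u) \<in> borel_measurable path_measure"
  using measurable_path_space_eval by (simp cong: measurable_cong_sets add: sets_path_measure)

lemma measurable_copy_eval: "u \<in> unit_cube \<Longrightarrow> (\<lambda>\<omega>. \<omega> m u) \<in> borel_measurable path_copies"
  by (rule measurable_compose[OF measurable_copy measurable_path_measure_eval])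

lemma indep_copies: "prob_space.indep_vars path_copies (\<lambda>_. path_measure) (\<lambda>m \<omega>. \<omega> m) UNIV"
  unfolding path_copies_def by (rule indep_vars_PiM_coords) (rule prob_space_path_measure)

lemma indep_restrict_copies:
  "prob_space.indep_vars path_copies (\<lambda>_. Pi\<^sub>M unit_cube (\<lambda>_. borel)) (\<lambda>m \<omega>. restrict (\<omega> m) unit_cube) I"
proof -
  interpret prob_space path_copies by (rule prob_space_path_copies)
  have "(\<lambda>f. restrict f unit_cube) \<in> measurable path_measure (Pi\<^sub>M unit_cube (\<lambda>_. borel))"
    using measurable_restrict_path_space by (simp cong: measurable_cong_sets add: sets_path_measure)
  from indep_vars_compose2[OF indep_copies this] show ?thesis
    by (rule indep_vars_subset) simp
qed

lemma measurable_cis_path_combination: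
  assumes "S \<subseteq> unit_cube"
  shows "(\<lambda>f. cis (\<Sum>u\<in>S. c u * f u)) \<in> borel_measurable path_measure"
  using assms by (intro borel_measurable_cis borel_measurable_sum borel_measurable_times measurable_path_measure_eval) auto

lemma expectation_cis_copy:
  assumes S: "finite S" "S \<subseteq> unit_cube"
  shows "(\<integral>\<omega>. cis (\<Sum>u\<in>S. c u * \<omega> m u) \<partial>path_copies) = exp (- (\<Sum>u\<in>S. \<Sum>v\<in>S. c u * c v * K u v) / 2)"
proof -
  have "(\<integral>\<omega>. cis (\<Sum>u\<in>S. c u * \<omega> m u) \<partial>path_copies)
      = (\<integral>f. cis (\<Sum>u\<in>S. c u * f u) \<partial>distr path_copies path_measure (\<lambda>\<omega>. \<omega> m))"
    by (rule integral_distr[OF measurable_copy measurable_cis_path_combination[OF S(2)], symmetric])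
  also have "distr path_copies path_measure (\<lambda>\<omega>. \<omega> m) = path_measure"
    unfolding path_copies_def by (rule distr_PiM_component) (auto intro: prob_space_path_measure)
  finally show ?thesis by (simp only: expectation_cis_path_measure[OF S])
qed

lemma expectation_cis_copies:
  assumes S: "finite S" "S \<subseteq> unit_cube"
  shows "(\<integral>\<omega>. cis (\<Sum>m\<le>M. \<Sum>u\<in>S. c m u * \<omega> m u) \<partial>path_copies)
    = exp (- (\<Sum>m\<le>M. \<Sum>u\<in>S. \<Sum>v\<in>S. c m u * c m v * K u v) / 2)"
proof -
  interpret prob_space path_copies by (rule prob_space_path_copies)
  let ?g = "\<lambda>m f. cis (\<Sum>u\<in>S. c m u * f u)" and ?v = "\<lambda>m. \<Sum>u\<in>S. \<Sum>v\<in>S. c m u * c m v * K u v"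
  note g = measurable_cis_path_combination[OF S(2)]
  have "indep_vars (\<lambda>_. borel) (\<lambda>m \<omega>. ?g m (\<omega> m)) UNIV"
    by (rule indep_vars_compose2[OF indep_copies g])
  then have ind: "indep_vars (\<lambda>_. borel) (\<lambda>m \<omega>. ?g m (\<omega> m)) {..M}" by (rule indep_vars_subset) simp
  have int: "integrable path_copies (\<lambda>\<omega>. ?g m (\<omega> m))" for m
    using measurable_compose[OF measurable_copy g] by (intro integrable_const_bound[of _ 1]) auto
  have "expectation (\<lambda>\<omega>. cis (\<Sum>m\<le>M. \<Sum>u\<in>S. c m u * \<omega> m u)) = (\<Prod>m\<le>M. expectation (\<lambda>\<omega>. ?g m (\<omega> m)))"
    unfolding cis_sum[of _ "{..M}"] by (rule indep_vars_lebesgue_integral[OF _ ind int]) simp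
  also have "\<dots> = complex_of_real (\<Prod>m\<le>M. exp (- ?v m / 2))"
    by (simp add: expectation_cis_copy[OF S])
  also have "(\<Prod>m\<le>M. exp (- ?v m / 2)) = exp (- (\<Sum>m\<le>M. ?v m) / 2)"
    by (subst exp_sum[symmetric]) (simp_all add: sum_negf sum_divide_distrib)
  finally show ?thesis .
qed

lemma centered_gaussian_process_copy: "centered_gaussian_process path_copies (\<lambda>\<omega>. \<omega> m) unit_cube K"
  by (intro prob_space.centered_gaussian_process_of_cf[OF prob_space_path_copies]
      measurable_copy_eval psd_kernel_sym[OF psd] expectation_cis_copy)

lemma copy_second_moment:
  assumes "u \<in> unit_cube"
  shows "integrable path_copies (\<lambda>\<omega>. (\<omega> m u)\<^sup>2)" "(\<integral>\<omega>. (\<omega> m u)\<^sup>2 \<partial>path_copies) = K u u"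
  using centered_gaussian_process_copy[of m] assms
  unfolding centered_gaussian_process_def power2_eq_square by blast+

end

context copula_sample
begin

lemma psd_cov: "psd_kernel cov"
  unfolding psd_kernel_def
proof (intro conjI allI)
  show "cov u v = cov v u" for u v by (simp add: cov_def min.commute mult_ac)
  fix n :: nat and c :: "nat \<Rightarrow> real" and x :: "nat \<Rightarrow> real^'p"
  have "\<bar>\<Sum>i<n. c i * orthant F A (x i) s\<bar> \<le> (\<Sum>i<n. \<bar>c i\<bar>)" for s :: "(real^'p) \<times> (real^'q)"
    by (intro order_trans[OF sum_abs] sum_mono) (simp add: abs_mult abs_orthant_le mult_left_le)
  then show "0 \<le> (\<Sum>i<n. \<Sum>j<n. c i * c j * cov (x i) (x j))"
    unfolding evar_orthant_sum[symmetric] by (intro evar_nonneg) measurable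
qed

sublocale gaussian_kernel cov
  using psd_cov cov_increment_le continuous_on_cov by unfold_locales

lemma cov_diag_le: "cov u u \<le> moment_bound"
proof -
  have "(\<chi> k. min (u $ k) (u $ k)) = u" by (simp add: vec_eq_iff)
  then have "cov u u = p * C u - (p * C u)\<^sup>2" by (simp add: cov_def power2_eq_square mult_ac)
  also have "\<dots> \<le> p * C u" by simp
  also have "\<dots> \<le> 1 * 1" using p_le_1 C_01[of u] by (intro mult_mono) auto
  also have "\<dots> \<le> moment_bound"
    using exp_ge_add_one_self[of "1 / 2"] unfolding moment_bound_def by linarith
  finally show ?thesis .
qed

lemma cf_W_tendsto:
  assumes S: "finite S" "S \<subseteq> unit_cube"
  shows "(\<lambda>n. expectation (\<lambda>\<omega>. cis (\<Sum>m\<le>M. \<Sum>u\<in>S. t m u * W n m \<omega> u)))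
    \<longlonglongrightarrow> (\<integral>\<omega>. cis (\<Sum>m\<le>M. \<Sum>u\<in>S. t m u * \<omega> m u) \<partial>path_copies)"
proof -
  define y where "y m s = (\<Sum>u\<in>S. t (min m M) u * orthant F A u s)" for m s
  define c where "c = 1 + (\<Sum>m\<le>M. \<Sum>u\<in>S. \<bar>t m u\<bar>)"
  have y: "y m \<in> borel_measurable borel" for m
    unfolding y_def[abs_def] by measurable
  have bound: "\<bar>y m s\<bar> \<le> c" for m s
  proof -
    have "\<bar>y m s\<bar> \<le> (\<Sum>u\<in>S. \<bar>t (min m M) u\<bar>)"
      unfolding y_def by (intro order_trans[OF sum_abs] sum_mono) (simp add: abs_mult abs_orthant_le mult_left_le)
    also have "\<dots> \<le> (\<Sum>m\<le>M. \<Sum>u\<in>S. \<bar>t m u\<bar>)"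
      by (rule member_le_sum) (auto intro: sum_nonneg)
    finally show ?thesis by (simp add: c_def)
  qed
  have "0 < c" unfolding c_def by (intro add_pos_nonneg sum_nonneg) auto
  from cf_sum_proc_tendsto[OF y bound this, where M = M]
  have "(\<lambda>n. expectation (\<lambda>\<omega>. cis (\<Sum>m\<le>M. proc n m (y m) \<omega>))) \<longlonglongrightarrow> exp (- (\<Sum>m\<le>M. evar (y m)) / 2)" .
  moreover have "proc n m (y m) \<omega> = (\<Sum>u\<in>S. t m u * W n m \<omega> u)" if "m \<le> M" for n m \<omega>
    using that proc_sum[OF measurable_orthant abs_orthant_le] by (simp add: y_def[abs_def])
  moreover have "evar (y m) = (\<Sum>u\<in>S. \<Sum>v\<in>S. t m u * t m v * cov u v)" if "m \<le> M" for m
    using that evar_orthant_sum[of "t m" "\<lambda>u. u" S] by (simp add: y_def[abs_def])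
  ultimately show ?thesis by (simp add: expectation_cis_copies[OF S])
qed

lemma fidi_tendsto:
  assumes S: "finite S" "S \<subseteq> unit_cube"
    and f: "lipschitz_coords ({..M} \<times> S) L f" and b: "\<And>x. \<bar>f x\<bar> \<le> b"
  shows "(\<lambda>n. expectation (\<lambda>\<omega>. f (\<lambda>i. W n (fst i) \<omega> (snd i)))) \<longlonglongrightarrow> (\<integral>\<omega>. f (\<lambda>i. \<omega> (fst i) (snd i)) \<partial>path_copies)"
proof (rule expectation_lipschitz_coords_tendsto[OF prob_space_axioms prob_space_path_copies _ f b,
      where c = moment_bound])
  show "(\<lambda>n. expectation (\<lambda>\<omega>. cis (\<Sum>i\<in>{..M} \<times> S. t i * W n (fst i) \<omega> (snd i))))
      \<longlonglongrightarrow> (\<integral>\<omega>. cis (\<Sum>i\<in>{..M} \<times> S. t i * \<omega> (fst i) (snd i)) \<partial>path_copies)" for t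
    using cf_W_tendsto[OF S, where M = M and t = "\<lambda>m u. t (m, u)"] by (simp add: sum.cartesian_product' split_beta)
  fix i assume i: "i \<in> {..M} \<times> S"
  then have u: "snd i \<in> unit_cube" using S(2) by auto
  show "(\<lambda>\<omega>. W n (fst i) \<omega> (snd i)) \<in> borel_measurable P" for n by measurable
  show "(\<lambda>\<omega>. \<omega> (fst i) (snd i)) \<in> borel_measurable path_copies" by (rule measurable_copy_eval[OF u])
  show "integrable P (\<lambda>\<omega>. (W n (fst i) \<omega> (snd i))\<^sup>2) \<and> expectation (\<lambda>\<omega>. (W n (fst i) \<omega> (snd i))\<^sup>2) \<le> moment_bound" for n
    using proc_second_moment[OF measurable_orthant abs_orthant_le] by blast
  show "integrable path_copies (\<lambda>\<omega>. (\<omega> (fst i) (snd i))\<^sup>2) \<and> (\<integral>\<omega>. (\<omega> (fst i) (snd i))\<^sup>2 \<partial>path_copies) \<le> moment_bound"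
    using copy_second_moment[OF u] cov_diag_le by simp
qed (use S in simp)

definition linearized :: "(nat \<Rightarrow> real^'p \<Rightarrow> real) \<Rightarrow> nat \<Rightarrow> real^'p \<Rightarrow> real" where
  "linearized b m u = Cinf p C dC (b m) u"

definition coarsen :: "nat \<Rightarrow> (nat \<Rightarrow> real^'p \<Rightarrow> real) \<Rightarrow> nat \<Rightarrow> real^'p \<Rightarrow> real" where
  "coarsen l b m u = b m (dyadic_floor l u)"

context
  fixes M :: nat
begin

abbreviation T :: "(nat \<times> (real^'p)) set" where "T \<equiv> {0..M} \<times> unit_cube"

lemma T_nonempty: "T \<noteq> {}"
  using one_in_unit_cube by auto

lemma linearized_linf:
  assumes "\<And>m u. (m, u) \<in> T \<Longrightarrow> \<bar>b m u\<bar> \<le> a"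
  shows "linearized b \<in> linf T"
  unfolding linearized_def using assms by (intro linfI[of _ _ "Cinf_bound * a"] abs_Cinf_le) auto

lemma sup_dist_linearized_le:
  assumes "\<And>m u. (m, u) \<in> T \<Longrightarrow> \<bar>b m u - b' m u\<bar> \<le> a"
  shows "sup_dist T (linearized b) (linearized b') \<le> Cinf_bound * a"
  unfolding linearized_def Cinf_diff
  using assms by (intro sup_dist_least[OF T_nonempty]) (auto simp: Cinf_diff intro!: abs_Cinf_le)

lemma linearized_coarsen_linf: "linearized (coarsen l b) \<in> linf T"
proof (rule linearized_linf)
  fix m u assume mu: "(m, u) \<in> T"
  have "\<bar>b m (dyadic_floor l u)\<bar> \<le> (\<Sum>i\<in>{0..M} \<times> dyadic_grid l. \<bar>b (fst i) (snd i)\<bar>)"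
    using mu by (intro member_le_sum[of "(m, dyadic_floor l u)" _ "\<lambda>i. \<bar>b (fst i) (snd i)\<bar>", simplified])
      (auto simp: finite_dyadic_grid dyadic_floor_in_grid)
  then show "\<bar>coarsen l b m u\<bar> \<le> (\<Sum>i\<in>{0..M} \<times> dyadic_grid l. \<bar>b (fst i) (snd i)\<bar>)"
    by (simp add: coarsen_def)
qed

lemma linearized_copies_linf:
  assumes "\<omega> \<in> space path_copies" shows "linearized \<omega> \<in> linf T"
proof -
  have "\<exists>a. \<forall>u\<in>unit_cube. \<bar>\<omega> m u\<bar> \<le> a" for m
    using compact_imp_bounded[OF compact_continuous_image[OF continuous_on_path_copies[OF assms] compact_unit_cube]]
    by (auto simp: bounded_iff)
  then obtain a where a: "\<And>m u. u \<in> unit_cube \<Longrightarrow> \<bar>\<omega> m u\<bar> \<le> a m" by metis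
  show ?thesis
  proof (rule linearized_linf)
    fix m u assume mu: "(m, u) \<in> T"
    then have "\<bar>\<omega> m u\<bar> \<le> \<bar>a m\<bar>" using a[of u m] by auto
    also have "\<dots> \<le> (\<Sum>m\<in>{0..M}. \<bar>a m\<bar>)" using mu by (intro member_le_sum) auto
    finally show "\<bar>\<omega> m u\<bar> \<le> (\<Sum>m\<in>{0..M}. \<bar>a m\<bar>)" .
  qed
qed

lemma copula_proc_linf: "copula_proc P X Z J A n \<omega> \<in> linf T"
proof (rule linfI)
  fix m u
  have "\<bar>sqrt (real n) * (emp_copula n s A u - C u)\<bar> \<le> sqrt (real n)" for s :: "nat \<Rightarrow> (real^'p) \<times> (real^'q)"
  proof -
    have "\<bar>emp_copula n s A u - C u\<bar> \<le> 1" using emp_copula_01[of n s A u] C_01[of u] by (auto simp: abs_le_iff)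
    then show ?thesis by (simp add: abs_mult mult_left_le)
  qed
  from this[of "resample n m \<omega>"] this[of "resample n 0 \<omega>"]
  show "\<bar>copula_proc P X Z J A n \<omega> m u\<bar> \<le> 2 * sqrt (real n)" unfolding copula_proc_eq by auto
qed

lemma lipschitz_coords_coarse:
  assumes h: "bl_linf T k b h"
  shows "lipschitz_coords ({..M} \<times> dyadic_grid l) (k * Cinf_bound) (\<lambda>y. h (linearized (coarsen l (\<lambda>m u. y (m, u)))))"
  unfolding lipschitz_coords_def
proof (intro conjI allI)
  show "0 \<le> k * Cinf_bound" using bl_linfD(1)[OF h] Cinf_bound_pos by simp
  fix x y :: "nat \<times> (real^'p) \<Rightarrow> real"
  let ?\<Phi> = "\<lambda>y. linearized (coarsen l (\<lambda>m u. y (m, u)))" and ?s = "\<Sum>i\<in>{..M} \<times> dyadic_grid l. \<bar>x i - y i\<bar>"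
  have "sup_dist T (?\<Phi> x) (?\<Phi> y) \<le> Cinf_bound * ?s"
    unfolding coarsen_def
    by (intro sup_dist_linearized_le member_le_sum[of "(_, dyadic_floor l _)" _ "\<lambda>i. \<bar>x i - y i\<bar>"])
      (auto simp: finite_dyadic_grid dyadic_floor_in_grid)
  then have "k * sup_dist T (?\<Phi> x) (?\<Phi> y) \<le> k * (Cinf_bound * ?s)"
    using bl_linfD(1)[OF h] by (rule mult_left_mono)
  then show "\<bar>h (?\<Phi> x) - h (?\<Phi> y)\<bar> \<le> k * Cinf_bound * ?s"
    unfolding mult.assoc by (rule order_trans[OF bl_linfD(3)[OF h linearized_coarsen_linf linearized_coarsen_linf]])
qed

lemma coarse_tendsto:
  assumes h: "bl_linf T k b h"
  shows "(\<lambda>n. expectation (\<lambda>\<omega>. h (linearized (coarsen l (\<lambda>m. W n m \<omega>)))))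
    \<longlonglongrightarrow> (\<integral>\<omega>. h (linearized (coarsen l \<omega>)) \<partial>path_copies)"
  using fidi_tendsto[OF finite_dyadic_grid _ lipschitz_coords_coarse[OF h], of l b]
    bl_linfD(2)[OF h linearized_coarsen_linf] dyadic_grid_in_unit_cube by auto

lemma measurable_coarse:
  assumes "bl_linf T k b h" "\<And>m u. m \<le> M \<Longrightarrow> u \<in> unit_cube \<Longrightarrow> (\<lambda>\<omega>. Y \<omega> m u) \<in> borel_measurable Q"
  shows "(\<lambda>\<omega>. h (linearized (coarsen l (Y \<omega>)))) \<in> borel_measurable Q"
proof -
  have "(\<lambda>\<omega>. Y \<omega> (fst i) (snd i)) \<in> borel_measurable Q" if "i \<in> {..M} \<times> dyadic_grid l" for i
    using that by (intro assms(2) dyadic_grid_in_unit_cube[of _ l]) auto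
  from borel_measurable_lipschitz_coords[OF _ lipschitz_coords_coarse[OF assms(1)],
      where Y = "\<lambda>\<omega> i. Y \<omega> (fst i) (snd i)", OF _ this]
  show ?thesis by (simp add: finite_dyadic_grid)
qed

lemma sup_dist_coarsen_tendsto:
  assumes \<omega>: "\<omega> \<in> space path_copies"
  shows "(\<lambda>l. sup_dist T (linearized (coarsen l \<omega>)) (linearized \<omega>)) \<longlonglongrightarrow> 0"
proof (rule LIMSEQ_I)
  fix e :: real assume "0 < e"
  then have a: "0 < e / (2 * Cinf_bound)" using Cinf_bound_pos by simp
  have "eventually (\<lambda>l. \<forall>m\<in>{0..M}. oscillation_le (1 / 2 ^ l) (e / (2 * Cinf_bound)) (\<omega> m)) sequentially"
    by (intro eventually_ball_finite ballI continuous_on_imp_oscillation_le continuous_on_path_copies[OF \<omega>] a) simp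
  then have "eventually (\<lambda>l. norm (sup_dist T (linearized (coarsen l \<omega>)) (linearized \<omega>) - 0) < e) sequentially"
  proof eventually_elim
    case (elim l)
    have "sup_dist T (linearized (coarsen l \<omega>)) (linearized \<omega>) \<le> Cinf_bound * (e / (2 * Cinf_bound))"
      unfolding coarsen_def dist_real_def[symmetric]
    proof (rule sup_dist_linearized_le)
      fix m u assume "(m, u) \<in> T"
      then show "\<bar>\<omega> m (dyadic_floor l u) - \<omega> m u\<bar> \<le> e / (2 * Cinf_bound)"
        using oscillation_leD[OF bspec[OF elim], of m u "dyadic_floor l u"] abs_diff_dyadic_floor_le
        by (auto simp: dist_real_def abs_minus_commute dyadic_floor_in_unit_cube)
    qed
    also have "\<dots> < e" using \<open>0 < e\<close> Cinf_bound_pos by simp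
    finally show ?case
      using sup_dist_nonneg[OF T_nonempty linearized_coarsen_linf linearized_copies_linf[OF \<omega>]] by simp
  qed
  then show "\<exists>no. \<forall>l\<ge>no. norm (sup_dist T (linearized (coarsen l \<omega>)) (linearized \<omega>) - 0) < e"
    by (simp add: eventually_sequentially)
qed

lemma sup_dist_copula_proc_coarse_le:
  assumes proc: "\<forall>m\<le>M. \<forall>u\<in>unit_cube. \<bar>copula_proc P X Z J A n \<omega> m u - Cinf p C dC (W n m \<omega>) u\<bar> \<le> \<eta>"
    and osc: "\<forall>m\<le>M. oscillation_le (1 / 2 ^ l) \<eta> (deviation n m \<omega>)"
  shows "sup_dist T (copula_proc P X Z J A n \<omega>) (linearized (coarsen l (\<lambda>m. W n m \<omega>))) \<le> \<eta> + Cinf_bound * (2 * \<eta>)"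
proof -
  let ?W = "\<lambda>m. W n m \<omega>"
  have "\<bar>deviation n m \<omega> u - deviation n m \<omega> (dyadic_floor l u)\<bar> \<le> \<eta>" if "m \<le> M" "u \<in> unit_cube" for m u
    using oscillation_leD[OF osc[rule_format, OF that(1)] that(2) dyadic_floor_in_unit_cube[OF that(2)] abs_diff_dyadic_floor_le]
    by (simp add: dist_real_def)
  note dev = this this[OF le0]
  have "\<bar>?W m u - coarsen l ?W m u\<bar> \<le> 2 * \<eta>" if "(m, u) \<in> T" for m u
    using dev(1)[of m u] dev(2)[of u] that unfolding deviation_eq_W coarsen_def by (cases "m = 0") auto
  then have coarse: "sup_dist T (linearized ?W) (linearized (coarsen l ?W)) \<le> Cinf_bound * (2 * \<eta>)"
    by (rule sup_dist_linearized_le)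
  have linear: "sup_dist T (copula_proc P X Z J A n \<omega>) (linearized ?W) \<le> \<eta>"
    using proc by (intro sup_dist_least[OF T_nonempty]) (auto simp: linearized_def)
  have "linearized ?W \<in> linf T"
    using abs_proc_le[OF measurable_orthant abs_orthant_le] by (rule linearized_linf)
  from order_trans[OF sup_dist_triangle[OF T_nonempty copula_proc_linf this linearized_coarsen_linf] add_mono[OF linear coarse]]
  show ?thesis .
qed

lemma copula_proc_close:
  assumes \<eta>: "0 < \<eta>"
  shows "eventually (\<lambda>l. eventually (\<lambda>n. nearly_surely \<eta>
    (\<lambda>\<omega>. sup_dist T (copula_proc P X Z J A n \<omega>) (linearized (coarsen l (\<lambda>m. W n m \<omega>))) \<le> \<eta>)) sequentially) sequentially"
proof -
  have "0 < \<eta> / 2" using \<eta> by simp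
  then obtain a where a: "0 < a" "a \<le> \<eta> / 2" "(1 + 2 * Cinf_bound) * a \<le> \<eta> / 2"
    using exists_pos_mult_le by blast
  show ?thesis
    using eventually_deviation_oscillation_le[OF a(1), of M]
  proof eventually_elim
    case (elim l)
    show ?case
      using copula_proc_linearization[OF a(1), of M] elim
    proof eventually_elim
      case (elim n)
      show ?case
      proof (rule nearly_surely_mono[OF nearly_surely_conj[OF elim]])
        fix \<omega> assume "(\<forall>m\<le>M. \<forall>u\<in>unit_cube. \<bar>copula_proc P X Z J A n \<omega> m u - Cinf p C dC (W n m \<omega>) u\<bar> \<le> a)
            \<and> (\<forall>m\<le>M. oscillation_le (1 / 2 ^ l) a (deviation n m \<omega>))"
        then have "sup_dist T (copula_proc P X Z J A n \<omega>) (linearized (coarsen l (\<lambda>m. W n m \<omega>))) \<le> a + Cinf_bound * (2 * a)"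
          by (intro sup_dist_copula_proc_coarse_le) auto
        also have "\<dots> = (1 + 2 * Cinf_bound) * a" by (simp add: algebra_simps)
        finally show "sup_dist T (copula_proc P X Z J A n \<omega>) (linearized (coarsen l (\<lambda>m. W n m \<omega>))) \<le> \<eta>"
          using a(3) \<eta> by linarith
      qed (use a(2) in simp)
    qed
  qed
qed

theorem copula_proc_weak_conv: "weak_conv_linf T P (copula_proc P X Z J A) path_copies linearized"
proof -
  interpret N: prob_space path_copies by (rule prob_space_path_copies)
  interpret approximation: linf_approximation P path_copies T "copula_proc P X Z J A" linearized
    "\<lambda>l n \<omega>. linearized (coarsen l (\<lambda>m. W n m \<omega>))" "\<lambda>l \<omega>. linearized (coarsen l \<omega>)"
    by unfold_locales
      (auto intro: one_in_unit_cube copula_proc_linf linearized_copies_linf linearized_coarsen_linf measurable_coarse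
        measurable_proc measurable_orthant measurable_copy_eval coarse_tendsto sup_dist_coarsen_tendsto copula_proc_close)
  show ?thesis by (rule approximation.weak_conv)
qed

end

end

theorem theorem7:
  fixes P :: "'a measure"
    and X :: "nat \<Rightarrow> 'a \<Rightarrow> real^'p"
    and Z :: "nat \<Rightarrow> 'a \<Rightarrow> real^'q"
    and J :: "nat \<times> nat \<times> nat \<Rightarrow> 'a \<Rightarrow> nat"
    and A :: "(real^'q) set"
    and C' :: "real^'p \<Rightarrow> ((real^'p) \<Rightarrow>\<^sub>L real)"
    and M :: nat
  assumes P: "prob_space P"
    and X_meas: "\<And>i. X i \<in> borel_measurable P"
    and Z_meas: "\<And>i. Z i \<in> borel_measurable P"
    and iid_indep: "prob_space.indep_vars P (\<lambda>_. borel) (\<lambda>i \<omega>. (X i \<omega>, Z i \<omega>)) UNIV"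
    and iid_dist: "\<And>i. distr P borel (\<lambda>\<omega>. (X i \<omega>, Z i \<omega>)) = distr P borel (\<lambda>\<omega>. (X 0 \<omega>, Z 0 \<omega>))"
    and boot_indep: "prob_space.indep_vars P (\<lambda>_. count_space UNIV) J UNIV"
    and boot_unif: "\<And>n m i. i < n \<Longrightarrow>
          distr P (count_space UNIV) (J (n, m, i)) = measure_pmf (pmf_of_set {..<n})"
    and boot_data_indep: "\<And>S T. S \<in> sets (Pi\<^sub>M UNIV (\<lambda>_. borel)) \<Longrightarrow>
          T \<in> sets (Pi\<^sub>M UNIV (\<lambda>_. count_space UNIV)) \<Longrightarrow>
          measure P {\<omega>\<in>space P. (\<lambda>i. (X i \<omega>, Z i \<omega>)) \<in> S \<and> (\<lambda>k. J k \<omega>) \<in> T}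
          = measure P {\<omega>\<in>space P. (\<lambda>i. (X i \<omega>, Z i \<omega>)) \<in> S}
            * measure P {\<omega>\<in>space P. (\<lambda>k. J k \<omega>) \<in> T}"
    and A_borel: "A \<in> sets borel"
    and pA_pos: "pA P (Z 0) A > 0"
    and margins_cont: "\<And>k. continuous_on UNIV (condF P (X 0) (Z 0) A k)"
    and C_deriv: "\<And>u. u \<in> unit_cube \<Longrightarrow>
          (condC P (X 0) (Z 0) A has_derivative blinfun_apply (C' u)) (at u within unit_cube)"
    and C'_cont: "continuous_on unit_cube C'"
    and M: "M \<ge> 2"
  shows "\<exists>(N :: (nat \<Rightarrow> real^'p \<Rightarrow> real) measure) (B :: nat \<Rightarrow> (nat \<Rightarrow> real^'p \<Rightarrow> real) \<Rightarrow> real^'p \<Rightarrow> real).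
           prob_space N \<and>
           (\<forall>m\<le>M. centered_gaussian_process N (B m) unit_cube
              (\<lambda>u v. pA P (Z 0) A * condC P (X 0) (Z 0) A (\<chi> k. min (u $ k) (v $ k))
                     - (pA P (Z 0) A)\<^sup>2 * condC P (X 0) (Z 0) A u * condC P (X 0) (Z 0) A v)) \<and>
           (\<forall>m\<le>M. \<forall>\<omega>\<in>space N. continuous_on unit_cube (B m \<omega>)) \<and>
           prob_space.indep_vars N (\<lambda>_. Pi\<^sub>M unit_cube (\<lambda>_. borel))
              (\<lambda>m \<omega>. restrict (B m \<omega>) unit_cube) {0..M} \<and>
           weak_conv_linf ({0..M} \<times> unit_cube) P
              (\<lambda>n \<omega> m u. copula_proc P X Z J A n \<omega> m u) N
              (\<lambda>\<omega> m u. Cinf (pA P (Z 0) A) (condC P (X 0) (Z 0) A)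
                          (\<lambda>v k. blinfun_apply (C' v) (axis k 1)) (B m \<omega>) u)"
proof -
  interpret prob_space P by (rule P)
  interpret copula_sample P X Z J A C'
    by unfold_locales (fact iid_indep iid_dist boot_indep boot_unif boot_data_indep A_borel pA_pos margins_cont
        C_deriv C'_cont)+
  let ?cov = "\<lambda>u v. p * C (\<chi> k. min (u $ k) (v $ k)) - p\<^sup>2 * C u * C v"
  show ?thesis
  proof (intro exI[of _ path_copies] exI[of _ "\<lambda>m \<omega>. \<omega> m"] conjI allI impI ballI)
    show "prob_space path_copies" by (rule prob_space_path_copies)
    show "centered_gaussian_process path_copies (\<lambda>\<omega>. \<omega> m) unit_cube ?cov" for m
      using centered_gaussian_process_copy[of m] unfolding cov_def[abs_def] .
    show "continuous_on unit_cube (\<omega> m)" if "\<omega> \<in> space path_copies" for m \<omega>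
      using that by (rule continuous_on_path_copies)
    show "prob_space.indep_vars path_copies (\<lambda>_. Pi\<^sub>M unit_cube (\<lambda>_. borel)) (\<lambda>m \<omega>. restrict (\<omega> m) unit_cube) {0..M}"
      by (rule indep_restrict_copies)
    show "weak_conv_linf ({0..M} \<times> unit_cube) P (\<lambda>n \<omega> m u. copula_proc P X Z J A n \<omega> m u) path_copies
        (\<lambda>\<omega> m u. Cinf p C dC (\<omega> m) u)"
      using copula_proc_weak_conv[of M] unfolding linearized_def[abs_def] .
  qed
qed

end
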